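(* Let $\mu\in\mathbb{Z}^r$ and $u\in S_r$. Let $\lambda\in A^{(n)}$ and $w^{(n)}\in W^{(n)}_{\mathrm{Cox}}$ be the unique pair with $w^{(n)}\lambda=\mu$ and $w^{(n)}$ of minimal length; write a reduced expression $w^{(n)}=s^{(n)}_{i_1}\cdots s^{(n)}_{i_\ell}$, $w=s_{i_1}\cdots s_{i_\ell}\in W_{\mathrm{Cox}}$, $\vec w=(i_1,\dots,i_\ell)$, and $\beta_j^{(n)}=s^{(n)}_{i_\ell}*\cdots*s^{(n)}_{i_{j+1}}*\alpha^{(n)}_{i_j}$. For $p\in\mathcal{B}(u,\vec w)$ choose a reduced expression $\phi(p)=s_{u_{p,1}}\cdots s_{u_{p,t}}$ and let \[c(p)=\Big(\prod_{a=1}^{t}\sigma\big((\lambda,s_{u_{p,t}}\cdots s_{u_{p,a+1}}\alpha_{u_{p,a}})\big)\Big)\Big(\prod_{j\in f^+(p)}\frac{k^{-1}-k}{1-\gamma(-\beta^{(n)}_j;\lambda)}\Big)\Big(\prod_{j\in f^-(p)}\frac{(k^{-1}-k)\gamma(-\beta_j^{(n)};\lambda)}{1-\gamma(-\beta^{(n)}_j;\lambda)}\Big).\] Then $T_uE^{(n)}_\mu$ is a nonzero scalar multiple of $T_u\tau^\vee_{i_1}\cdots\tau^\vee_{i_\ell}x^\lambda$, and \[T_u\tau^\vee_{i_1}\cdots\tau^\vee_{i_\ell}x^\lambda=\sum_{p\in\mathcal{B}(u,\vec w)}c(p)\,x^{n\,\mathrm{wt}(p)+\phi(p)\lambda}.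\]
   Context: Fix integers $r\ge2$, $n\ge1$. Notation: $\epsilon_i$ standard basis of $\mathbb{R}^r$, $(\cdot,\cdot)$ standard inner product, $\Phi=\{\epsilon_i-\epsilon_j:i\ne j\}$, $\Phi_+=\{\epsilon_i-\epsilon_j:i<j\}$, $\alpha_i=\epsilon_i-\epsilon_{i+1}$, $\theta=\epsilon_1-\epsilon_r$, $Q=\mathbb{Z}\Phi$; $S_r$ permutes coordinates, $s_i=(i\ i+1)$, $s_\theta$ swaps coordinates $1,r$; $\ell(u)$ is Coxeter length. $\delta$ formal, $P_a^{(n)}=n\mathbb{Z}^r\oplus n^2\mathbb{Z}\delta$. Groups: $W_{\mathrm{Cox}}=Q\rtimes S_r$, $W^{(n)}_{\mathrm{Cox}}=nQ\rtimes S_r$ acting on $\mathbb{R}^r$ by affine maps ($\tau(\beta)$ = translation). $W_{\mathrm{Cox}}$ is Coxeter with generators $s_1,\dots,s_{r-1},s_0=\tau(\theta)s_\theta$; $W^{(n)}_{\mathrm{Cox}}$ with $s_i^{(n)}=s_i$ and $s_0^{(n)}=\tau(n\theta)s_\theta$ ($s_0^{(n)}(v)=(v_r+n,v_2,\dots,v_{r-1},v_1-n)$). Linear action on $\mathbb{Z}^r\oplus\mathbb{Z}\delta$: $s_i*(\mu+s\delta)=s_i\mu+s\delta$, $s_0^{(n)}*(\mu+s\delta)=s_\theta\mu+(s+n(\mu,\theta))\delta$. $\alpha_i^{(n)}=n\alpha_i$ ($1\le i\le r-1$), $\alpha_0^{(n)}=-n\theta+n^2\delta$. $A^{(n)}=\{\lambda\in\mathbb{Z}^r:\lambda_1\ge\dots\ge\lambda_r,\lambda_1-\lambda_r\le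 n\}$. Alcove walks: hyperplanes $\{v:(\alpha,v)+s=0\}$ ($\alpha\in\Phi_+$, $s\in\mathbb{Z}$) cut $\mathbb{R}^r$ into alcoves; $\mathcal{A}=\{v:v_1>\dots>v_r,v_1-v_r<1\}$; $u\mapsto u\mathcal{A}$ identifies $W_{\mathrm{Cox}}$ with alcoves. $v$ is on the positive side of $\{(\alpha,v)+s=0\}$ ($\alpha\in\Phi_+$) if $(\alpha,v)+s>0$. An alcove walk of type $\vec w=(i_1,\dots,i_\ell)$ starting at $u\in W_{\mathrm{Cox}}$ is $p=(A_0,\dots,A_\ell)$, $A_0=u$, $A_j\in\{A_{j-1},A_{j-1}s_{i_j}\}$. Fold at step $j$ if $A_j=A_{j-1}$; positive if $A_{j-1}$ is on the positive side of the hyperplane separating $A_{j-1}$ and $A_{j-1}s_{i_j}$, negative otherwise; $f^\pm(p)$ the sets of positive/negative fold steps. $\mathcal{B}(u,\vec w)$ is the set of such walks. $A_\ell=\tau(\mathrm{wt}(p))\phi(p)$, $\mathrm{wt}(p)\in Q$, $\phi(p)\in S_r$. Parameters: $k$, $G_j$ with $G_0=k$, $G_jG_{-j}=1$, $G_j$ depending only on $j$ mod $n$ ($G_{n/2}=\pm1$ fixed if $n$ even); $k,q,G_1,\dots,G_{\lfloor(n-1)/2\rfloor}$ independent indeterminates, $\mathbb{F}^{(n)}=\mathbb{C}(k,G_1,\dots,G_{\lfloor(n-1)/2\rfloor},q)$. $\sigma(a)=k^{-1}$ if $a\in n\mathbb{Z}_{>0}$, else $G_a$. $\gamma(\mu+sn^2\delta;\lambda)=q^{-sn-(\mu,\lambda)/n}\prod_{\alpha\in\Phi_+}\sigma((\lambda,\alpha))^{(\mu,\alpha)/n}$.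 Operators on $\mathbb{F}^{(n)}[x^{\pm1}]$ ($x^\mu=\prod x_i^{\mu_i}$), with $t_n(j)=j-r_n(j)$, $r_n(j)\in\{0,\dots,n-1\}$ the residue mod $n$: $T_ix^\lambda=(k-k^{-1})\frac{1-x^{-t_n((\lambda,\alpha_i))\alpha_i}}{1-x^{n\alpha_i}}x^\lambda+G_{(\lambda,\alpha_i)}x^{s_i\lambda}$ ($1\le i\le r-1$; invertible); $\omega x^\lambda=q^{-\lambda_r}x^{(\lambda_r,\lambda_1,\dots,\lambda_{r-1})}$; $Y_i=T_{i-1}^{-1}\cdots T_1^{-1}\omega T_{r-1}\cdots T_i$; for $u\in S_r$ with reduced word $u=s_{j_1}\cdots s_{j_m}$, $T_u=T_{j_1}\cdots T_{j_m}$. $E^{(n)}_\nu$ ($\nu\in\mathbb{Z}^r$) is the unique Laurent polynomial with coefficient $1$ at $x^\nu$ and $Y_iE^{(n)}_\nu=\gamma(n\epsilon_i;\nu)E^{(n)}_\nu$ for all $i$; the $E^{(n)}_\nu$ form a basis of $\mathbb{F}^{(n)}[x^{\pm1}]$ and $\gamma(-\alpha_i^{(n)};\nu)\ne1$ for all $\nu$, $i$. Intertwiners: let $T_i^\vee=T_i$ for $1\le i\le r-1$ and $T_0^\vee f=T_{s_\theta}^{-1}(x^{-n\theta}f)$, where $T_{s_\theta}=T_1T_2\cdots T_{r-1}\cdots T_2T_1$. For $0\le i\le r-1$ let $R_i$ be the operator with $R_iE^{(n)}_\nu=(1-\gamma(-\alpha_i^{(n)};\nu))^{-1}E^{(n)}_\nu$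 for all $\nu$, and $\tau_i^\vee=T_i^\vee+(k^{-1}-k)R_i$. *)

theory Defs
  imports
    "HOL-Analysis.Finite_Cartesian_Product"
    "HOL-Library.Poly_Mapping"
    "HOL-Computational_Algebra.Fraction_Field"
    "HOL-Combinatorics.Transposition"
    "HOL-Algebra.Group"
begin

(* HOL-Algebra's notation for group inverses would shadow the inverse of a function. *)
unbundle no m_inv_syntax

text \<open>
  The coordinates of \<open>\<int>\<^sup>r\<close> and \<open>\<real>\<^sup>r\<close> are indexed by a finite linearly ordered type of
  cardinality \<open>r\<close>; \<open>coord i\<close> is its \<open>i\<close>-th element, for \<open>1 \<le> i \<le> r\<close>.
\<close>

type_synonym 'r weight = "(int, 'r) vec"

definition coord :: "nat \<Rightarrow> 'a::{finite,linorder}"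
  where "coord i = sorted_list_of_set (UNIV :: 'a set) ! (i - 1)"

definition eps :: "'r \<Rightarrow> 'r::finite weight"
  where "eps a = axis a 1"

text \<open>The standard inner product of an integral vector with an integral or a real vector.\<close>

definition ip :: "'r weight \<Rightarrow> ('a::ring_1, 'r::finite) vec \<Rightarrow> 'a"
  where "ip x y = (\<Sum>a\<in>UNIV. of_int (x $ a) * y $ a)"

definition Roots :: "('r::finite weight) set"
  where "Roots = {eps a - eps b | a b. a \<noteq> b}"

definition pos_roots :: "('r::{finite,linorder} weight) set"
  where "pos_roots = {eps a - eps b | a b. a < b}"

definition simple_root :: "nat \<Rightarrow> 'r::{finite,linorder} weight"
  where "simple_root i = eps (coord i) - eps (coord (i + 1))"

definition theta :: "'r::{finite,linorder} weight"
  where "theta = eps (coord 1) - eps (coord CARD('r))"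

definition root_lattice :: "('r::finite weight) set"
  where "root_lattice = {\<Sum>\<alpha>\<in>Roots. c \<alpha> *s \<alpha> | c. True}"


section \<open>The symmetric group and the affine Weyl groups\<close>

definition sym_gp :: "('r::finite \<Rightarrow> 'r) monoid"
  where "sym_gp = \<lparr>carrier = {p. bij p}, mult = (\<circ>), one = id\<rparr>"

text \<open>The left action with \<open>perm_act p (eps a) = eps (p a)\<close>.\<close>

definition perm_act :: "('r \<Rightarrow> 'r) \<Rightarrow> ('a, 'r) vec \<Rightarrow> ('a, 'r::finite) vec"
  where "perm_act p v = (\<chi> a. v $ inv p a)"

definition s_perm :: "nat \<Rightarrow> 'r \<Rightarrow> 'r::{finite,linorder}"
  where "s_perm i = Transposition.transpose (coord i) (coord (i + 1))"

definition s_theta :: "'r \<Rightarrow> 'r::{finite,linorder}"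
  where "s_theta = Transposition.transpose (coord 1) (coord CARD('r))"

type_synonym 'r aff = "'r weight \<times> ('r \<Rightarrow> 'r)"

text \<open>
  The group \<open>nQ \<rtimes> S\<^sub>r\<close>; the pair \<open>(\<beta>, p)\<close> stands for \<open>\<tau>(\<beta>) p\<close>. The case \<open>n = 1\<close> is the
  group \<open>Q \<rtimes> S\<^sub>r\<close>.
\<close>

definition WCox :: "nat \<Rightarrow> ('r::finite aff) monoid"
  where "WCox n =
    \<lparr>carrier = (\<lambda>\<beta>. int n *s \<beta>) ` root_lattice \<times> {p. bij p},
     mult = (\<lambda>(\<beta>, p) (\<beta>', p'). (\<beta> + perm_act p \<beta>', p \<circ> p')),
     one = (0, id)\<rparr>"

definition aff_act :: "'r aff \<Rightarrow> ('a::ring_1, 'r) vec \<Rightarrow> ('a, 'r::finite) vec"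
  where "aff_act w v = (\<chi> a. of_int (fst w $ a)) + perm_act (snd w) v"

definition s_aff :: "nat \<Rightarrow> nat \<Rightarrow> 'r::{finite,linorder} aff"
  where "s_aff n i = (if i = 0 then (int n *s theta, s_theta) else (0, s_perm i))"

definition word_prod :: "('g, 'b) monoid_scheme \<Rightarrow> (nat \<Rightarrow> 'g) \<Rightarrow> nat list \<Rightarrow> 'g"
  where "word_prod G s ws = foldr (\<lambda>i g. s i \<otimes>\<^bsub>G\<^esub> g) ws \<one>\<^bsub>G\<^esub>"

text \<open>Coxeter length and reduced words with respect to the generators \<open>s i\<close>, \<open>i \<in> I\<close>.\<close>

definition cox_length :: "('g, 'b) monoid_scheme \<Rightarrow> (nat \<Rightarrow> 'g) \<Rightarrow> nat set \<Rightarrow> 'g \<Rightarrow> nat"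
  where "cox_length G s I g =
    (LEAST l. \<exists>ws. set ws \<subseteq> I \<and> length ws = l \<and> word_prod G s ws = g)"

definition reduced_word ::
    "('g, 'b) monoid_scheme \<Rightarrow> (nat \<Rightarrow> 'g) \<Rightarrow> nat set \<Rightarrow> nat list \<Rightarrow> 'g \<Rightarrow> bool"
  where "reduced_word G s I ws g \<longleftrightarrow>
    set ws \<subseteq> I \<and> word_prod G s ws = g \<and> length ws = cox_length G s I g"

definition perm_reduced :: "nat list \<Rightarrow> ('r \<Rightarrow> 'r::{finite,linorder}) \<Rightarrow> bool"
  where "perm_reduced ws p \<longleftrightarrow> reduced_word sym_gp s_perm {1..<CARD('r)} ws p"

definition aff_length :: "nat \<Rightarrow> 'r::{finite,linorder} aff \<Rightarrow> nat"
  where "aff_length n w = cox_length (WCox n) (s_aff n) {0..<CARD('r)} w"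

definition aff_reduced :: "nat \<Rightarrow> nat list \<Rightarrow> 'r::{finite,linorder} aff \<Rightarrow> bool"
  where "aff_reduced n ws w \<longleftrightarrow> reduced_word (WCox n) (s_aff n) {0..<CARD('r)} ws w"

definition fund_alcove_weights :: "nat \<Rightarrow> ('r::{finite,linorder} weight) set"
  where "fund_alcove_weights n =
    {lam. (\<forall>i\<in>{1..<CARD('r)}. lam $ coord i \<ge> lam $ coord (i + 1)) \<and>
        lam $ coord 1 - lam $ coord CARD('r) \<le> int n}"

text \<open>The pair \<open>(\<mu>, d)\<close> stands for \<open>\<mu> + d\<delta>\<close>.\<close>

definition lin_act :: "nat \<Rightarrow> nat \<Rightarrow> 'r weight \<times> int \<Rightarrow> 'r::{finite,linorder} weight \<times> int"
  where "lin_act n i m =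
    (if i = 0 then (perm_act s_theta (fst m), snd m + int n * ip (fst m) theta)
     else (perm_act (s_perm i) (fst m), snd m))"

definition aff_simple_root :: "nat \<Rightarrow> nat \<Rightarrow> 'r::{finite,linorder} weight \<times> int"
  where "aff_simple_root n i =
    (if i = 0 then (- (int n *s theta), (int n)\<^sup>2) else (int n *s simple_root i, 0))"

text \<open>\<open>\<beta>\<^sub>j = s\<^bsub>i\<^sub>\<ell>\<^esub> * \<dots> * s\<^bsub>i\<^sub>j\<^sub>+\<^sub>1\<^esub> * \<alpha>\<^bsub>i\<^sub>j\<^esub>\<close> for the word \<open>ws = (i\<^sub>1, \<dots>, i\<^sub>\<ell>)\<close> and \<open>1 \<le> j \<le> \<ell>\<close>.\<close>

definition beta :: "nat \<Rightarrow> nat list \<Rightarrow> nat \<Rightarrow> 'r::{finite,linorder} weight \<times> int"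
  where "beta n ws j = fold (lin_act n) (drop j ws) (aff_simple_root n (ws ! (j - 1)))"


section \<open>Alcove walks\<close>

definition fund_alcove :: "((real, 'r::{finite,linorder}) vec) set"
  where "fund_alcove =
    {v. (\<forall>i\<in>{1..<CARD('r)}. v $ coord i > v $ coord (i + 1)) \<and>
        v $ coord 1 - v $ coord CARD('r) < 1}"

text \<open>The alcove identified with \<open>w \<in> WCox 1\<close>.\<close>

definition alcove :: "'r aff \<Rightarrow> ((real, 'r::{finite,linorder}) vec) set"
  where "alcove w = aff_act w ` fund_alcove"

text \<open>The two sides of the hyperplane \<open>{v. ip \<alpha> v + of_int s = 0}\<close>.\<close>

definition pos_side :: "'r weight \<Rightarrow> int \<Rightarrow> ((real, 'r::finite) vec) set"
  where "pos_side \<alpha> s = {v. ip \<alpha> v + of_int s > 0}"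

definition neg_side :: "'r weight \<Rightarrow> int \<Rightarrow> ((real, 'r::finite) vec) set"
  where "neg_side \<alpha> s = {v. ip \<alpha> v + of_int s < 0}"

definition separates ::
    "'r weight \<Rightarrow> int \<Rightarrow> ((real, 'r) vec) set \<Rightarrow> ((real, 'r::finite) vec) set \<Rightarrow> bool"
  where "separates \<alpha> s A B \<longleftrightarrow>
    A \<subseteq> pos_side \<alpha> s \<and> B \<subseteq> neg_side \<alpha> s \<or> A \<subseteq> neg_side \<alpha> s \<and> B \<subseteq> pos_side \<alpha> s"

definition alcove_walks ::
    "'r aff \<Rightarrow> nat list \<Rightarrow> 'r::{finite,linorder} aff list set"
  where "alcove_walks u ws =
    {p. length p = length ws + 1 \<and> p ! 0 = u \<and>
        (\<forall>j\<in>{1..length ws}.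
           p ! j \<in> {p ! (j - 1), p ! (j - 1) \<otimes>\<^bsub>WCox 1\<^esub> s_aff 1 (ws ! (j - 1))})}"

definition folds ::
    "nat list \<Rightarrow> 'r::{finite,linorder} aff list \<Rightarrow> nat set"
  where "folds ws p = {j\<in>{1..length ws}. p ! j = p ! (j - 1)}"

(* Exactly one hyperplane separates the adjacent alcoves w and w s_i. *)
definition starts_pos :: "'r::{finite,linorder} aff \<Rightarrow> nat \<Rightarrow> bool"
  where "starts_pos w i \<longleftrightarrow>
    (\<exists>\<alpha>\<in>pos_roots. \<exists>s. separates \<alpha> s (alcove w) (alcove (w \<otimes>\<^bsub>WCox 1\<^esub> s_aff 1 i)) \<and>
       alcove w \<subseteq> pos_side \<alpha> s)"

definition pos_folds ::
    "nat list \<Rightarrow> 'r::{finite,linorder} aff list \<Rightarrow> nat set"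
  where "pos_folds ws p = {j\<in>folds ws p. starts_pos (p ! (j - 1)) (ws ! (j - 1))}"

definition neg_folds ::
    "nat list \<Rightarrow> 'r::{finite,linorder} aff list \<Rightarrow> nat set"
  where "neg_folds ws p = {j\<in>folds ws p. \<not> starts_pos (p ! (j - 1)) (ws ! (j - 1))}"

definition walk_wt :: "('r::finite aff) list \<Rightarrow> 'r weight"
  where "walk_wt p = fst (last p)"

definition walk_phi :: "('r::finite aff) list \<Rightarrow> 'r \<Rightarrow> 'r"
  where "walk_phi p = snd (last p)"


section \<open>The field of parameters\<close>

text \<open>
  Rational functions over the complex numbers in indeterminates indexed by \<open>'v\<close>. The first two
  indeterminates are \<open>k\<close> and \<open>q\<close>, the remaining ones are \<open>G\<^sub>1, G\<^sub>2, \<dots>\<close>; for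
  \<open>CARD('v) = (n - 1) div 2 + 2\<close> this is the field of parameters \<open>\<complex>(k, G\<^sub>1, \<dots>, q)\<close>.
\<close>

type_synonym 'v pfield = "(('v \<Rightarrow>\<^sub>0 nat) \<Rightarrow>\<^sub>0 complex) fract"

definition indet :: "nat \<Rightarrow> 'v::{finite,linorder} pfield"
  where "indet j =
    Fract (Poly_Mapping.single (Poly_Mapping.single (coord j :: 'v) 1) 1) 1"

definition kpar :: "'v::{finite,linorder} pfield"
  where "kpar = indet 1"

definition qpar :: "'v::{finite,linorder} pfield"
  where "qpar = indet 2"

text \<open>
  The sign \<open>sg\<close> is the value of \<open>G\<^sub>n\<^sub>/\<^sub>2\<close> for even \<open>n\<close>. The relation \<open>G\<^sub>j G\<^sub>-\<^sub>j = 1\<close> is imposed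
  for \<open>j\<close> not divisible by \<open>n\<close>.
\<close>

definition Gpar :: "nat \<Rightarrow> 'v pfield \<Rightarrow> int \<Rightarrow> 'v::{finite,linorder} pfield"
  where "Gpar n sg j =
    (let a = nat (j mod int n) in
     if a = 0 then kpar
     else if 2 * a < n then indet (a + 2)
     else if 2 * a = n then sg
     else inverse (indet (n - a + 2)))"

definition sigma :: "nat \<Rightarrow> 'v pfield \<Rightarrow> int \<Rightarrow> 'v::{finite,linorder} pfield"
  where "sigma n sg a = (if a > 0 \<and> int n dvd a then inverse kpar else Gpar n sg a)"

text \<open>
  \<open>\<gamma>(\<mu> + d\<delta>; \<lambda>)\<close> for \<open>\<mu> \<in> n\<int>\<^sup>r\<close> and \<open>d \<in> n\<^sup>2\<int>\<close>; the divisions are exact on this domain.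
\<close>

definition gamma ::
    "nat \<Rightarrow> 'v pfield \<Rightarrow> 'r weight \<times> int \<Rightarrow> 'r::{finite,linorder} weight \<Rightarrow>
     'v::{finite,linorder} pfield"
  where "gamma n sg m lam =
    qpar powi (- (snd m div (int n)\<^sup>2) * int n - ip (fst m) lam div int n) *
    (\<Prod>\<alpha>\<in>pos_roots. sigma n sg (ip lam \<alpha>) powi (ip (fst m) \<alpha> div int n))"


section \<open>Operators on Laurent polynomials\<close>

text \<open>The Laurent polynomial ring is the group algebra of \<open>\<int>\<^sup>r\<close>.\<close>

type_synonym ('r, 'v) laurent = "'r weight \<Rightarrow>\<^sub>0 'v pfield"

definition x_pow :: "'r::finite weight \<Rightarrow> ('r, 'v::{finite,linorder}) laurent"
  where "x_pow \<mu> = Poly_Mapping.single \<mu> 1"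

definition smul ::
    "'v pfield \<Rightarrow> ('r, 'v) laurent \<Rightarrow> ('r::finite, 'v::{finite,linorder}) laurent"
  where "smul c f = Poly_Mapping.single 0 c * f"

definition lin_ext ::
    "('r weight \<Rightarrow> ('r, 'v) laurent) \<Rightarrow> ('r, 'v) laurent \<Rightarrow>
     ('r::finite, 'v::{finite,linorder}) laurent"
  where "lin_ext h f = (\<Sum>\<mu>\<in>Poly_Mapping.keys f. smul (Poly_Mapping.lookup f \<mu>) (h \<mu>))"

text \<open>The quotient of \<open>f\<close> by a divisor \<open>g \<noteq> 0\<close> of \<open>f\<close>; the Laurent polynomials form a domain.\<close>

definition laurent_quot ::
    "('r, 'v) laurent \<Rightarrow> ('r, 'v) laurent \<Rightarrow>
     ('r::finite, 'v::{finite,linorder}) laurent"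
  where "laurent_quot f g = (THE h. h * g = f)"

definition t_floor :: "nat \<Rightarrow> int \<Rightarrow> int"
  where "t_floor n j = j - j mod int n"

definition T_op ::
    "nat \<Rightarrow> 'v pfield \<Rightarrow> nat \<Rightarrow> ('r, 'v) laurent \<Rightarrow>
     ('r::{finite,linorder}, 'v::{finite,linorder}) laurent"
  where "T_op n sg i = lin_ext (\<lambda>\<mu>.
    smul (kpar - inverse kpar)
      (laurent_quot (1 - x_pow (- (t_floor n (ip \<mu> (simple_root i)) *s simple_root i)))
                    (1 - x_pow (int n *s simple_root i)) * x_pow \<mu>)
    + smul (Gpar n sg (ip \<mu> (simple_root i))) (x_pow (perm_act (s_perm i) \<mu>)))"

text \<open>\<open>(\<mu>\<^sub>1, \<dots>, \<mu>\<^sub>r) \<mapsto> (\<mu>\<^sub>r, \<mu>\<^sub>1, \<dots>, \<mu>\<^sub>r\<^sub>-\<^sub>1)\<close>\<close>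

definition rotate_weight :: "'r weight \<Rightarrow> 'r::{finite,linorder} weight"
  where "rotate_weight \<mu> =
    \<mu> $ coord CARD('r) *s eps (coord 1) +
    (\<Sum>i\<in>{1..<CARD('r)}. \<mu> $ coord i *s eps (coord (i + 1)))"

definition omega ::
    "('r, 'v) laurent \<Rightarrow> ('r::{finite,linorder}, 'v::{finite,linorder}) laurent"
  where "omega = lin_ext (\<lambda>\<mu>. smul (qpar powi (- (\<mu> $ coord CARD('r)))) (x_pow (rotate_weight \<mu>)))"

definition T_inv ::
    "nat \<Rightarrow> 'v pfield \<Rightarrow> nat \<Rightarrow> ('r, 'v) laurent \<Rightarrow>
     ('r::{finite,linorder}, 'v::{finite,linorder}) laurent"
  where "T_inv n sg i = inv (T_op n sg i)"

definition comp_list :: "('a \<Rightarrow> 'a) list \<Rightarrow> 'a \<Rightarrow> 'a"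
  where "comp_list fs = foldr (\<circ>) fs id"

definition Y_op ::
    "nat \<Rightarrow> 'v pfield \<Rightarrow> nat \<Rightarrow> ('r, 'v) laurent \<Rightarrow>
     ('r::{finite,linorder}, 'v::{finite,linorder}) laurent"
  where "Y_op n sg i =
    comp_list (map (T_inv n sg) (rev [1..<i])) \<circ> omega \<circ>
    comp_list (map (T_op n sg) (rev [i..<CARD('r)]))"

text \<open>The operator \<open>T\<^sub>u\<close>, for \<open>ws\<close> a reduced word of \<open>u \<in> S\<^sub>r\<close>.\<close>

definition T_word ::
    "nat \<Rightarrow> 'v pfield \<Rightarrow> nat list \<Rightarrow> ('r, 'v) laurent \<Rightarrow>
     ('r::{finite,linorder}, 'v::{finite,linorder}) laurent"
  where "T_word n sg ws = comp_list (map (T_op n sg) ws)"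

definition E_poly ::
    "nat \<Rightarrow> 'v pfield \<Rightarrow> 'r weight \<Rightarrow>
     ('r::{finite,linorder}, 'v::{finite,linorder}) laurent"
  where "E_poly n sg \<nu> =
    (THE f. Poly_Mapping.lookup f \<nu> = 1 \<and>
       (\<forall>i\<in>{1..CARD('r)}. Y_op n sg i f = smul (gamma n sg (int n *s eps (coord i), 0) \<nu>) f))"


section \<open>Intertwiners\<close>

definition T_check ::
    "nat \<Rightarrow> 'v pfield \<Rightarrow> nat \<Rightarrow> ('r, 'v) laurent \<Rightarrow>
     ('r::{finite,linorder}, 'v::{finite,linorder}) laurent"
  where "T_check n sg i f =
    (if i = 0
     then inv (T_word n sg ([1..<CARD('r)] @ rev [1..<CARD('r) - 1]))
            (x_pow (- (int n *s (theta :: 'r weight))) * f)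
     else T_op n sg i f)"

definition R_op ::
    "nat \<Rightarrow> 'v pfield \<Rightarrow> nat \<Rightarrow> ('r, 'v) laurent \<Rightarrow>
     ('r::{finite,linorder}, 'v::{finite,linorder}) laurent"
  where "R_op n sg i =
    (THE R. Vector_Spaces.linear smul smul R \<and>
       (\<forall>\<nu>. R (E_poly n sg \<nu>) =
          smul (inverse (1 - gamma n sg (- aff_simple_root n i) \<nu>)) (E_poly n sg \<nu>)))"

definition tau_check ::
    "nat \<Rightarrow> 'v pfield \<Rightarrow> nat \<Rightarrow> ('r, 'v) laurent \<Rightarrow>
     ('r::{finite,linorder}, 'v::{finite,linorder}) laurent"
  where "tau_check n sg i f = T_check n sg i f + smul (inverse kpar - kpar) (R_op n sg i f)"


section \<open>The coefficient of an alcove walk\<close>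

text \<open>\<open>us\<close> is a reduced word of \<open>walk_phi p\<close>.\<close>

definition walk_coeff ::
    "nat \<Rightarrow> 'v pfield \<Rightarrow> 'r weight \<Rightarrow> nat list \<Rightarrow> nat list \<Rightarrow>
     'r::{finite,linorder} aff list \<Rightarrow> 'v::{finite,linorder} pfield"
  where "walk_coeff n sg lam ws us p =
    (\<Prod>a\<in>{1..length us}. sigma n sg
       (ip lam (fold (\<lambda>i. perm_act (s_perm i)) (drop a us) (simple_root (us ! (a - 1)))))) *
    (\<Prod>j\<in>pos_folds ws p.
       (inverse kpar - kpar) / (1 - gamma n sg (- beta n ws j) lam)) *
    (\<Prod>j\<in>neg_folds ws p.
       (inverse kpar - kpar) * gamma n sg (- beta n ws j) lam /
       (1 - gamma n sg (- beta n ws j) lam))"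

end

theory Submission
  imports Defs
begin

text \<open>
  The affine Hecke algebra, with basis \<open>x\<^sup>\<beta> T\<^sub>u\<close>, acts on the Laurent polynomials, and for \<open>lam\<close> in the
  closed alcove the monomial \<open>x\<^sup>l\<^sup>a\<^sup>m\<close> generates a quotient of it in which \<open>x\<^sup>\<beta> T\<^sub>u\<close> becomes a multiple of
  \<open>x\<^sup>n\<^sup>\<beta>\<^sup>+\<^sup>u\<^sup>l\<^sup>a\<^sup>m\<close>. Left and right multiplications commute, so the relations of the Hecke algebra need only be
  verified on the unit; they are then inherited by the operators on Laurent polynomials.

  The relations make \<open>\<tau>\<^sub>i\<close>, with its spectral operator replaced by the scalar by which it acts, an
  intertwiner between joint eigenspaces of the \<open>Y\<^sub>i\<close>; the case \<open>i = 0\<close> is conjugate to the case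
  \<open>i = r - 1\<close> under the element of length \<open>0\<close>. Starting from the eigenvectors \<open>x\<^sup>l\<^sup>a\<^sup>m\<close>, products of
  intertwiners along shortest words yield joint eigenvectors that are triangular with respect to
  the length of the word, hence a basis. Comparing exponents of \<open>q\<close>, the joint eigenspaces are lines.

  For the expansion, the product of the factors \<open>T\<^sub>i + b\<close> is multiplied onto \<open>T\<^sub>u\<close> from the right. There
  \<open>x\<^sup>\<beta> T\<^sub>u T\<^sub>i\<close> is the basis element of the adjacent alcove, plus \<open>(k - k\<^sup>-\<^sup>1) x\<^sup>\<beta> T\<^sub>u\<close> if the crossing starts on
  the negative side, so every factor either crosses a wall or folds.
\<close>

section \<open>Coordinates and weights\<close>

text \<open>The polynomials \<open>E_poly\<close> and the operators \<open>R_op\<close> are definite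
  descriptions, which say nothing before a joint eigenbasis is known to exist. The basis therefore
  has to be built from \<open>T_check\<close> and explicit scalars \<open>bcoef\<close>; the passage
  to \<open>tau_check\<close> is possible only once the eigenspaces are known to be lines. Shortness
  of the words is used twice. Every letter then moves the weight, so the weight lies off the wall of
  that letter; there \<gamma> has a nonzero exponent of q, and 1 - \<gamma> cannot vanish. Moreover
  the eigenvalues follow the reflection only because \<sigma>(j)\<sigma>(-j) = 1, which fails at j =
  0, that is, on the wall. The value k^{-1} of \<sigma> comes from the far wall of the closed
  alcove: where a pairing equals n, the quotient in T_i contributes -(k - k^{-1}), which turns the
  coefficient k into k^{-1}. The two kinds of folds come from one identity: for b = (k^{-1} - k)/(1
  - \<gamma>) the sum b + (k - k^{-1}) equals b\<gamma>. So the second term of x^\<beta> T_u T_i and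
  the scalar b merge into the factor of a negative fold.\<close>

lemma coord_strict_mono:
  assumes "1 \<le> i" "i < j" "j \<le> CARD('a)"
  shows "(coord i :: 'a::{finite,linorder}) < coord j"
proof -
  let ?xs = "sorted_list_of_set (UNIV :: 'a set)"
  have "sorted_wrt (<) ?xs" by (simp add: strict_sorted_list_of_set)
  moreover have "length ?xs = CARD('a)" by simp
  ultimately show ?thesis
    using assms sorted_wrt_nth_less[of "(<)" ?xs "i-1" "j-1"] by (simp add: coord_def)
qed

lemma coord_less_iff:
  assumes "i \<in> {1..CARD('a)}" "j \<in> {1..CARD('a)}"
  shows "(coord i :: 'a::{finite,linorder}) < coord j \<longleftrightarrow> i < j"
  using assms coord_strict_mono[where 'a='a, of i j] coord_strict_mono[where 'a='a, of j i]
  by (metis atLeastAtMost_iff linorder_neqE_nat order_less_asym order_less_irrefl)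

lemma coord_eq_iff:
  assumes "i \<in> {1..CARD('a)}" "j \<in> {1..CARD('a)}"
  shows "(coord i :: 'a::{finite,linorder}) = coord j \<longleftrightarrow> i = j"
  using assms coord_less_iff[where 'a='a, of i j] coord_less_iff[where 'a='a, of j i]
  by (metis linorder_neqE_nat order_less_irrefl)

text \<open>Positions turn questions about the order of coordinates into arithmetic on natural
  numbers.\<close>

definition coord_index :: "'a::{finite,linorder} \<Rightarrow> nat"
  where "coord_index a = (THE i. i \<in> {1..CARD('a)} \<and> coord i = a)"

lemma coord_index:
  "coord_index (a::'a::{finite,linorder}) \<in> {1..CARD('a)}" "coord (coord_index a) = a"
proof -
  let ?xs = "sorted_list_of_set (UNIV :: 'a set)"
  have "a \<in> set ?xs" by simp
  then obtain m where m: "m < CARD('a)" "?xs ! m = a" by (metis in_set_conv_nth length_sorted_list_of_set)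
  have "Suc m \<in> {1..CARD('a)} \<and> coord (Suc m) = a" using m by (auto simp: coord_def)
  then have "\<exists>!i. i \<in> {1..CARD('a)} \<and> coord i = a"
    using coord_eq_iff by blast
  from theI'[OF this] show "coord_index (a::'a::{finite,linorder}) \<in> {1..CARD('a)}" "coord (coord_index a) = a"
    by (auto simp: coord_index_def)
qed

lemma coord_index_bounds [simp]:
  "Suc 0 \<le> coord_index (a::'a::{finite,linorder})" "0 < coord_index a" "coord_index a \<le> CARD('a)"
  using coord_index(1)[of a] by auto

lemma coord_coord_index [simp]: "coord (coord_index a) = a"
  by (rule coord_index)

lemma coord_index_coord [simp]:
  assumes "1 \<le> i" "i \<le> CARD('a)"
  shows "coord_index (coord i :: 'a::{finite,linorder}) = i"
  using assms coord_index[of "coord i :: 'a"] 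
    coord_eq_iff[where 'a='a, of "coord_index (coord i :: 'a)" i] by simp

lemma coord_index_less_iff: "a < b \<longleftrightarrow> coord_index a < coord_index b" for a b :: "'a::{finite,linorder}"
  using coord_less_iff[where 'a='a, of "coord_index a" "coord_index b"]
  by simp

lemma coord_index_le_iff: "a \<le> b \<longleftrightarrow> coord_index a \<le> coord_index b" for a b :: "'a::{finite,linorder}"
  by (meson coord_index_less_iff linorder_not_le)

lemma coord_index_inj [simp]: "coord_index a = coord_index b \<longleftrightarrow> a = b" for a b :: "'a::{finite,linorder}"
  by (metis coord_coord_index)

lemma eq_coord_iff:
  assumes "1 \<le> i" "i \<le> CARD('a)"
  shows "a = (coord i :: 'a::{finite,linorder}) \<longleftrightarrow> coord_index a = i"
  using assms by (metis coord_coord_index coord_index_coord)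

lemma s_perm_apply:
  assumes "1 \<le> i" "i < CARD('a)"
  shows "s_perm i a = (coord (if coord_index a = i then i + 1 else if coord_index a = i + 1 then i
    else coord_index a) :: 'a::{finite,linorder})"
  using assms by (auto simp: s_perm_def Transposition.transpose_def eq_coord_iff)

lemma coord_index_s_perm:
  assumes "1 \<le> i" "i < CARD('a)"
  shows "coord_index (s_perm i a :: 'a::{finite,linorder}) =
    (if coord_index a = i then i + 1 else if coord_index a = i + 1 then i else coord_index a)"
  using assms by (simp add: s_perm_apply)

lemma s_perm_coord:
  assumes "1 \<le> i" "i < CARD('a)"
  shows "s_perm i (coord i) = (coord (i+1) :: 'a::{finite,linorder})"
    "s_perm i (coord (i+1)) = (coord i :: 'a)"
  by (auto simp: s_perm_def)

lemma s_perm_invol [simp]: "s_perm i (s_perm i a) = a"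
  by (simp add: s_perm_def)

lemma s_perm_comp_invol [simp]: "s_perm i \<circ> s_perm i = id"
  by (auto simp: fun_eq_iff)

lemma bij_s_perm [simp]: "bij (s_perm i)"
  by (rule involuntory_imp_bij) simp

lemma inv_s_perm [simp]: "inv (s_perm i) = s_perm i"
  by (rule inv_unique_comp) auto

lemma s_theta_invol [simp]: "s_theta (s_theta a) = a"
  by (simp add: s_theta_def)

lemma bij_s_theta [simp]: "bij s_theta"
  by (rule involuntory_imp_bij) simp

lemma inv_s_theta [simp]: "inv s_theta = s_theta"
  by (rule inv_unique_comp) auto

text \<open>No position lies strictly between two adjacent ones, so only the swapped pair itself can
  change its order. Inversions, descents, eigenvalues and walls are all tracked through this
  fact.\<close>

lemma s_perm_less_iff:
  assumes i: "1 \<le> i" "i < CARD('a)" and "a \<noteq> b" "{a, b} \<noteq> {coord i, coord (i + 1)}"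
  shows "(s_perm i a :: 'a::{finite,linorder}) < s_perm i b \<longleftrightarrow> a < b"
proof -
  have "coord_index a < coord_index b \<or> coord_index b < coord_index a" using assms 
    by (metis coord_index_inj linorder_neqE_nat)
  moreover have "\<not> (coord_index a = i \<and> coord_index b = i+1)" "\<not> (coord_index b = i \<and> coord_index a = i+1)"
    using assms(4) by (metis coord_coord_index insert_commute)+
  ultimately show ?thesis
    using i unfolding coord_index_less_iff[of a b] coord_index_less_iff[of "s_perm i a"] coord_index_s_perm[OF i]
    by (simp split: if_splits) linarith+
qed

text \<open>The finite part of the length-zero element of the extended affine group. Conjugation by
  it shifts simple reflections by one index and turns the last one into the reflection in
  \<theta>.\<close>

definition cyc :: "'a \<Rightarrow> 'a::{finite,linorder}"
  where "cyc a = (if coord_index a = CARD('a) then coord 1 else coord (coord_index a + 1))"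

definition cyc_inv :: "'a \<Rightarrow> 'a::{finite,linorder}"
  where "cyc_inv a = (if coord_index a = 1 then coord CARD('a) else coord (coord_index a - 1))"

lemma coord_index_cyc: "coord_index (cyc (a::'a::{finite,linorder})) = 
  (if coord_index a = CARD('a) then 1 else coord_index a + 1)"
proof -
  have "Suc 0 \<le> CARD('a)" "coord_index a \<le> CARD('a)" using coord_index_bounds[of a] by (linarith, simp)
  then show ?thesis using coord_index_bounds(3)[of a]
    by (auto simp: cyc_def simp del: coord_index_bounds intro!: coord_index_coord)
qed

lemma coord_index_cyc_inv: "coord_index (cyc_inv (a::'a::{finite,linorder})) = 
  (if coord_index a = 1 then CARD('a) else coord_index a - 1)"
proof -
  have "Suc 0 \<le> CARD('a)" "coord_index a \<le> CARD('a)" "1 \<le> coord_index a" using coord_index_bounds[of a] by (linarith, simp_all)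
  then show ?thesis using coord_index_bounds[of a]
    by (auto simp: cyc_inv_def simp del: coord_index_bounds intro!: coord_index_coord)
qed

lemma cyc_cyc_inv [simp]: "cyc (cyc_inv a) = a" "cyc_inv (cyc a) = (a::'a::{finite,linorder})"
  using coord_index_bounds[of a] by (auto simp: coord_index_inj[symmetric] coord_index_cyc coord_index_cyc_inv 
    simp del: coord_index_inj coord_index_bounds)

lemma bij_cyc [simp]: "bij cyc" "bij cyc_inv"
  by (rule o_bij[of cyc_inv], auto) (rule o_bij[of cyc], auto)

lemma inv_cyc [simp]: "inv cyc = cyc_inv" "inv cyc_inv = cyc"
  by (rule inv_unique_comp; auto)+

section \<open>Weights and the action of permutations on them\<close>

lemma eps_nth [simp]: "eps a $ b = (if b = a then 1 else 0)"
  by (auto simp: eps_def axis_def)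

lemma perm_act_nth [simp]: "perm_act p v $ a = v $ inv p a"
  by (simp add: perm_act_def)

lemma perm_act_id [simp]: "perm_act id v = v"
  by (simp add: vec_eq_iff)

lemma perm_act_comp: "bij p \<Longrightarrow> bij p' \<Longrightarrow> perm_act (p \<circ> p') v = perm_act p (perm_act p' v)"
  by (simp add: vec_eq_iff o_inv_distrib)

lemma perm_act_add: "perm_act p (v + w) = perm_act p v + perm_act p w"
  and perm_act_diff: "perm_act p (v - w) = perm_act p v - perm_act p w"
  and perm_act_minus: "perm_act p (- v) = - perm_act p v"
  and perm_act_zero [simp]: "perm_act p 0 = 0"
  and perm_act_scale: "perm_act p (c *s v) = c *s perm_act p v"
  by (simp_all add: vec_eq_iff)

lemma perm_act_eps: "bij p \<Longrightarrow> perm_act p (eps a) = eps (p a)"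
  by (auto simp: vec_eq_iff bij_is_inj bij_is_surj surj_f_inv_f)

lemma perm_act_s_perm [simp]: "perm_act (s_perm i) (perm_act (s_perm i) v) = v"
  by (simp add: vec_eq_iff)

lemma ip_eps: "ip x (eps a) = x $ a" 
  by (simp add: ip_def if_distrib cong: if_cong)

lemma ip_diff: "ip x (y - z) = ip x y - ip x z"
  and ip_add_left: "ip (y + z) x = ip y x + ip z x"
  and ip_diff_left: "ip (y - z) x = ip y x - ip z x"
  and ip_minus_left: "ip (- y) x = - ip y x"
  and ip_zero [simp]: "ip x 0 = 0" "ip 0 x = 0"
  by (simp_all add: ip_def sum.distrib sum_subtractf sum_negf algebra_simps)

lemma ip_scale: "ip (c *s x) (y :: 'r::finite weight) = c * ip x y"
   "ip x (c *s y) = c * ip x (y :: 'r::finite weight)"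
  by (simp_all add: ip_def sum_distrib_left algebra_simps)

lemma ip_eps_left: "ip (eps a) y = y $ a"
  by (simp add: ip_def if_distrib[where f="\<lambda>x. of_int x * _"] cong: if_cong)

lemma ip_simple_root: "ip x (simple_root i) = x $ coord i - x $ coord (i+1)"
  by (simp only: simple_root_def ip_diff ip_eps)

lemma perm_act_s_perm_eq:
  assumes "1 \<le> i" "i < CARD('r)"
  shows "perm_act (s_perm i) x = x - ip x (simple_root i) *s (simple_root i :: 'r::{finite,linorder} weight)"
proof -
  have "coord i \<noteq> (coord (i+1)::'r)" using assms coord_eq_iff[where 'a='r, of i "i+1"] by auto
  then show ?thesis
    by (auto simp: vec_eq_iff s_perm_def simple_root_def Transposition.transpose_def ip_diff ip_eps)
qed

lemma simple_root_nz:
  assumes "1 \<le> i" "i < CARD('r)"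
  shows "simple_root i \<noteq> (0 :: 'r::{finite,linorder} weight)"
proof -
  have "coord i \<noteq> (coord (i+1)::'r)" using assms coord_eq_iff[where 'a='r, of i "i+1"] by auto
  then have "(simple_root i :: 'r weight) $ coord i = 1" by (simp add: simple_root_def)
  then show ?thesis by (metis zero_index zero_neq_one)
qed

text \<open>Induction on the sum of the absolute values of the entries: some nonzero entry moves one
  step towards 0. Monomials are thus reached by multiplications with single variables and their
  inverses.\<close>

lemma weight_pm_induct [case_names zero add sub]:
  fixes \<beta> :: "'r::finite weight"
  assumes "P 0" "\<And>\<beta> a. P \<beta> \<Longrightarrow> P (\<beta> + eps a)" "\<And>\<beta> a. P \<beta> \<Longrightarrow> P (\<beta> - eps a)"
  shows "P \<beta>"
proof (induction "\<Sum>a\<in>UNIV. nat \<bar>\<beta> $ a\<bar>" arbitrary: \<beta> rule: less_induct)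
  case less
  show ?case
  proof (cases "\<beta> = 0")
    case False
    then obtain a where a: "\<beta> $ a \<noteq> 0" by (auto simp: vec_eq_iff)
    have *: "(\<Sum>b\<in>UNIV. nat \<bar>\<beta>' $ b\<bar>) < (\<Sum>b\<in>UNIV. nat \<bar>\<beta> $ b\<bar>)"
      if "\<And>b. b \<noteq> a \<Longrightarrow> \<beta>' $ b = \<beta> $ b" "\<bar>\<beta>' $ a\<bar> < \<bar>\<beta> $ a\<bar>" for \<beta>'
    proof (intro sum_strict_mono_ex1)
      show "\<forall>x\<in>UNIV. nat \<bar>\<beta>' $ x\<bar> \<le> nat \<bar>\<beta> $ x\<bar>" using that by (metis less_imp_le nat_mono order_refl)
      show "\<exists>x\<in>UNIV. nat \<bar>\<beta>' $ x\<bar> < nat \<bar>\<beta> $ x\<bar>" using that(2) by (intro bexI[of _ a]) auto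
    qed simp
    show ?thesis
    proof (cases "\<beta> $ a > 0")
      case True
      have "P (\<beta> - eps a)" by (rule less, rule *) (use True in auto)
      then show ?thesis using assms(2)[of "\<beta> - eps a" a] by simp
    next
      case F: False
      have "P (\<beta> + eps a)" by (rule less, rule *) (use F a in auto)
      then show ?thesis using assms(3)[of "\<beta> + eps a" a] by simp
    qed
  qed (use assms in simp)
qed

section \<open>Inversions and reduced words\<close>

text \<open>Inversions are recorded by arguments, not values, so that left multiplication by a
  simple reflection adds or removes one pair and leaves all others in place.\<close>

definition Inv :: "('r \<Rightarrow> 'r) \<Rightarrow> ('r::{finite,linorder} \<times> 'r) set"
  where "Inv p = {(a, b). a < b \<and> p b < p a}"

definition word_perm :: "nat list \<Rightarrow> 'r \<Rightarrow> 'r::{finite,linorder}"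
  where "word_perm ws = word_prod sym_gp s_perm ws"

lemma word_perm_simps [simp]:
  "word_perm [] = id" "word_perm (i # ws) = s_perm i \<circ> word_perm ws"
  by (simp_all add: word_prod_def sym_gp_def word_perm_def)

lemma bij_word_perm [simp]: "bij (word_perm ws)"
proof (induction ws)
  case (Cons i ws)
  show ?case unfolding word_perm_simps by (rule bij_comp[OF Cons bij_s_perm])
qed (simp only: word_perm_simps bij_id)

lemma inv_f_f_bij: "bij p \<Longrightarrow> inv p (p a) = a" "bij p \<Longrightarrow> p (inv p a) = a"
  by (simp_all add: bij_is_inj bij_is_surj surj_f_inv_f)

lemma inv_s_perm_comp: "bij p \<Longrightarrow> inv (s_perm i \<circ> p) a = inv p (s_perm i a)"
  "bij p \<Longrightarrow> inv (p \<circ> s_perm i) a = s_perm i (inv p a)"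
  by (simp_all add: o_inv_distrib)

text \<open>Only the arguments whose values are the two swapped ones change their relative order; by
  assumption they were not inverted before.\<close>

lemma Inv_s_perm:
  assumes p: "bij p" and i: "1 \<le> i" "i < CARD('r)"
    and asc: "inv p (coord i) < inv p (coord (i + 1))"
  shows "Inv (s_perm i \<circ> p) = insert (inv p (coord i), inv p (coord (i + 1))) (Inv (p :: 'r::{finite,linorder} \<Rightarrow> 'r))"
    and "(inv p (coord i), inv p (coord (i + 1))) \<notin> Inv p"
proof -
  have lt: "coord i < (coord (i+1)::'r)" using i coord_strict_mono[where 'a='r, of i "i+1"] by simp
  show "(inv p (coord i), inv p (coord (i + 1))) \<notin> Inv p"
    using p lt by (auto simp: Inv_def inv_f_f_bij)
  have "(a, b) \<in> Inv (s_perm i \<circ> p) \<longleftrightarrow> (a, b) \<in> insert (inv p (coord i), inv p (coord (i + 1))) (Inv p)"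
    if ab: "a < b" for a b
  proof (cases "{p a, p b} = {coord i, coord (i+1)}")
    case True
    then have "p a = coord i \<and> p b = coord (i+1) \<or> p b = coord i \<and> p a = coord (i+1)"
      by (auto simp: doubleton_eq_iff)
    then show ?thesis
    proof
      assume h: "p a = coord i \<and> p b = coord (i+1)"
      then have "a = inv p (coord i)" "b = inv p (coord (i+1))" using p by (metis inv_f_f_bij(1))+
      then show ?thesis using ab lt h by (simp add: Inv_def s_perm_coord[OF i, simplified])
    next
      assume h: "p b = coord i \<and> p a = coord (i+1)"
      then have "b = inv p (coord i)" "a = inv p (coord (i+1))" using p by (metis inv_f_f_bij(1))+
      then show ?thesis using ab asc by simp
    qed
  next
    case False
    have "p a \<noteq> p b" using ab p by (metis inv_f_f_bij(1) order_less_irrefl)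
    from s_perm_less_iff[OF i, of "p b" "p a"] this False
    have "s_perm i (p b) < s_perm i (p a) \<longleftrightarrow> p b < p a" by (auto simp: insert_commute)
    moreover have "(a, b) \<noteq> (inv p (coord i), inv p (coord (i + 1)))"
      using False p by (auto simp: inv_f_f_bij)
    ultimately show ?thesis using ab by (auto simp: Inv_def)
  qed
  moreover have "a < b" if "(a, b) \<in> Inv (s_perm i \<circ> p) \<or> (a, b) \<in> insert (inv p (coord i), inv p (coord (i + 1))) (Inv p)" for a b
    using that asc by (auto simp: Inv_def)
  ultimately show "Inv (s_perm i \<circ> p) = insert (inv p (coord i), inv p (coord (i + 1))) (Inv p)"
    by (metis (no_types, lifting) subrelI subset_antisym)
qed

text \<open>The descending case is the ascending case applied to \<open>s_perm i \<circ> p\<close>,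
  which a second multiplication by \<open>s_perm i\<close> takes back to \<open>p\<close>.\<close>

lemma card_Inv_s_perm:
  assumes p: "bij (p :: 'r::{finite,linorder} \<Rightarrow> 'r)" and i: "1 \<le> i" "i < CARD('r)"
  shows "inv p (coord i) < inv p (coord (i + 1)) \<Longrightarrow> card (Inv (s_perm i \<circ> p)) = Suc (card (Inv p))"
    and "\<not> inv p (coord i) < inv p (coord (i + 1)) \<Longrightarrow> card (Inv p) = Suc (card (Inv (s_perm i \<circ> p)))"
proof -
  have *: "card (Inv (s_perm i \<circ> p)) = Suc (card (Inv p))" 
    if "inv p (coord i) < inv p (coord (i + 1))" "bij p" for p :: "'r \<Rightarrow> 'r"
    using Inv_s_perm[OF that(2) i that(1)] by simp
  show "inv p (coord i) < inv p (coord (i + 1)) \<Longrightarrow> card (Inv (s_perm i \<circ> p)) = Suc (card (Inv p))"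
    using * p by blast
  assume n: "\<not> inv p (coord i) < inv p (coord (i + 1))"
  have "coord i \<noteq> (coord (i+1)::'r)" using i coord_strict_mono[where 'a='r, of i "i+1"] by simp
  then have "inv p (coord i) \<noteq> inv p (coord (i + 1))" using p by (metis inv_f_f_bij(2))
  then have "inv (s_perm i \<circ> p) (coord i) < inv (s_perm i \<circ> p) (coord (i + 1))"
    using n p s_perm_coord[OF i] by (simp add: inv_s_perm_comp)
  from *[OF this] p show "card (Inv p) = Suc (card (Inv (s_perm i \<circ> p)))"
    using bij_comp[OF p bij_s_perm[of i]] by (simp add: o_assoc)
qed

text \<open>Strict growth from the left end gives \<open>i \<le> f i\<close>, and strict growth up
  to the right end gives \<open>f i \<le> i\<close>.\<close>

lemma strict_mono_bounded_nat:
  fixes f :: "nat \<Rightarrow> nat"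
  assumes "\<And>i. 1 \<le> i \<Longrightarrow> i < n \<Longrightarrow> f i < f (i + 1)" "\<And>i. 1 \<le> i \<Longrightarrow> i \<le> n \<Longrightarrow> 1 \<le> f i \<and> f i \<le> n"
    and "1 \<le> i" "i \<le> n"
  shows "f i = i"
proof -
  have "i \<le> f i" using assms(3,4)
  proof (induction i rule: nat_induct_at_least)
    case (Suc m) then show ?case using assms(1)[of m] by simp
  qed (use assms(2) in auto)
  moreover have "\<forall>i. 1 \<le> i \<longrightarrow> i + k = n \<longrightarrow> f i \<le> i" for k
  proof (induction k)
    case 0 then show ?case using assms(2) by auto
  next
    case (Suc k)
    show ?case
    proof (intro allI impI)
      fix i assume "1 \<le> i" "i + Suc k = n"
      then show "f i \<le> i" using Suc[rule_format, of "i+1"] assms(1)[of i] by simp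
    qed
  qed
  ultimately show ?thesis using assms(3,4) by (metis le_add_diff_inverse le_antisym)
qed

lemma perm_no_descent_eq_id:
  assumes p: "bij (p :: 'r::{finite,linorder} \<Rightarrow> 'r)"
    and asc: "\<And>i. 1 \<le> i \<Longrightarrow> i < CARD('r) \<Longrightarrow> inv p (coord i) < inv p (coord (i + 1))"
  shows "p = id"
proof -
  have *: "coord_index (inv p (coord i)) = i" if "1 \<le> i" "i \<le> CARD('r)" for i
    using that by (intro strict_mono_bounded_nat[where n="CARD('r)"]) 
       (use asc in \<open>auto simp: coord_index_less_iff[symmetric]\<close>)
  have "inv p a = a" for a
    using *[of "coord_index a"] by simp
  then show ?thesis using p by (metis eq_id_iff inv_f_f_bij(2))
qed

text \<open>Sorting by adjacent transpositions: as long as a left descent exists, undoing it removes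
  exactly one inversion.\<close>

lemma perm_word_exists:
  assumes "bij (p :: 'r::{finite,linorder} \<Rightarrow> 'r)"
  shows "\<exists>ws. set ws \<subseteq> {1..<CARD('r)} \<and> length ws = card (Inv p) \<and> word_perm ws = p"
  using assms
proof (induction "card (Inv p)" arbitrary: p rule: less_induct)
  case less
  show ?case
  proof (cases "\<forall>i. 1 \<le> i \<longrightarrow> i < CARD('r) \<longrightarrow> inv p (coord i) < inv p (coord (i + 1))")
    case True
    then have p: "p = id" using perm_no_descent_eq_id less.prems by blast
    have "card (Inv p) = 0" by (auto simp: Inv_def p)
    then show ?thesis using p by (intro exI[of _ "[]"]) simp
  next
    case False
    then obtain i where i: "1 \<le> i" "i < CARD('r)" "\<not> inv p (coord i) < inv p (coord (i + 1))" by blast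
    have c: "card (Inv p) = Suc (card (Inv (s_perm i \<circ> p)))"
      using card_Inv_s_perm(2)[OF less.prems i] .
    obtain ws where "set ws \<subseteq> {1..<CARD('r)}" "length ws = card (Inv (s_perm i \<circ> p))" "word_perm ws = s_perm i \<circ> p"
      using less.hyps[of "s_perm i \<circ> p"] c bij_comp[OF less.prems bij_s_perm[of i]] by auto
    then show ?thesis using c i by (intro exI[of _ "i # ws"]) (auto simp: o_assoc)
  qed
qed

lemma card_Inv_word_le: "set ws \<subseteq> {1..<CARD('r)} \<Longrightarrow> card (Inv (word_perm ws :: 'r::{finite,linorder} \<Rightarrow> 'r)) \<le> length ws"
proof (induction ws)
  case Nil
  then show ?case by (auto simp: Inv_def)
next
  case (Cons i ws)
  then have i: "1 \<le> i" "i < CARD('r)" and IH: "card (Inv (word_perm ws :: 'r \<Rightarrow> 'r)) \<le> length ws" by auto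
  show ?case using card_Inv_s_perm[OF bij_word_perm[of ws] i] IH unfolding word_perm_simps
    by (cases "inv (word_perm ws) (coord i) < inv (word_perm ws) (coord (i + 1) :: 'r)") (simp_all only: length_Cons, linarith+)
qed

text \<open>Sorting bounds the Coxeter length by the number of inversions, and a letter can create
  at most one inversion, which gives the opposite bound.\<close>

lemma perm_reducedD:
  assumes "perm_reduced ws (p :: 'r::{finite,linorder} \<Rightarrow> 'r)"
  shows "set ws \<subseteq> {1..<CARD('r)}" "word_perm ws = p" "length ws = card (Inv p)"
proof -
  show 1: "set ws \<subseteq> {1..<CARD('r)}" "word_perm ws = p"
    using assms by (auto simp: perm_reduced_def reduced_word_def word_perm_def)
  have "bij p" using 1(2) by auto
  from perm_word_exists[OF this] have "cox_length sym_gp s_perm {1..<CARD('r)} p \<le> card (Inv p)"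
    unfolding cox_length_def by (intro Least_le) (auto simp: word_perm_def)
  then show "length ws = card (Inv p)"
    using assms card_Inv_word_le[OF 1(1)] 1(2) by (auto simp: perm_reduced_def reduced_word_def)
qed

text \<open>A letter that lowered the number of inversions would leave a reduced word with more
  letters than inversions. So only ascents occur, which is exactly where T_i T_p is a single basis
  element.\<close>

lemma perm_reduced_induct [consumes 1, case_names Nil Cons]:
  assumes red: "perm_reduced ws (p :: 'r::{finite,linorder} \<Rightarrow> 'r)"
    and "P [] id"
    and step: "\<And>i ws p. \<lbrakk>1 \<le> i; i < CARD('r); bij p; inv p (coord i) < inv p (coord (i + 1)); P ws p\<rbrakk>
      \<Longrightarrow> P (i # ws) (s_perm i \<circ> p)"
  shows "P ws p"
proof -
  have "P ws (word_perm ws)" if "set ws \<subseteq> {1..<CARD('r)}" "length ws = card (Inv (word_perm ws :: 'r \<Rightarrow> 'r))"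
    using that
  proof (induction ws)
    case (Cons i ws)
    let ?p = "word_perm ws :: 'r \<Rightarrow> 'r"
    have i: "1 \<le> i" "i < CARD('r)" using Cons.prems by auto
    have le: "card (Inv ?p) \<le> length ws" using Cons.prems card_Inv_word_le by auto
    have asc: "inv ?p (coord i) < inv ?p (coord (i + 1))"
      using card_Inv_s_perm(2)[OF bij_word_perm i, of ws] le Cons.prems(2) unfolding word_perm_simps length_Cons by linarith
    then have "length ws = card (Inv ?p)" using card_Inv_s_perm(1)[OF bij_word_perm i, of ws] Cons.prems(2) unfolding word_perm_simps length_Cons by linarith
    then have "P ws ?p" using Cons by auto
    then show ?case using step[OF i bij_word_perm asc] unfolding word_perm_simps by blast
  qed (use assms(2) in simp)
  then show ?thesis using perm_reducedD[OF red] by simp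
qed

section \<open>Laurent polynomials\<close>

lemma x_pow_0 [simp]: "x_pow 0 = 1" by (simp add: x_pow_def)
lemma x_pow_add: "x_pow (a + b) = x_pow a * x_pow b" by (simp add: x_pow_def mult_single)
lemma x_pow_neg [simp]: "x_pow a * x_pow (- a) = 1" "x_pow (- a) * x_pow a = 1"
  by (simp_all flip: x_pow_add)
lemma x_pow_neg_mult [simp]: "x_pow a * (x_pow (- a) * f) = f" "x_pow (- a) * (x_pow a * f) = f"
  by (simp_all flip: mult.assoc)

lemma smul_simps: "smul c (f + g) = smul c f + smul c g" "smul (c + d) f = smul c f + smul d f"
  "smul c (smul d f) = smul (c * d) f" "smul 1 f = f" "smul 0 f = 0" "smul c 0 = 0"
  "smul c (f - g) = smul c f - smul c g" "smul c (- f) = - smul c f" "smul (c - d) f = smul c f - smul d f"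
  "smul (- c) f = - smul c f"
  by (simp_all add: smul_def distrib_left distrib_right right_diff_distrib left_diff_distrib single_add single_diff single_uminus mult_single flip: mult.assoc)

lemma smul_mult: "f * smul c g = smul c (f * g)" "smul c f * g = smul c (f * g)"
  by (simp_all add: smul_def algebra_simps)

lemma smul_sum: "smul c (\<Sum>i\<in>A. f i) = (\<Sum>i\<in>A. smul c (f i))"
  by (simp add: smul_def sum_distrib_left)

lemma lookup_smul [simp]: "Poly_Mapping.lookup (smul c f) \<mu> = c * Poly_Mapping.lookup f \<mu>"
  by (simp add: smul_def mult_map_scale_conv_mult[symmetric] map.rep_eq when_def)

lemma lookup_x_pow: "Poly_Mapping.lookup (x_pow \<mu>) \<kappa> = (if \<mu> = \<kappa> then 1 else 0)"
  by (simp add: x_pow_def lookup_single when_def)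

lemma laurent_expand: "f = (\<Sum>\<mu>\<in>Poly_Mapping.keys f. smul (Poly_Mapping.lookup f \<mu>) (x_pow \<mu>))"
proof (rule poly_mapping_eqI)
  fix \<kappa>
  show "Poly_Mapping.lookup f \<kappa> = Poly_Mapping.lookup (\<Sum>\<mu>\<in>Poly_Mapping.keys f. smul (Poly_Mapping.lookup f \<mu>) (x_pow \<mu>)) \<kappa>"
    by (simp add: lookup_sum lookup_x_pow in_keys_iff if_distrib cong: if_cong)
qed

lemma laurent_induct [case_names zero mono add]:
  assumes "P 0" "\<And>c \<mu>. P (smul c (x_pow \<mu>))" "\<And>f g. P f \<Longrightarrow> P g \<Longrightarrow> P (f + g)"
  shows "P f"
proof -
  have "P (\<Sum>\<mu>\<in>A. smul (Poly_Mapping.lookup f \<mu>) (x_pow \<mu>))" if "finite A" for A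
    using that by induction (use assms in auto)
  from this[of "Poly_Mapping.keys f"] show ?thesis using laurent_expand[of f] by simp
qed

definition lin :: "(('r, 'v) laurent \<Rightarrow> ('r::finite, 'v::{finite,linorder}) laurent) \<Rightarrow> bool"
  where "lin T \<longleftrightarrow> (\<forall>f g. T (f + g) = T f + T g) \<and> (\<forall>c f. T (smul c f) = smul c (T f))"

lemma lin_add: "lin T \<Longrightarrow> T (f + g) = T f + T g" and lin_smul: "lin T \<Longrightarrow> T (smul c f) = smul c (T f)"
  by (simp_all add: lin_def)

lemma lin_zero: "lin T \<Longrightarrow> T 0 = 0" 
  using lin_smul[of T 0 0] by (simp add: smul_simps)
lemma lin_neg: "lin T \<Longrightarrow> T (- f) = - T f"
  using lin_smul[of T "-1" f] by (simp add: smul_simps)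
lemma lin_diff: "lin T \<Longrightarrow> T (f - g) = T f - T g"
  using lin_add[of T f "-g"] lin_neg[of T g] by simp
lemma lin_sum: "lin T \<Longrightarrow> T (\<Sum>i\<in>A. f i) = (\<Sum>i\<in>A. T (f i))"
  by (induction A rule: infinite_finite_induct) (simp_all add: lin_zero[of T] lin_add[of T])

lemma lin_eqI:
  assumes "lin S" "lin T" "\<And>\<mu>. S (x_pow \<mu>) = T (x_pow \<mu>)"
  shows "S f = T f"
  by (induction f rule: laurent_induct)
    (simp_all add: lin_zero[OF assms(1)] lin_zero[OF assms(2)] lin_smul[OF assms(1)] lin_smul[OF assms(2)]
      lin_add[OF assms(1)] lin_add[OF assms(2)] assms(3))

lemma lin_intros:
  "lin (\<lambda>f. f)" 
  "lin S \<Longrightarrow> lin T \<Longrightarrow> lin (\<lambda>f. S f + T f)"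
  "lin S \<Longrightarrow> lin T \<Longrightarrow> lin (\<lambda>f. S f - T f)"
  "lin S \<Longrightarrow> lin (\<lambda>f. - S f)"
  "lin S \<Longrightarrow> lin (\<lambda>f. smul c (S f))"
  "lin S \<Longrightarrow> lin (\<lambda>f. h * S f)"
  "lin S \<Longrightarrow> lin (\<lambda>f. S f * h)"
  "lin (\<lambda>f. 0)"
  by (auto simp: lin_def algebra_simps smul_mult smul_simps)

lemma lin_comp: "lin S \<Longrightarrow> lin T \<Longrightarrow> lin (\<lambda>f. S (T f))"
  by (simp add: lin_def)

lemma lin_ext_superset:
  assumes "finite A" "Poly_Mapping.keys f \<subseteq> A"
  shows "lin_ext h f = (\<Sum>\<mu>\<in>A. smul (Poly_Mapping.lookup f \<mu>) (h \<mu>))"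
  unfolding lin_ext_def using assms
  by (intro sum.mono_neutral_left) (auto simp: in_keys_iff smul_simps)

lemma lin_lin_ext: "lin (lin_ext h)"
  unfolding lin_def
proof (intro conjI allI)
  fix f g :: "('a, 'b) laurent"
  let ?A = "Poly_Mapping.keys f \<union> Poly_Mapping.keys g"
  have "Poly_Mapping.keys (f + g) \<subseteq> ?A" by (rule keys_add)
  then show "lin_ext h (f + g) = lin_ext h f + lin_ext h g"
    using lin_ext_superset[of ?A f h] lin_ext_superset[of ?A g h] lin_ext_superset[of ?A "f+g" h]
    by (simp add: lookup_add smul_simps sum.distrib)
next
  fix c :: "'b pfield" and f :: "('a, 'b) laurent"
  have "Poly_Mapping.keys (smul c f) \<subseteq> Poly_Mapping.keys f" by (auto simp: in_keys_iff)
  then show "lin_ext h (smul c f) = smul c (lin_ext h f)"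
    using lin_ext_superset[of "Poly_Mapping.keys f" f h] lin_ext_superset[of "Poly_Mapping.keys f" "smul c f" h]
    by (simp add: smul_sum smul_simps)
qed

lemma lin_ext_x_pow [simp]: "lin_ext h (x_pow \<mu>) = h \<mu>"
  by (simp add: lin_ext_superset[of "{\<mu>}"] lookup_x_pow smul_simps x_pow_def)

lemma lookup_times_x_pow: "Poly_Mapping.lookup (f * x_pow \<gamma>) (\<kappa> + \<gamma>) = Poly_Mapping.lookup f \<kappa>"
proof (induction f rule: laurent_induct)
  case (mono c \<mu>)
  then show ?case by (simp add: smul_mult lookup_x_pow flip: x_pow_add)
qed (simp_all add: algebra_simps lookup_add)

text \<open>The difference h of the two factors satisfies h = h x^\<gamma>, so its support is
  invariant under translation by \<gamma> and would be infinite if it were nonempty. This makes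
  \<open>laurent_quot\<close> well defined.\<close>

lemma one_minus_x_pow_cancel:
  assumes "\<gamma> \<noteq> 0" "f * (1 - x_pow \<gamma>) = g * (1 - x_pow \<gamma>)"
  shows "f = g"
proof (rule ccontr)
  assume "f \<noteq> g"
  let ?h = "f - g"
  have h: "?h = ?h * x_pow \<gamma>" using assms(2) by (simp add: algebra_simps)
  have step: "Poly_Mapping.lookup ?h (\<kappa> + \<gamma>) = Poly_Mapping.lookup ?h \<kappa>" for \<kappa>
    unfolding lookup_times_x_pow[of ?h \<gamma> \<kappa>, symmetric] h[symmetric] ..
  obtain \<kappa> where k: "Poly_Mapping.lookup ?h \<kappa> \<noteq> 0" using \<open>f \<noteq> g\<close>
    by (metis eq_iff_diff_eq_0 lookup_zero poly_mapping_eqI)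
  have "Poly_Mapping.lookup ?h (\<kappa> + int m *s \<gamma>) \<noteq> 0" for m
  proof (induction m)
    case (Suc m)
    have "\<kappa> + int (Suc m) *s \<gamma> = (\<kappa> + int m *s \<gamma>) + \<gamma>" by (simp add: vec_eq_iff algebra_simps)
    then show ?case using Suc step by metis
  qed (use k in simp)
  then have "range (\<lambda>m. \<kappa> + int m *s \<gamma>) \<subseteq> Poly_Mapping.keys ?h" by (auto simp: in_keys_iff)
  then have "finite (range (\<lambda>m. \<kappa> + int m *s \<gamma>))" by (rule finite_subset) simp
  moreover have "inj (\<lambda>m. \<kappa> + int m *s \<gamma>)"
  proof (rule injI)
    fix m m' assume "\<kappa> + int m *s \<gamma> = \<kappa> + int m' *s \<gamma>"
    moreover obtain a where "\<gamma> $ a \<noteq> 0" using assms(1) by (auto simp: vec_eq_iff)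
    ultimately show "m = m'" by (auto simp: vec_eq_iff)
  qed
  ultimately show False using finite_imageD by blast
qed

text \<open>The geometric sum, for positive and negative \<open>m\<close>: each step of the
  induction adds or removes one power.\<close>

lemma geometric_quotient_exists:
  "\<exists>h :: ('r::finite, 'v::{finite,linorder}) laurent. h * (1 - x_pow \<gamma>) = 1 - x_pow (- (m *s \<gamma>))"
proof (induction m rule: int_induct[where k=0])
  case base
  then show ?case by (intro exI[of _ 0]) (simp add: vector_smult_lzero)
next
  case (step1 i)
  from step1(2) obtain h :: "('r, 'v) laurent" where h: "h * (1 - x_pow \<gamma>) = 1 - x_pow (- (i *s \<gamma>))" by blast
  have "- (i *s \<gamma>) = - ((i+1) *s \<gamma>) + \<gamma>" by (simp add: vec_eq_iff algebra_simps)
  then have "x_pow (- (i *s \<gamma>)) = (x_pow (- ((i+1) *s \<gamma>)) * x_pow \<gamma> :: ('r, 'v) laurent)" by (simp flip: x_pow_add)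
  then have "(h - x_pow (- ((i+1) *s \<gamma>))) * (1 - x_pow \<gamma>) = 1 - x_pow (- ((i+1) *s \<gamma>))"
    unfolding left_diff_distrib h by (simp only: right_diff_distrib) simp
  then show ?case by blast
next
  case (step2 i)
  from step2(2) obtain h :: "('r, 'v) laurent" where h: "h * (1 - x_pow \<gamma>) = 1 - x_pow (- (i *s \<gamma>))" by blast
  have "- ((i-1) *s \<gamma>) = - (i *s \<gamma>) + \<gamma>" by (simp add: vec_eq_iff algebra_simps)
  then have "x_pow (- ((i-1) *s \<gamma>)) = (x_pow (- (i *s \<gamma>)) * x_pow \<gamma> :: ('r, 'v) laurent)" by (simp flip: x_pow_add)
  then have "(h + x_pow (- (i *s \<gamma>))) * (1 - x_pow \<gamma>) = 1 - x_pow (- ((i-1) *s \<gamma>))"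
    unfolding distrib_right h by (simp only: right_diff_distrib) simp
  then show ?case by blast
qed

lemma laurent_quot:
  assumes "\<gamma> \<noteq> 0" "h * (1 - x_pow \<gamma>) = f"
  shows "laurent_quot f (1 - x_pow \<gamma>) = h"
  unfolding laurent_quot_def using assms one_minus_x_pow_cancel by blast

lemma laurent_quot_mult:
  assumes "\<gamma> \<noteq> 0"
  shows "laurent_quot (1 - x_pow (- (m *s \<gamma>))) (1 - x_pow \<gamma>) * (1 - x_pow \<gamma>) = 1 - x_pow (- (m *s \<gamma>))"
  using geometric_quotient_exists[of \<gamma> m] laurent_quot[OF assms] by metis

interpretation laurent_vs: vector_space "smul :: _ \<Rightarrow> ('r::finite, 'v::{finite,linorder}) laurent \<Rightarrow> _"
  by unfold_locales (simp_all add: smul_simps)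

section \<open>The affine Hecke algebra as a bimodule\<close>

definition hecke_par :: "'v::{finite,linorder} pfield"
  where "hecke_par = kpar - inverse kpar"

definition refl :: "nat \<Rightarrow> ('r::{finite,linorder}, 'v::{finite,linorder}) laurent \<Rightarrow> ('r, 'v) laurent"
  where "refl i = lin_ext (\<lambda>\<mu>. x_pow (perm_act (s_perm i) \<mu>))"

text \<open>The divided difference (f - s_i f)/(1 - x^{\<alpha>_i}), given on monomials, where the
  quotient is a geometric sum.\<close>

definition demazure :: "nat \<Rightarrow> ('r::{finite,linorder}, 'v::{finite,linorder}) laurent \<Rightarrow> ('r, 'v) laurent"
  where "demazure i = lin_ext (\<lambda>\<mu>. laurent_quot (1 - x_pow (- (ip \<mu> (simple_root i) *s simple_root i)))
    (1 - x_pow (simple_root i)) * x_pow \<mu>)"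

lemma lin_refl [simp]: "lin (refl i)" and lin_demazure [simp]: "lin (demazure i)"
  by (simp_all add: refl_def demazure_def lin_lin_ext)

lemma refl_x_pow [simp]: "refl i (x_pow \<mu>) = x_pow (perm_act (s_perm i) \<mu>)"
  by (simp add: refl_def)

lemmas refl_lin = lin_add[OF lin_refl] lin_smul[OF lin_refl] lin_zero[OF lin_refl]
lemmas demazure_lin = lin_add[OF lin_demazure] lin_smul[OF lin_demazure] lin_zero[OF lin_demazure]

lemma refl_x_pow_mult: "refl i (x_pow \<beta> * f) = x_pow (perm_act (s_perm i) \<beta>) * refl i f"
  by (rule lin_eqI[of "\<lambda>f. refl i (x_pow \<beta> * f)"])
    (auto intro!: lin_intros lin_comp[OF lin_refl] lin_comp[OF lin_demazure] simp: perm_act_add simp flip: x_pow_add)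

lemma refl_refl [simp]: "refl i (refl i f) = f"
  by (rule lin_eqI[of "\<lambda>f. refl i (refl i f)"]) (auto intro!: lin_intros lin_comp[OF lin_refl] lin_comp[OF lin_demazure])

lemma demazure_mult:
  fixes f :: "('r::{finite,linorder}, 'v::{finite,linorder}) laurent"
  assumes "1 \<le> i" "i < CARD('r)"
  shows "demazure i f * (1 - x_pow (simple_root i)) = f - refl i f"
proof (rule lin_eqI[of "\<lambda>f. demazure i f * (1 - x_pow (simple_root i))"])
  fix \<mu> :: "'r weight"
  have "demazure i (x_pow \<mu>) * (1 - x_pow (simple_root i))
      = laurent_quot (1 - x_pow (- (ip \<mu> (simple_root i) *s simple_root i))) (1 - x_pow (simple_root i))
        * (1 - x_pow (simple_root i)) * (x_pow \<mu> :: ('r, 'v) laurent)"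
    by (simp add: demazure_def)
  also have "\<dots> = (1 - x_pow (- (ip \<mu> (simple_root i) *s simple_root i))) * x_pow \<mu>"
    unfolding laurent_quot_mult[OF simple_root_nz[OF assms]] ..
  also have "\<dots> = x_pow \<mu> - refl i (x_pow \<mu>)"
    by (simp add: left_diff_distrib perm_act_s_perm_eq[OF assms] flip: x_pow_add)
  finally show "demazure i (x_pow \<mu>) * (1 - x_pow (simple_root i)) = (x_pow \<mu> - refl i (x_pow \<mu>) :: ('r, 'v) laurent)" .
qed (auto intro!: lin_intros lin_comp[OF lin_refl] lin_comp[OF lin_demazure])

text \<open>Values of the divided difference are verified after multiplication by the denominator;
  no explicit geometric sum is ever needed.\<close>

lemma demazure_eqI:
  fixes f :: "('r::{finite,linorder}, 'v::{finite,linorder}) laurent"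
  assumes "1 \<le> i" "i < CARD('r)" "g * (1 - x_pow (simple_root i)) = f - refl i f"
  shows "demazure i f = g"
  using assms demazure_mult[OF assms(1,2), of f] one_minus_x_pow_cancel[OF simple_root_nz[OF assms(1,2)]] by metis

lemma ring_aux: "(a * r + x * d) * q = a * q * r + x * (d * q)" for a :: "'a::comm_ring"
  by (simp add: algebra_simps)

text \<open>The twisted Leibniz rule: after multiplication by the denominator the mixed terms x^v
  s_i f cancel.\<close>

lemma demazure_x_pow_mult:
  fixes f :: "('r::{finite,linorder}, 'v::{finite,linorder}) laurent"
  assumes i: "1 \<le> i" "i < CARD('r)"
  shows "demazure i (x_pow v * f) = demazure i (x_pow v) * refl i f + x_pow v * demazure i f"
proof (rule demazure_eqI[OF i])
  have "(demazure i (x_pow v) * refl i f + x_pow v * demazure i f) * (1 - x_pow (simple_root i))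
    = demazure i (x_pow v) * (1 - x_pow (simple_root i)) * refl i f + x_pow v * (demazure i f * (1 - x_pow (simple_root i)))"
    by (rule ring_aux)
  also have "\<dots> = x_pow v * f - refl i (x_pow v * f)"
    unfolding demazure_mult[OF i] refl_x_pow refl_x_pow_mult by (simp only: left_diff_distrib right_diff_distrib) simp
  finally show "(demazure i (x_pow v) * refl i f + x_pow v * demazure i f) * (1 - x_pow (simple_root i))
    = x_pow v * f - refl i (x_pow v * f)" .
qed

lemma demazure_one [simp]: "1 \<le> i \<Longrightarrow> i < CARD('r) \<Longrightarrow> demazure i (1 :: ('r::{finite,linorder}, 'v::{finite,linorder}) laurent) = 0"
  using refl_x_pow[of i "0 :: 'r weight"] by (intro demazure_eqI) simp_all

lemma demazure_eps:
  assumes i: "1 \<le> i" "i < CARD('r)"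
  shows "demazure i (x_pow (eps a)) = (if a = coord i then - x_pow (eps (coord (i+1)))
     else if a = coord (i+1) then x_pow (eps (coord (i+1))) else 0 :: ('r::{finite,linorder}, 'v::{finite,linorder}) laurent)"
proof (rule demazure_eqI[OF i])
  have ne: "coord i \<noteq> (coord (i+1)::'r)" using i coord_strict_mono[where 'a='r, of i "i+1"] by simp
  have "x_pow (eps (coord (i+1))) * x_pow (simple_root i) = (x_pow (eps (coord i)) :: ('r, 'v) laurent)"
    by (simp add: simple_root_def flip: x_pow_add)
  then show "(if a = coord i then - x_pow (eps (coord (i+1)))
     else if a = coord (i+1) then x_pow (eps (coord (i+1))) else 0) * (1 - x_pow (simple_root i))
     = x_pow (eps a) - refl i (x_pow (eps a) :: ('r, 'v) laurent)"
    using ne by (auto simp: perm_act_eps s_perm_def algebra_simps Transposition.transpose_def)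
qed

text \<open>Left and right descents: the respective multiplication by a simple reflection shortens
  \<open>u\<close>.\<close>

abbreviation ldesc :: "('r \<Rightarrow> 'r::{finite,linorder}) \<Rightarrow> nat \<Rightarrow> bool"
  where "ldesc u i \<equiv> inv u (coord (i + 1)) < inv u (coord i)"

abbreviation rdesc :: "('r \<Rightarrow> 'r::{finite,linorder}) \<Rightarrow> nat \<Rightarrow> bool"
  where "rdesc u j \<equiv> u (coord (j + 1)) < u (coord j)"

text \<open>The coefficient of the second term in T_i T_u = T_{s_i u} + (k - k^{-1}) T_u, which is
  present only at a descent.\<close>

definition kd :: "bool \<Rightarrow> 'v::{finite,linorder} pfield"
  where "kd b = (if b then hecke_par else 0)"

type_synonym ('r, 'v) hmod = "('r \<Rightarrow> 'r) \<Rightarrow> ('r, 'v) laurent"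

text \<open>
  A function \<open>F\<close> stands for the sum of the \<open>F(u) T\<^sub>u\<close> over the permutations \<open>u\<close>. Left multiplication by
  \<open>T\<^sub>i\<close> is \<open>LT i\<close>, right multiplication by \<open>T\<^sub>j\<close> is \<open>RT j\<close>, and \<open>RP\<close> is right multiplication by the element
  \<open>x\<^bsub>1\<^esub> T\<^bsub>1\<^esub> \<dots> T\<^bsub>r-1\<^esub>\<close> of length \<open>0\<close>, with inverse \<open>RPi\<close>.
\<close>

definition LT :: "nat \<Rightarrow> ('r::{finite,linorder}, 'v::{finite,linorder}) hmod \<Rightarrow> ('r, 'v) hmod"
  where "LT i F = (\<lambda>u. if bij u then refl i (F (s_perm i \<circ> u)) + smul (kd (ldesc u i)) (refl i (F u))
    + smul hecke_par (demazure i (F u)) else 0)"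

definition RT :: "nat \<Rightarrow> ('r::{finite,linorder}, 'v::{finite,linorder}) hmod \<Rightarrow> ('r, 'v) hmod"
  where "RT j F = (\<lambda>u. if bij u then F (u \<circ> s_perm j) + smul (kd (rdesc u j)) (F u) else 0)"

definition RP :: "('r::{finite,linorder}, 'v::{finite,linorder}) hmod \<Rightarrow> ('r, 'v) hmod"
  where "RP F = (\<lambda>u. if bij u then x_pow (eps (u (coord CARD('r)))) * F (u \<circ> cyc_inv) else 0)"

definition RPi :: "('r::{finite,linorder}, 'v::{finite,linorder}) hmod \<Rightarrow> ('r, 'v) hmod"
  where "RPi F = (\<lambda>u. if bij u then x_pow (- eps (u (coord 1))) * F (u \<circ> cyc) else 0)"

definition mon :: "'r weight \<Rightarrow> ('r \<Rightarrow> 'r) \<Rightarrow> ('r::{finite,linorder}, 'v::{finite,linorder}) hmod"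
  where "mon \<beta> u = (\<lambda>v. if v = u then x_pow \<beta> else 0)"

lemma bij_comp' [simp]: "bij p \<Longrightarrow> bij p' \<Longrightarrow> bij (p \<circ> p')"
  by (rule bij_comp)

text \<open>Reflection and divided difference act on the polynomial coefficients and the right
  factor on the permutation alone, so the only possible interference is between the descent
  terms.\<close>

lemma LT_RT:
  fixes F :: "('r::{finite,linorder}, 'v::{finite,linorder}) hmod"
  assumes i: "1 \<le> i" "i < CARD('r)" and j: "1 \<le> j" "j < CARD('r)"
  shows "LT i (RT j F) = RT j (LT i F)"
proof
  fix u :: "'r \<Rightarrow> 'r"
  show "LT i (RT j F) u = RT j (LT i F) u"
  proof (cases "bij u")
    case u: True
    let ?r = "refl i"
    have ii: "coord i < (coord (i+1)::'r)" using i coord_strict_mono[where 'a='r, of i "i+1"] by simp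
    have jj: "coord j < (coord (j+1)::'r)" using j coord_strict_mono[where 'a='r, of j "j+1"] by simp
    have nii: "\<not> coord (i+1) < (coord i::'r)" "\<not> coord (j+1) < (coord j::'r)" using ii jj by auto
    have iu: "inv (u \<circ> s_perm j) a = s_perm j (inv u a)" for a
      using u by (simp add: inv_s_perm_comp)
    \<comment> \<open>The left reflection affects a right descent, or conversely, only if it swaps
      the values that the right one exchanges. Then
      \<open>s_perm i \<circ> u = u \<circ> s_perm j\<close>, and the two mixed terms carry the same
      vector.\<close>
    have core: "smul (kd (rdesc (s_perm i \<circ> u) j)) (?r (F (s_perm i \<circ> u))) + smul (kd (ldesc u i)) (?r (F (u \<circ> s_perm j)))
      = smul (kd (ldesc (u \<circ> s_perm j) i)) (?r (F (u \<circ> s_perm j))) + smul (kd (rdesc u j)) (?r (F (s_perm i \<circ> u)))"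
    proof (cases "{u (coord j), u (coord (j+1))} = {coord i, coord (i+1)}")
      case True
      then consider "u (coord j) = coord i" "u (coord (j+1)) = coord (i+1)" | 
         "u (coord j) = coord (i+1)" "u (coord (j+1)) = coord i" by (auto simp: doubleton_eq_iff)
      then show ?thesis
      proof cases
        case 1
        have in1: "inv u (coord i) = coord j" "inv u (coord (i+1)) = coord (j+1)"
          using 1 u by (metis inv_f_f_bij(1))+
        have "s_perm i \<circ> u = u \<circ> s_perm j"
          using transpose_comp_eq[OF u, of "coord i" "coord (i+1)"] in1 by (simp only: s_perm_def)
        then show ?thesis using 1 in1 ii jj nii s_perm_coord[OF i] s_perm_coord[OF j] by (simp add: iu)
      next
        case 2
        have in1: "inv u (coord (i+1)) = coord j" "inv u (coord i) = coord (j+1)"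
          using 2 u by (metis inv_f_f_bij(1))+
        have "s_perm i \<circ> u = u \<circ> s_perm j"
          using transpose_comp_eq[OF u, of "coord i" "coord (i+1)"] in1 by (simp only: s_perm_def transpose_commute)
        then show ?thesis using 2 in1 ii jj nii s_perm_coord[OF i] s_perm_coord[OF j] by (simp add: iu)
      qed
    next
      case False
      have "u (coord j) \<noteq> u (coord (j+1))" using jj u by (metis inv_f_f_bij(1) order_less_irrefl)
      then have 1: "rdesc (s_perm i \<circ> u) j = rdesc u j"
        using s_perm_less_iff[OF i, of "u (coord (j+1))" "u (coord j)"] False by (metis comp_apply insert_commute)
      have "inv u (coord i) \<noteq> inv u (coord (i+1))" using ii u by (metis inv_f_f_bij(2) order_less_irrefl)
      moreover have "{inv u (coord (i+1)), inv u (coord i)} \<noteq> {coord j, coord (j+1)}"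
      proof
        assume "{inv u (coord (i+1)), inv u (coord i)} = {coord j, coord (j+1)}"
        then have "u ` {inv u (coord (i+1)), inv u (coord i)} = u ` {coord j, coord (j+1)}" by simp
        then show False using False by (simp only: image_insert image_empty inv_f_f_bij(2)[OF u] insert_commute) 
      qed
      ultimately have 2: "ldesc (u \<circ> s_perm j) i = ldesc u i"
        unfolding iu by (metis s_perm_less_iff[OF j])
      show ?thesis unfolding 1 2 by (simp add: add.commute)
    qed
    have "LT i (RT j F) u = ?r (F (s_perm i \<circ> u \<circ> s_perm j)) + smul hecke_par (demazure i (F (u \<circ> s_perm j)))
       + smul (kd (rdesc u j) * hecke_par) (demazure i (F u)) + smul (kd (rdesc u j) * kd (ldesc u i)) (?r (F u))
       + (smul (kd (rdesc (s_perm i \<circ> u) j)) (?r (F (s_perm i \<circ> u))) + smul (kd (ldesc u i)) (?r (F (u \<circ> s_perm j))))"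
      using u by (simp add: LT_def RT_def refl_lin demazure_lin smul_simps mult.commute del: o_apply)
    moreover have "RT j (LT i F) u = ?r (F (s_perm i \<circ> u \<circ> s_perm j)) + smul hecke_par (demazure i (F (u \<circ> s_perm j)))
       + smul (kd (rdesc u j) * hecke_par) (demazure i (F u)) + smul (kd (rdesc u j) * kd (ldesc u i)) (?r (F u))
       + (smul (kd (ldesc (u \<circ> s_perm j) i)) (?r (F (u \<circ> s_perm j))) + smul (kd (rdesc u j)) (?r (F (s_perm i \<circ> u))))"
      using u by (simp add: LT_def RT_def refl_lin demazure_lin smul_simps mult.commute comp_assoc del: o_apply)
    ultimately show ?thesis unfolding core by simp
  qed (simp add: LT_def RT_def)
qed

text \<open>The rotation can change the left descent of \<open>u\<close> at \<open>i\<close> only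
  when the last position of \<open>u\<close> is mapped to i or i + 1; the divided difference of the
  variable brought in by \<open>RP\<close> makes up for precisely this change.\<close>

lemma LT_RP:
  fixes F :: "('r::{finite,linorder}, 'v::{finite,linorder}) hmod"
  assumes i: "1 \<le> i" "i < CARD('r)"
  shows "LT i (RP F) = RP (LT i F)"
proof
  fix u :: "'r \<Rightarrow> 'r"
  show "LT i (RP F) u = RP (LT i F) u"
  proof (cases "bij u")
    case u: True
    let ?n = "CARD('r)" and ?r = "refl i" and ?g = "F (u \<circ> cyc_inv)" and ?a = "u (coord CARD('r))"
    have ne: "coord i \<noteq> (coord (i+1)::'r)" using i coord_strict_mono[where 'a='r, of i "i+1"] by simp
    have iu: "inv (u \<circ> cyc_inv) a = cyc (inv u a)" for a
      using u by (simp add: o_inv_distrib)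
    have last: "coord_index (coord ?n :: 'r) = ?n" by (rule coord_index_coord) (use i in auto)
    have cyc_less: "cyc a < cyc b \<longleftrightarrow> (if coord_index b = ?n then False else if coord_index a = ?n then True else a < b)"
      if "a \<noteq> b" for a b :: 'r
      using that coord_index_bounds[of a] coord_index_bounds[of b] 
      by (auto simp: coord_index_less_iff[of "cyc a"] coord_index_less_iff[of a b] coord_index_cyc simp del: coord_index_bounds)
    \<comment> \<open>Three cases for the new variable x_a: for a = i the descent disappears and the
      divided difference is -x_{i+1}; for a = i + 1 a descent appears and it is x_{i+1}; otherwise
      both are unaffected.\<close>
    have key: "smul (kd (ldesc u i)) (x_pow (perm_act (s_perm i) (eps ?a)) * ?r ?g) 
        + smul hecke_par (demazure i (x_pow (eps ?a)) * ?r ?g)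
      = smul (kd (ldesc (u \<circ> cyc_inv) i)) (x_pow (eps ?a) * ?r ?g)"
    proof -
      have ab: "inv u (coord (i+1)) \<noteq> inv u (coord i)" using ne u by (metis inv_f_f_bij(2))
      have a1: "?a = coord i \<longleftrightarrow> coord_index (inv u (coord i)) = ?n"
        using u last by (metis coord_coord_index inv_f_f_bij)
      have a2: "?a = coord (i+1) \<longleftrightarrow> coord_index (inv u (coord (i+1))) = ?n"
        using u last by (metis coord_coord_index inv_f_f_bij)
      consider "?a = coord i" | "?a = coord (i+1)" | "?a \<noteq> coord i" "?a \<noteq> coord (i+1)" by blast
      then show ?thesis
      proof cases
        case 1
        then have "\<not> ldesc (u \<circ> cyc_inv) i" "ldesc u i" 
          unfolding iu cyc_less[OF ab] using a1 a2 ne coord_index_bounds(3)[of "inv u (coord (i+1))"]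
          by (auto simp: coord_index_less_iff[of "inv u (coord (Suc i))"] le_less)
        then show ?thesis using 1 s_perm_coord[OF i]
          by (simp add: kd_def perm_act_eps demazure_eps[OF i] smul_simps)
      next
        case 2
        then have "ldesc (u \<circ> cyc_inv) i" "\<not> ldesc u i" 
          unfolding iu cyc_less[OF ab] using a1 a2 ne coord_index_bounds(3)[of "inv u (coord i)"]
          by (auto simp: coord_index_less_iff[of "inv u (coord (Suc i))"] simp del: coord_index_bounds)
        then show ?thesis using 2 ne
          by (simp add: kd_def demazure_eps[OF i] smul_simps)
      next
        case 3
        then have "ldesc (u \<circ> cyc_inv) i = ldesc u i" 
          unfolding iu cyc_less[OF ab] using a1 a2 by auto
        then show ?thesis using 3
          by (simp add: perm_act_eps demazure_eps[OF i] smul_simps s_perm_def)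
      qed
    qed
    have "LT i (RP F) u = x_pow (eps ?a) * ?r (F (s_perm i \<circ> u \<circ> cyc_inv)) + x_pow (eps ?a) * smul hecke_par (demazure i ?g)
       + (smul (kd (ldesc u i)) (x_pow (perm_act (s_perm i) (eps ?a)) * ?r ?g) 
        + smul hecke_par (demazure i (x_pow (eps ?a)) * ?r ?g))"
      using u by (simp add: LT_def RP_def refl_x_pow_mult demazure_x_pow_mult[OF i] perm_act_eps smul_simps smul_mult)
    also have "\<dots> = RP (LT i F) u"
      unfolding key using u by (simp add: LT_def RP_def smul_simps comp_assoc smul_mult algebra_simps)
    finally show ?thesis .
  qed (simp add: LT_def RP_def)
qed

lemma cyc_comp [simp]: "cyc \<circ> cyc_inv = id" "cyc_inv \<circ> cyc = id"
  by (auto simp: fun_eq_iff)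

lemma cyc_last [simp]: "cyc (coord CARD('r)) = (coord 1 :: 'r::{finite,linorder})"
  and cyc_inv_first [simp]: "cyc_inv (coord 1) = (coord CARD('r) :: 'r)"
  using coord_index_coord[where 'a='r, of "CARD('r)"] coord_index_coord[where 'a='r, of 1]
  by (auto simp: cyc_def cyc_inv_def Suc_leI)

text \<open>All multiplications cut functions down to bijections, so \<open>RP\<close> and
  \<open>RPi\<close> are mutually inverse only up to this restriction.\<close>

definition restr :: "('r::{finite,linorder}, 'v::{finite,linorder}) hmod \<Rightarrow> ('r, 'v) hmod"
  where "restr F = (\<lambda>u. if bij u then F u else 0)"

lemma RP_RPi: "RP (RPi F) = restr F" and RPi_RP: "RPi (RP F) = restr F"
  for F :: "('r::{finite,linorder}, 'v::{finite,linorder}) hmod"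
  by (auto simp: RP_def RPi_def restr_def fun_eq_iff comp_assoc simp del: o_apply One_nat_def) (auto simp del: One_nat_def)

lemma restr_LT [simp]: "restr (LT i F) = LT i F" "LT i (restr F) = LT i F"
  and restr_RT [simp]: "restr (RT i F) = RT i F"
  and restr_RP [simp]: "restr (RP F) = RP F" "restr (RPi F) = RPi F" "RPi (restr F) = RPi F"
  by (auto simp: restr_def LT_def RT_def RP_def RPi_def)

lemma LT_RPi: 
  fixes F :: "('r::{finite,linorder}, 'v::{finite,linorder}) hmod"
  assumes "1 \<le> i" "i < CARD('r)"
  shows "LT i (RPi F) = RPi (LT i F)"
proof -
  have "RPi (LT i F) = RPi (LT i (RP (RPi F)))" by (simp add: RP_RPi)
  also have "\<dots> = RPi (RP (LT i (RPi F)))" using LT_RP[OF assms] by metis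
  also have "\<dots> = LT i (RPi F)" by (simp add: RPi_RP)
  finally show ?thesis ..
qed

section \<open>Operators that commute with right multiplication\<close>

definition hadd :: "('r::{finite,linorder}, 'v::{finite,linorder}) hmod \<Rightarrow> ('r, 'v) hmod \<Rightarrow> ('r, 'v) hmod"
  where "hadd F H = (\<lambda>u. F u + H u)"

definition hsmul :: "'v pfield \<Rightarrow> ('r::{finite,linorder}, 'v::{finite,linorder}) hmod \<Rightarrow> ('r, 'v) hmod"
  where "hsmul c F = (\<lambda>u. smul c (F u))"

definition hx :: "'r weight \<Rightarrow> ('r::{finite,linorder}, 'v::{finite,linorder}) hmod \<Rightarrow> ('r, 'v) hmod"
  where "hx \<beta> F = (\<lambda>u. x_pow \<beta> * F u)"

text \<open>Endomorphisms of the Hecke algebra as a right module over itself, phrased through the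
  right multiplications by generators.\<close>

definition leftop :: "(('r, 'v) hmod \<Rightarrow> ('r::{finite,linorder}, 'v::{finite,linorder}) hmod) \<Rightarrow> bool"
  where "leftop S \<longleftrightarrow> (\<forall>F H. S (hadd F H) = hadd (S F) (S H)) \<and> (\<forall>c F. S (hsmul c F) = hsmul c (S F)) \<and>
    (\<forall>j F. 1 \<le> j \<longrightarrow> j < CARD('r) \<longrightarrow> S (RT j F) = RT j (S F)) \<and>
    (\<forall>F. S (RP F) = RP (S F)) \<and> (\<forall>F. S (RPi F) = RPi (S F))"

lemma RT_lin: "RT j (hadd F H) = hadd (RT j F) (RT j H)" "RT j (hsmul c F) = hsmul c (RT j F)"
  and RP_lin: "RP (hadd F H) = hadd (RP F) (RP H)" "RP (hsmul c F) = hsmul c (RP F)"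
  and RPi_lin: "RPi (hadd F H) = hadd (RPi F) (RPi H)" "RPi (hsmul c F) = hsmul c (RPi F)"
  by (auto simp: RT_def RP_def RPi_def hadd_def hsmul_def fun_eq_iff smul_simps distrib_left smul_mult mult.commute)

lemma LT_lin: "LT j (hadd F H) = hadd (LT j F) (LT j H)" "LT j (hsmul c F) = hsmul c (LT j F)"
  by (auto simp: LT_def hadd_def hsmul_def fun_eq_iff smul_simps distrib_left smul_mult refl_lin demazure_lin mult.commute)

lemma leftop_LT: "1 \<le> i \<Longrightarrow> i < CARD('r) \<Longrightarrow> leftop (LT i :: ('r::{finite,linorder}, 'v::{finite,linorder}) hmod \<Rightarrow> _)"
  unfolding leftop_def by (simp add: LT_lin LT_RT LT_RP LT_RPi)

lemma leftop_hx: "leftop (hx \<beta>)"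
  unfolding leftop_def by (auto simp: hx_def hadd_def hsmul_def RT_def RP_def RPi_def smul_simps distrib_left smul_mult mult.left_commute fun_eq_iff)

lemma leftop_comp: "leftop S \<Longrightarrow> leftop T \<Longrightarrow> leftop (\<lambda>F. S (T F))"
  unfolding leftop_def by simp

lemmas leftop_LT_comp = leftop_comp[OF leftop_LT]

lemma hadd_hsmul: "hsmul c (hadd F H) = hadd (hsmul c F) (hsmul c H)" "hsmul c (hsmul d F) = hsmul (c * d) F"
  "hadd (hadd F G) H = hadd F (hadd G H)" "hadd F G = hadd G F" "hadd F (hadd G H) = hadd G (hadd F H)"
  "hsmul 1 F = F" "hadd F (hsmul 0 G) = F"
  by (auto simp: hadd_def hsmul_def fun_eq_iff smul_simps)

lemma leftop_add: "leftop S \<Longrightarrow> leftop T \<Longrightarrow> leftop (\<lambda>F. hadd (S F) (T F))"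
  unfolding leftop_def by (simp add: hadd_hsmul RT_lin RP_lin RPi_lin)

lemma leftop_smul: "leftop S \<Longrightarrow> leftop (\<lambda>F. hsmul c (S F))"
  unfolding leftop_def by (simp add: hadd_hsmul RT_lin RP_lin RPi_lin mult.commute)

lemma leftop_id: "leftop (\<lambda>F. F)"
  unfolding leftop_def by simp

text \<open>The right submodule generated by the unit, as an inductive predicate so that agreement
  of two module maps propagates by rule induction.\<close>

inductive gen :: "('r::{finite,linorder}, 'v::{finite,linorder}) hmod \<Rightarrow> bool" where
  gen_one: "gen (mon 0 id)"
| gen_RT: "gen F \<Longrightarrow> 1 \<le> j \<Longrightarrow> j < CARD('r) \<Longrightarrow> gen (RT j (F :: ('r, 'v) hmod))"
| gen_RP: "gen F \<Longrightarrow> gen (RP F)"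
| gen_RPi: "gen F \<Longrightarrow> gen (RPi F)"
| gen_add: "gen F \<Longrightarrow> gen H \<Longrightarrow> gen (hadd F H)"
| gen_smul: "gen F \<Longrightarrow> gen (hsmul c F)"

text \<open>A map of cyclic right modules is determined by its value at the generator. Each relation
  between left multiplications is thereby reduced to a computation with one basis element.\<close>

lemma leftop_eq:
  assumes "leftop S" "leftop T" "S (mon 0 id) = T (mon 0 id)" "gen F"
  shows "S F = T F"
  using assms(4) by induction (use assms(1-3) in \<open>auto simp: leftop_def\<close>)

lemma mon_comp: "bij p \<Longrightarrow> mon \<beta> u (v \<circ> p) = mon \<beta> (u \<circ> inv p) v"
proof -
  assume p: "bij p"
  have "v \<circ> p = u \<longleftrightarrow> v = u \<circ> inv p"
    using p by (metis bij_is_inj bij_is_surj comp_assoc comp_id inv_o_cancel surj_iff)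
  then show ?thesis by (simp add: mon_def)
qed

lemma mon_not_bij: "bij u \<Longrightarrow> \<not> bij v \<Longrightarrow> mon \<beta> u v = 0"
  by (auto simp: mon_def)

lemma restr_mon: "bij u \<Longrightarrow> restr (mon \<beta> u) = mon \<beta> u"
  by (rule ext) (simp add: restr_def mon_not_bij)

lemma RT_mon: 
  fixes u :: "'r::{finite,linorder} \<Rightarrow> 'r"
  assumes u: "bij u"
  shows "RT j (mon \<beta> u :: ('r, 'v::{finite,linorder}) hmod) = hadd (mon \<beta> (u \<circ> s_perm j)) (hsmul (kd (rdesc u j)) (mon \<beta> u))"
proof
  fix v
  show "RT j (mon \<beta> u :: ('r, 'v) hmod) v = hadd (mon \<beta> (u \<circ> s_perm j)) (hsmul (kd (rdesc u j)) (mon \<beta> u)) v"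
  proof (cases "bij v")
    case True
    have "smul (kd (rdesc v j)) (mon \<beta> u v) = (smul (kd (rdesc u j)) (mon \<beta> u v) :: ('r, 'v) laurent)"
      by (cases "v = u") (simp_all add: mon_def smul_simps)
    then show ?thesis using True by (simp only: RT_def hadd_def hsmul_def mon_comp[OF bij_s_perm] inv_s_perm if_True)
  next
    case False
    have "bij (u \<circ> s_perm j)" using u by (rule bij_comp'[OF _ bij_s_perm])
    with False show ?thesis using u by (simp add: RT_def hadd_def hsmul_def mon_not_bij smul_simps del: o_apply)
  qed
qed

text \<open>An element of length zero permutes the basis; unlike \<open>RT_mon\<close> there is no
  second term.\<close>

lemma RP_mon: 
  fixes u :: "'r::{finite,linorder} \<Rightarrow> 'r"
  assumes u: "bij u"
  shows "RP (mon \<beta> u :: ('r, 'v::{finite,linorder}) hmod) = mon (\<beta> + eps (u (coord 1))) (u \<circ> cyc)"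
proof
  fix v
  show "RP (mon \<beta> u :: ('r, 'v) hmod) v = mon (\<beta> + eps (u (coord 1))) (u \<circ> cyc) v"
  proof (cases "bij v")
    case True
    have "RP (mon \<beta> u :: ('r, 'v) hmod) v = x_pow (eps (v (coord CARD('r)))) * mon \<beta> (u \<circ> cyc) v"
      using True by (simp only: RP_def mon_comp[OF bij_cyc(2)] inv_cyc if_True)
    also have "\<dots> = mon (\<beta> + eps (u (coord 1))) (u \<circ> cyc) v"
      by (cases "v = u \<circ> cyc") (simp_all add: mon_def x_pow_add mult.commute del: One_nat_def)
    finally show ?thesis .
  next
    case False
    have "bij (u \<circ> cyc)" using u by (rule bij_comp'[OF _ bij_cyc(1)])
    with False show ?thesis by (simp add: RP_def mon_not_bij del: o_apply)
  qed
qed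

lemma RPi_mon: 
  fixes u :: "'r::{finite,linorder} \<Rightarrow> 'r"
  assumes u: "bij u"
  shows "RPi (mon \<beta> u :: ('r, 'v::{finite,linorder}) hmod) = mon (\<beta> - eps (u (coord CARD('r)))) (u \<circ> cyc_inv)"
proof
  fix v
  show "RPi (mon \<beta> u :: ('r, 'v) hmod) v = mon (\<beta> - eps (u (coord CARD('r)))) (u \<circ> cyc_inv) v"
  proof (cases "bij v")
    case True
    have "RPi (mon \<beta> u :: ('r, 'v) hmod) v = x_pow (- eps (v (coord 1))) * mon \<beta> (u \<circ> cyc_inv) v"
      using True by (simp only: RPi_def mon_comp[OF bij_cyc(1)] inv_cyc if_True)
    also have "\<dots> = mon (\<beta> - eps (u (coord CARD('r)))) (u \<circ> cyc_inv) v"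
      by (cases "v = u \<circ> cyc_inv") (simp_all add: mon_def flip: x_pow_add del: One_nat_def)
    finally show ?thesis .
  next
    case False
    have "bij (u \<circ> cyc_inv)" using u by (rule bij_comp'[OF _ bij_cyc(2)])
    with False show ?thesis by (simp add: RPi_def mon_not_bij del: o_apply)
  qed
qed

lemma LT_mon0: 
  fixes u :: "'r::{finite,linorder} \<Rightarrow> 'r"
  assumes u: "bij u" and i: "1 \<le> i" "i < CARD('r)"
  shows "LT i (mon 0 u :: ('r, 'v::{finite,linorder}) hmod) = hadd (mon 0 (s_perm i \<circ> u)) (hsmul (kd (ldesc u i)) (mon 0 u))"
proof
  fix v
  show "LT i (mon 0 u :: ('r, 'v) hmod) v = hadd (mon 0 (s_perm i \<circ> u)) (hsmul (kd (ldesc u i)) (mon 0 u)) v"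
  proof (cases "bij v")
    case True
    have r: "refl i (mon 0 u w) = (mon 0 u w :: ('r, 'v) laurent)" "demazure i (mon 0 u w) = (0 :: ('r, 'v) laurent)" for w
      using refl_x_pow[of i "0 :: 'r weight"] i
      by (cases "w = u"; simp add: mon_def refl_lin demazure_lin)+
    have c: "mon 0 u (s_perm i \<circ> v) = (mon 0 (s_perm i \<circ> u) v :: ('r, 'v) laurent)"
    proof -
      have "s_perm i \<circ> v = u \<longleftrightarrow> v = s_perm i \<circ> u" by (metis comp_assoc id_comp s_perm_comp_invol)
      then show ?thesis by (simp add: mon_def)
    qed
    have "smul (kd (ldesc v i)) (mon 0 u v) = (smul (kd (ldesc u i)) (mon 0 u v) :: ('r, 'v) laurent)"
      by (cases "v = u") (simp_all add: mon_def smul_simps)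
    then show ?thesis using True by (simp only: LT_def hadd_def hsmul_def r c if_True smul_simps add_0_right)
  next
    case False
    have "bij (s_perm i \<circ> u)" using u by (rule bij_comp'[OF bij_s_perm])
    with False show ?thesis using u by (simp add: LT_def hadd_def hsmul_def mon_not_bij smul_simps del: o_apply)
  qed
qed

text \<open>Subtracting the descent term from \<open>RT i\<close> appends the letter i to the
  permutation, and every permutation is \<open>u\<close> followed by some word.\<close>

lemma gen_mon_perm:
  assumes "gen (mon \<beta> u :: ('r::{finite,linorder}, 'v::{finite,linorder}) hmod)" "bij u" "bij v"
  shows "gen (mon \<beta> v :: ('r, 'v) hmod)"
proof -
  have "gen (mon \<beta> (u \<circ> word_perm ws) :: ('r, 'v) hmod)" if "set ws \<subseteq> {1..<CARD('r)}" "bij u" "gen (mon \<beta> u :: ('r, 'v) hmod)" for ws and u :: "'r \<Rightarrow> 'r"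
    using that
  proof (induction ws arbitrary: u)
    case (Cons i ws)
    have "gen (hadd (RT i (mon \<beta> u :: ('r, 'v) hmod)) (hsmul (- kd (rdesc u i)) (mon \<beta> u)))"
      using Cons.prems by (auto intro!: gen.intros)
    moreover have "hadd (RT i (mon \<beta> u :: ('r, 'v) hmod)) (hsmul (- kd (rdesc u i)) (mon \<beta> u)) = mon \<beta> (u \<circ> s_perm i)"
      unfolding RT_mon[OF Cons.prems(2)] by (auto simp: hadd_def hsmul_def fun_eq_iff smul_simps)
    ultimately have g: "gen (mon \<beta> (u \<circ> s_perm i) :: ('r, 'v) hmod)" by metis
    have "set ws \<subseteq> {1..<CARD('r)}" using Cons.prems(1) by simp
    from Cons.IH[OF this bij_comp'[OF Cons.prems(2) bij_s_perm] g]
    show ?case unfolding word_perm_simps comp_assoc .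
  qed simp
  moreover obtain ws where "set ws \<subseteq> {1..<CARD('r)}" "word_perm ws = inv u \<circ> v"
    using perm_word_exists[of "inv u \<circ> v"] assms by (auto simp: bij_imp_bij_inv)
  ultimately have "gen (mon \<beta> (u \<circ> (inv u \<circ> v)) :: ('r, 'v) hmod)" using assms by metis
  moreover have "u \<circ> (inv u \<circ> v) = v" using assms by (simp add: fun_eq_iff inv_f_f_bij(2))
  ultimately show ?thesis by simp
qed

lemma gen_mon: "bij u \<Longrightarrow> gen (mon \<beta> u :: ('r::{finite,linorder}, 'v::{finite,linorder}) hmod)"
proof (induction \<beta> arbitrary: u rule: weight_pm_induct)
  case zero
  show ?case by (rule gen_mon_perm[OF gen_one]) (use zero in auto)
next
  case (add \<beta> a)
  \<comment> \<open>\<open>RP\<close> raises the exponent at the image of the first position, so a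
    permutation that sends this position to \<open>a\<close> is used.\<close>
  define v :: "'r \<Rightarrow> 'r" where "v = Transposition.transpose (coord 1) a"
  have v: "bij v" "v (coord 1) = a" by (auto simp: v_def)
  have "gen (RP (mon \<beta> v :: ('r, 'v) hmod))" by (intro gen.intros add v)
  then have "gen (mon (\<beta> + eps a) (v \<circ> cyc) :: ('r, 'v) hmod)" unfolding RP_mon[OF v(1)] v(2) .
  then show ?case by (rule gen_mon_perm) (use v add in auto)
next
  case (sub \<beta> a)
  define v :: "'r \<Rightarrow> 'r" where "v = Transposition.transpose (coord CARD('r)) a"
  have v: "bij v" "v (coord CARD('r)) = a" by (auto simp: v_def)
  have "gen (RPi (mon \<beta> v :: ('r, 'v) hmod))" by (intro gen.intros sub v)
  then have "gen (mon (\<beta> - eps a) (v \<circ> cyc_inv) :: ('r, 'v) hmod)" unfolding RPi_mon[OF v(1)] v(2) .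
  then show ?case by (rule gen_mon_perm) (use v sub in auto)
qed

lemma LT_mon0_asc: "bij u \<Longrightarrow> 1 \<le> i \<Longrightarrow> i < CARD('r) \<Longrightarrow> inv u (coord i) < inv u (coord (i + 1)) \<Longrightarrow>
   LT i (mon 0 u :: ('r, 'v::{finite,linorder}) hmod) = mon 0 (s_perm i \<circ> u)"
  for u :: "'r::{finite,linorder} \<Rightarrow> 'r"
  by (simp add: LT_mon0 kd_def hadd_hsmul(7) order_less_not_sym)

lemma coord_less_Suc: "1 \<le> i \<Longrightarrow> i < CARD('r) \<Longrightarrow> coord i < (coord (i + 1) :: 'r::{finite,linorder})"
  by (rule coord_strict_mono) auto

lemma LT_quadratic:
  assumes i: "1 \<le> i" "i < CARD('r)" and "gen (F :: ('r::{finite,linorder}, 'v::{finite,linorder}) hmod)"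
  shows "LT i (LT i F) = hadd F (hsmul hecke_par (LT i F))"
proof (rule leftop_eq[OF _ _ _ assms(3)])
  have 1: "LT i (mon 0 id) = (mon 0 (s_perm i) :: ('r, 'v) hmod)"
    using LT_mon0_asc[of id i] coord_less_Suc[OF i] i by simp
  show "LT i (LT i (mon 0 id)) = hadd (mon 0 id :: ('r, 'v) hmod) (hsmul hecke_par (LT i (mon 0 id)))"
    unfolding 1 using coord_less_Suc[OF i] s_perm_coord[OF i] i by (simp add: LT_mon0 kd_def)
qed (intro leftop_LT_comp leftop_LT leftop_add leftop_smul leftop_id i)+

lemma LT_commute:
  assumes i: "1 \<le> i" "i < CARD('r)" and j: "1 \<le> j" "j < CARD('r)" and ij: "j \<noteq> i" "j \<noteq> i + 1" "i \<noteq> j + 1"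
    and "gen (F :: ('r::{finite,linorder}, 'v::{finite,linorder}) hmod)"
  shows "LT i (LT j F) = LT j (LT i F)"
proof (rule leftop_eq[OF _ _ _ assms(8)])
  have 1: "LT i (mon 0 id) = (mon 0 (s_perm i) :: ('r, 'v) hmod)" if "1 \<le> i" "i < CARD('r)" for i
    using LT_mon0_asc[of id i] coord_less_Suc[OF that] that by simp
  have 2: "LT i (mon 0 (s_perm j)) = (mon 0 (s_perm i \<circ> s_perm j) :: ('r, 'v) hmod)" 
    if i: "1 \<le> i" "i < CARD('r)" and j: "1 \<le> j" "j < CARD('r)" and ij: "j \<noteq> i" "j \<noteq> i + 1" "i \<noteq> j + 1" for i j
  proof (rule LT_mon0_asc)
    have "s_perm j (coord i) = (coord i::'r)" "s_perm j (coord (i+1)) = (coord (i+1)::'r)"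
      using i j ij by (auto simp: s_perm_apply)
    then show "inv (s_perm j) (coord i) < (inv (s_perm j) (coord (i+1)) :: 'r)"
      using coord_less_Suc[OF i] by simp
  qed (use i in auto)
  have 3: "s_perm i \<circ> s_perm j = s_perm j \<circ> (s_perm i :: 'r \<Rightarrow> 'r)"
    using i j ij by (intro ext, subst coord_index_inj[symmetric]) (simp add: coord_index_s_perm del: coord_index_inj)
  show "LT i (LT j (mon 0 id :: ('r, 'v) hmod)) = LT j (LT i (mon 0 id))"
    using 1[OF i] 1[OF j] 2[OF i j ij] 2[OF j i] ij 3 by simp
qed (intro leftop_LT_comp leftop_LT i j)+

lemma LT_braid:
  assumes i: "1 \<le> i" "i + 1 < CARD('r)"
    and "gen (F :: ('r::{finite,linorder}, 'v::{finite,linorder}) hmod)"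
  shows "LT i (LT (i + 1) (LT i F)) = LT (i + 1) (LT i (LT (i + 1) F))"
proof (rule leftop_eq[OF _ _ _ assms(3)])
  let ?s = "s_perm i :: 'r \<Rightarrow> 'r" and ?t = "s_perm (i + 1) :: 'r \<Rightarrow> 'r"
  have i': "i < CARD('r)" "1 \<le> i + 1" using i by auto
  have lt: "coord i < (coord (i + 1) :: 'r)" "coord (i + 1) < (coord (i + 2) :: 'r)" "coord i < (coord (i + 2) :: 'r)"
    using i by (auto intro!: coord_strict_mono)
  have s: "?s (coord i) = coord (i+1)" "?s (coord (i+1)) = coord i" "?s (coord (i+2)) = coord (i+2)"
    and t: "?t (coord i) = coord i" "?t (coord (i+1)) = coord (i+2)" "?t (coord (i+2)) = coord (i+1)"
    using i by (auto simp: s_perm_apply)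
  have inv: "inv (p \<circ> q) = inv q \<circ> inv p" if "bij p" "bij q" for p q :: "'r \<Rightarrow> 'r"
    using that by (rule o_inv_distrib)
  have 1: "LT i (mon 0 id) = (mon 0 ?s :: ('r, 'v) hmod)" "LT (i+1) (mon 0 id) = (mon 0 ?t :: ('r, 'v) hmod)"
    using LT_mon0_asc[of "id :: 'r \<Rightarrow> 'r" i] LT_mon0_asc[of "id :: 'r \<Rightarrow> 'r" "i+1"] lt i i' by simp_all
  \<comment> \<open>Every factor is met at an ascent, so no second terms arise: both sides are
    single basis elements, and the braid relation of permutations identifies them.\<close>
  have 2: "LT i (mon 0 ?t) = (mon 0 (?s \<circ> ?t) :: ('r, 'v) hmod)" by (rule LT_mon0_asc) (use i i' lt t in simp_all)
  have 3: "LT (i+1) (mon 0 ?s) = (mon 0 (?t \<circ> ?s) :: ('r, 'v) hmod)" by (rule LT_mon0_asc) (use i i' lt s in simp_all)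
  have 4: "LT i (mon 0 (?t \<circ> ?s)) = (mon 0 (?s \<circ> (?t \<circ> ?s)) :: ('r, 'v) hmod)" by (rule LT_mon0_asc) (use i i' lt s t in \<open>simp_all add: inv\<close>)
  have 5: "LT (i+1) (mon 0 (?s \<circ> ?t)) = (mon 0 (?t \<circ> (?s \<circ> ?t)) :: ('r, 'v) hmod)" by (rule LT_mon0_asc) (use i i' lt s t in \<open>simp_all add: inv\<close>)
  have 6: "?s \<circ> (?t \<circ> ?s) = ?t \<circ> (?s \<circ> ?t)"
    using i by (intro ext, subst coord_index_inj[symmetric]) (simp add: coord_index_s_perm del: coord_index_inj)
  show "LT i (LT (i + 1) (LT i (mon 0 id))) = LT (i + 1) (LT i (LT (i + 1) (mon 0 id :: ('r, 'v) hmod)))"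
    unfolding 1 2 3 4 5 6 ..
qed (intro leftop_LT_comp leftop_LT; use i in simp)+

section \<open>The parameters\<close>

text \<open>The exponent of q, whose indeterminate has index 2, for quotients of monomials only. On
  these it is additive and unique, and having an exponent at all certifies that the element is
  nonzero; all spectral values are of this kind.\<close>

definition qdeg :: "'v::{finite,linorder} pfield \<Rightarrow> int \<Rightarrow> bool"
  where "qdeg x d \<longleftrightarrow> (\<exists>a b c e. c \<noteq> 0 \<and> e \<noteq> 0 \<and> x = Fract (Poly_Mapping.single a c) (Poly_Mapping.single b e) \<and>
    d = int (Poly_Mapping.lookup a (coord 2)) - int (Poly_Mapping.lookup b (coord 2)))"

lemma single_nz: "c \<noteq> 0 \<Longrightarrow> Poly_Mapping.single a c \<noteq> 0"
  by (metis lookup_single_eq lookup_zero)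

lemma qdegI: "c \<noteq> 0 \<Longrightarrow> e \<noteq> 0 \<Longrightarrow> x = Fract (Poly_Mapping.single a c) (Poly_Mapping.single b e) \<Longrightarrow>
    d = int (Poly_Mapping.lookup a (coord 2)) - int (Poly_Mapping.lookup b (coord 2)) \<Longrightarrow> qdeg x d"
  unfolding qdeg_def by blast

lemma qdeg_unique: 
  assumes "qdeg x d" "qdeg x d'"
  shows "d = d'"
proof -
  from assms(1) obtain a b c e where 1: "c \<noteq> 0" "e \<noteq> 0" "x = Fract (Poly_Mapping.single a c) (Poly_Mapping.single b e)"
    "d = int (Poly_Mapping.lookup a (coord 2)) - int (Poly_Mapping.lookup b (coord 2))" unfolding qdeg_def by blast
  from assms(2) obtain a' b' c' e' where 2: "c' \<noteq> 0" "e' \<noteq> 0" "x = Fract (Poly_Mapping.single a' c') (Poly_Mapping.single b' e')"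
    "d' = int (Poly_Mapping.lookup a' (coord 2)) - int (Poly_Mapping.lookup b' (coord 2))" unfolding qdeg_def by blast
  have "Poly_Mapping.single (a + b') (c * e') = Poly_Mapping.single (a' + b) (c' * e)"
    using 1 2 by (simp add: eq_fract single_nz mult_single)
  then have "a + b' = a' + b" using 1 2 by (metis lookup_single_eq lookup_single_not_eq mult_eq_0_iff)
  then have "Poly_Mapping.lookup (a + b') (coord 2) = Poly_Mapping.lookup (a' + b) (coord 2)" by simp
  then show ?thesis using 1 2 by (simp add: lookup_add)
qed

lemma qdeg_mult: 
  assumes "qdeg x d" "qdeg y d'"
  shows "qdeg (x * y) (d + d')"
proof -
  from assms(1) obtain a b c e where 1: "c \<noteq> 0" "e \<noteq> 0" "x = Fract (Poly_Mapping.single a c) (Poly_Mapping.single b e)"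
    "d = int (Poly_Mapping.lookup a (coord 2)) - int (Poly_Mapping.lookup b (coord 2))" unfolding qdeg_def by blast
  from assms(2) obtain a' b' c' e' where 2: "c' \<noteq> 0" "e' \<noteq> 0" "y = Fract (Poly_Mapping.single a' c') (Poly_Mapping.single b' e')"
    "d' = int (Poly_Mapping.lookup a' (coord 2)) - int (Poly_Mapping.lookup b' (coord 2))" unfolding qdeg_def by blast
  show ?thesis by (rule qdegI[of "c * c'" "e * e'" _ "a + a'" "b + b'"]) (use 1 2 in \<open>simp_all add: mult_single lookup_add\<close>)
qed

lemma qdeg_inverse: "qdeg x d \<Longrightarrow> qdeg (inverse x) (- d)"
  unfolding qdeg_def by (clarsimp simp: inverse_fract) (metis minus_diff_eq)

lemma qdeg_nonzero: "qdeg x d \<Longrightarrow> x \<noteq> 0"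
  unfolding qdeg_def by (auto simp: Zero_fract_def eq_fract single_nz)

lemma qdeg_1: "qdeg 1 0" and qdeg_m1: "qdeg (-1) 0"
proof -
  show "qdeg 1 0" by (rule qdegI[of 1 1 _ 0 0]) (simp_all add: One_fract_def)
  show "qdeg (-1) 0" by (rule qdegI[of "-1" 1 _ 0 0]) (simp_all add: One_fract_def single_uminus)
qed

lemma qdeg_power: "qdeg x d \<Longrightarrow> qdeg (x ^ m) (int m * d)"
proof (induction m)
  case (Suc m)
  from qdeg_mult[OF Suc(2) Suc(1)[OF Suc(2)]] show ?case by (simp add: algebra_simps)
qed (simp add: qdeg_1)

lemma qdeg_power_int: "qdeg x d \<Longrightarrow> qdeg (x powi m) (m * d)"
  using qdeg_power[of x d "nat m"] qdeg_inverse[OF qdeg_power[of x d "nat (- m)"]]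
  by (cases "m \<ge> 0") (simp_all add: power_int_def power_inverse)

lemma qdeg_prod: "(\<And>i. i \<in> A \<Longrightarrow> qdeg (f i) 0) \<Longrightarrow> qdeg (\<Prod>i\<in>A. f i) 0"
proof (induction A rule: infinite_finite_induct)
  case (insert x F)
  then show ?case using qdeg_mult[of "f x" 0 "prod f F" 0] by simp
qed (simp_all add: qdeg_1)

lemma qdeg_indet: "qdeg (indet j :: 'v::{finite,linorder} pfield) (if coord j = (coord 2 :: 'v) then 1 else 0)"
  unfolding indet_def by (rule qdegI[of 1 1 _ "Poly_Mapping.single (coord j) 1" 0]) (auto simp: lookup_single when_def)

lemma qdeg_qpar: "qdeg qpar 1"
  using qdeg_indet[of 2] by (simp add: qpar_def)

locale metaplectic_params =
  fixes n :: nat and sg :: "'v::{finite,linorder} pfield"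
  assumes n1: "n \<ge> 1" and cardv: "CARD('v) = (n - 1) div 2 + 2" and sg: "sg \<in> {1, -1}"
begin

lemma qdeg_kpar: "qdeg (kpar :: 'v pfield) 0"
proof -
  have "coord 1 \<noteq> (coord 2 :: 'v)" using cardv coord_eq_iff[where 'a='v, of 1 2] by simp
  then show ?thesis using qdeg_indet[where 'v='v, of 1] by (simp add: kpar_def)
qed

lemma kpar_nz [simp]: "(kpar :: 'v pfield) \<noteq> 0"
  using qdeg_nonzero[OF qdeg_kpar] .

lemma qpar_nz [simp]: "(qpar :: 'v pfield) \<noteq> 0"
  using qdeg_nonzero[OF qdeg_qpar] .

text \<open>The indeterminates G_m have index m + 2 with m at least 1, hence never that of q; the
  sign for 2m = n is a constant.\<close>

lemma qdeg_Gpar: "qdeg (Gpar n sg j) 0"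
proof -
  let ?a = "nat (j mod int n)"
  have i: "qdeg (indet (m + 2) :: 'v pfield) 0" if "1 \<le> m" "2 * m < n" for m
  proof -
    have "m + 2 \<le> CARD('v)" using that cardv by linarith
    then have "coord (m+2) \<noteq> (coord 2 :: 'v)" using that coord_eq_iff[where 'a='v, of "m+2" 2] by auto
    then show ?thesis using qdeg_indet[where 'v='v, of "m+2"] by simp
  qed
  consider "?a = 0" | "?a \<noteq> 0" "2 * ?a < n" | "?a \<noteq> 0" "2 * ?a = n" | "?a \<noteq> 0" "2 * ?a > n" by linarith
  then show ?thesis
  proof cases
    case 1 then show ?thesis using qdeg_kpar by (simp add: Gpar_def)
  next
    case 2 then have "Gpar n sg j = indet (?a + 2)" by (simp add: Gpar_def Let_def)
    then show ?thesis using i[of ?a] 2 by simp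
  next
    case 3 then have "Gpar n sg j = sg" by (simp add: Gpar_def Let_def)
    then show ?thesis using sg qdeg_1 qdeg_m1 by auto
  next
    case 4
    then have e: "Gpar n sg j = inverse (indet (n - ?a + 2))" by (simp add: Gpar_def Let_def)
    have "j mod int n < int n" using n1 by simp
    then have "?a < n" using n1 by linarith
    then have "1 \<le> n - ?a" "2 * (n - ?a) < n" using 4 by linarith+
    from qdeg_inverse[OF i[OF this]] show ?thesis unfolding e by simp
  qed
qed

lemma Gpar_nz [simp]: "Gpar n sg j \<noteq> 0"
  using qdeg_nonzero[OF qdeg_Gpar] .

lemma Gpar_dvd: "int n dvd j \<Longrightarrow> Gpar n sg j = kpar"
  by (simp add: Gpar_def)

lemma Gpar_cong: "j mod int n = j' mod int n \<Longrightarrow> Gpar n sg j = Gpar n sg j'"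
  by (simp add: Gpar_def)

text \<open>If j has residue a, then -j has residue n - a. This exchanges the ranges 2a < n and 2a >
  n, whose values are inverse by definition, and in the middle the sign is its own inverse.\<close>

lemma Gpar_neg: 
  assumes "\<not> int n dvd j"
  shows "Gpar n sg j * Gpar n sg (- j) = 1"
proof -
  define a where "a = nat (j mod int n)"
  have a: "a \<noteq> 0" "a < n" "int a = j mod int n"
    using assms n1 unfolding a_def by (auto simp: dvd_eq_mod_eq_0 nat_less_iff pos_mod_bound order.not_eq_order_implies_strict)
      (simp_all add: order_antisym_conv)
  have b: "nat (- j mod int n) = n - a"
    using assms a by (simp add: zmod_zminus1_eq_if dvd_eq_mod_eq_0)
  have nz: "(indet m :: 'v pfield) \<noteq> 0" for m using qdeg_nonzero[OF qdeg_indet[where 'v='v]] .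
  have e: "Gpar n sg j = (if 2 * a < n then indet (a + 2)
     else if 2 * a = n then sg else inverse (indet (n - a + 2)))" using a by (simp add: Gpar_def Let_def a_def)
  have e': "Gpar n sg (-j) = (if 2 * (n - a) < n then indet (n - a + 2)
     else if 2 * (n - a) = n then sg else inverse (indet (n - (n - a) + 2)))" using a b by (simp add: Gpar_def Let_def)
  consider "2 * a < n" | "2 * a = n" | "2 * a > n" by linarith
  then show ?thesis
  proof cases
    case 1
    then have "\<not> 2 * (n - a) < n" "2 * (n - a) \<noteq> n" "n - (n - a) = a" using a by linarith+
    then show ?thesis unfolding e e' using nz 1 by simp
  next
    case 2 then show ?thesis unfolding e e' using sg by auto
  next
    case 3 
    then have "2 * (n - a) < n" "\<not> 2 * a < n" "2 * a \<noteq> n" using a(2) by linarith+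
    then show ?thesis unfolding e e' using nz by simp
  qed
qed

lemma qdeg_sigma: "qdeg (sigma n sg j) 0"
  using qdeg_inverse[OF qdeg_kpar] by (simp add: sigma_def qdeg_Gpar)

lemma sigma_nz [simp]: "sigma n sg j \<noteq> 0"
  using qdeg_nonzero[OF qdeg_sigma] .

text \<open>At nonzero multiples of n one of the two arguments is positive and gives k^{-1}, while
  the other gives k. At 0 the product would be k^2, whence the hypothesis.\<close>

lemma sigma_neg: "j \<noteq> 0 \<Longrightarrow> sigma n sg j * sigma n sg (- j) = 1"
  using Gpar_neg[of j] by (cases "int n dvd j"; cases "j > 0") (auto simp: sigma_def Gpar_dvd)

lemma sigma_0: "sigma n sg 0 = kpar"
  by (simp add: sigma_def Gpar_dvd)

section \<open>The polynomial representation\<close>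

lemma lin_T_op [simp]: "lin (T_op n sg i)"
  by (simp add: T_op_def lin_lin_ext)

definition T_quot :: "nat \<Rightarrow> 'r weight \<Rightarrow> ('r::{finite,linorder}, 'v) laurent"
  where "T_quot i \<mu> = laurent_quot (1 - x_pow (- (t_floor n (ip \<mu> (simple_root i)) *s simple_root i)))
                    (1 - x_pow (int n *s simple_root i)) * x_pow \<mu>"

lemma T_op_x_pow: "T_op n sg i (x_pow \<mu>) = smul hecke_par (T_quot i \<mu>) 
   + smul (Gpar n sg (ip \<mu> (simple_root i))) (x_pow (perm_act (s_perm i) \<mu>))"
  by (simp add: T_op_def T_quot_def hecke_par_def)

lemma n_simple_root_nz:
  assumes "1 \<le> i" "i < CARD('r)"
  shows "int n *s simple_root i \<noteq> (0 :: 'r::{finite,linorder} weight)"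
proof -
  obtain a where "(simple_root i :: 'r weight) $ a \<noteq> 0" using simple_root_nz[OF assms] by (auto simp: vec_eq_iff)
  then have "(int n *s simple_root i :: 'r weight) $ a \<noteq> 0" using n1 by simp
  then show ?thesis by (metis zero_index)
qed

lemma t_floor_eq: "t_floor n a = (a div int n) * int n"
  by (simp add: t_floor_def minus_mod_eq_div_mult)

lemma T_quot_mult:
  fixes \<mu> :: "'r::{finite,linorder} weight"
  assumes i: "1 \<le> i" "i < CARD('r)"
  shows "T_quot i \<mu> * (1 - x_pow (int n *s simple_root i)) = 
    x_pow \<mu> - (x_pow (\<mu> - t_floor n (ip \<mu> (simple_root i)) *s simple_root i) :: ('r, 'v) laurent)"
proof -
  let ?a = "ip \<mu> (simple_root i)" and ?y = "1 - x_pow (int n *s simple_root i) :: ('r, 'v) laurent"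
  have e: "t_floor n ?a *s simple_root i = (?a div int n) *s (int n *s simple_root i :: 'r weight)"
    by (simp add: t_floor_eq vec_eq_iff mult.assoc)
  have "T_quot i \<mu> * ?y = laurent_quot (1 - x_pow (- (t_floor n ?a *s simple_root i))) ?y * ?y * x_pow \<mu>"
    by (simp only: T_quot_def ac_simps)
  also have "\<dots> = (1 - x_pow (- (t_floor n ?a *s simple_root i))) * x_pow \<mu>"
    unfolding e laurent_quot_mult[OF n_simple_root_nz[OF i]] ..
  also have "\<dots> = x_pow \<mu> - x_pow (\<mu> - t_floor n ?a *s simple_root i)"
    by (simp add: left_diff_distrib flip: x_pow_add)
  finally show ?thesis .
qed

lemma T_quot_eqI:
  fixes \<mu> :: "'r::{finite,linorder} weight"
  assumes i: "1 \<le> i" "i < CARD('r)"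
   and "h * (1 - x_pow (int n *s simple_root i)) = 
    x_pow \<mu> - (x_pow (\<mu> - t_floor n (ip \<mu> (simple_root i)) *s simple_root i) :: ('r, 'v) laurent)"
 shows "T_quot i \<mu> = h"
  using one_minus_x_pow_cancel[OF n_simple_root_nz[OF i]] T_quot_mult[OF i] assms(3) by metis

text \<open>Below n the floor of the pairing is 0 and the quotient vanishes. At n the quotient is
  -x^{s_i\<mu>}, and k - (k - k^{-1}) = k^{-1} is the value of \<sigma>.\<close>

lemma T_op_pos:
  fixes \<mu> :: "'r::{finite,linorder} weight"
  assumes i: "1 \<le> i" "i < CARD('r)" and a: "0 \<le> ip \<mu> (simple_root i)" "ip \<mu> (simple_root i) \<le> int n"
  shows "T_op n sg i (x_pow \<mu>) = smul (sigma n sg (ip \<mu> (simple_root i))) (x_pow (perm_act (s_perm i) \<mu>))"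
proof (cases "ip \<mu> (simple_root i) = int n")
  case True
  have "T_quot i \<mu> = (- x_pow (perm_act (s_perm i) \<mu>) :: ('r, 'v) laurent)"
    by (rule T_quot_eqI[OF i]) (simp add: t_floor_def True perm_act_s_perm_eq[OF i] right_diff_distrib flip: x_pow_add)
  then show ?thesis using n1 True by (simp add: T_op_x_pow Gpar_dvd sigma_def hecke_par_def smul_simps)
next
  case False
  have "T_quot i \<mu> = (0 :: ('r, 'v) laurent)"
    by (rule T_quot_eqI[OF i]) (use False a in \<open>simp add: t_floor_def\<close>)
  moreover have "sigma n sg (ip \<mu> (simple_root i)) = Gpar n sg (ip \<mu> (simple_root i))"
    using False a by (auto simp: sigma_def dest: zdvd_imp_le)
  ultimately show ?thesis by (simp add: T_op_x_pow smul_simps)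
qed

text \<open>The floor of the pairing is -n throughout this range, so the quotient is x^\<mu>
  itself.\<close>

lemma T_op_neg:
  fixes \<mu> :: "'r::{finite,linorder} weight"
  assumes i: "1 \<le> i" "i < CARD('r)" and a: "- int n \<le> ip \<mu> (simple_root i)" "ip \<mu> (simple_root i) < 0"
  shows "T_op n sg i (x_pow \<mu>) = smul hecke_par (x_pow \<mu>) + smul (Gpar n sg (ip \<mu> (simple_root i))) (x_pow (perm_act (s_perm i) \<mu>))"
proof -
  have "(ip \<mu> (simple_root i) + int n) div int n = 0" using a by simp
  then have "ip \<mu> (simple_root i) div int n = -1" using n1 by simp
  then have "t_floor n (ip \<mu> (simple_root i)) = - int n" by (simp add: t_floor_eq)
  moreover have "(- int n) *s (simple_root i :: 'r weight) = - (int n *s simple_root i)" by (simp add: vec_eq_iff)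
  ultimately have "T_quot i \<mu> = (x_pow \<mu> :: ('r, 'v) laurent)"
    by (intro T_quot_eqI[OF i]) (simp add: right_diff_distrib flip: x_pow_add)
  then show ?thesis by (simp add: T_op_x_pow)
qed

text \<open>The substitution of x^n for x: the lattice part of the Hecke algebra acts on Laurent
  polynomials through exponents in n\<int>^r.\<close>

definition scl :: "('r::{finite,linorder}, 'v) laurent \<Rightarrow> ('r, 'v) laurent"
  where "scl = lin_ext (\<lambda>\<mu>. x_pow (int n *s \<mu>))"

lemma lin_scl [simp]: "lin scl" by (simp add: scl_def lin_lin_ext)
lemma scl_x_pow [simp]: "scl (x_pow \<mu>) = x_pow (int n *s \<mu>)" by (simp add: scl_def)
lemmas scl_lin = lin_add[OF lin_scl] lin_smul[OF lin_scl] lin_zero[OF lin_scl] lin_diff[OF lin_scl]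

lemma scl_x_pow_mult: "scl (f * x_pow \<beta>) = scl f * x_pow (int n *s \<beta>)"
proof (rule lin_eqI[of "\<lambda>f. scl (f * x_pow \<beta>)"])
  fix \<mu> :: "'a weight"
  have "int n *s (\<mu> + \<beta>) = int n *s \<mu> + int n *s \<beta>" by (simp add: vector_add_ldistrib)
  then show "scl (x_pow \<mu> * x_pow \<beta>) = scl (x_pow \<mu>) * x_pow (int n *s \<beta>)" 
    unfolding x_pow_add[symmetric] scl_x_pow by simp
qed (auto intro!: lin_intros lin_comp[OF lin_scl])

lemma scl_demazure:
  fixes f :: "('r::{finite,linorder}, 'v) laurent"
  assumes i: "1 \<le> i" "i < CARD('r)"
  shows "scl (demazure i f) * (1 - x_pow (int n *s simple_root i)) = scl f - scl (refl i f)"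
proof -
  have "scl f - scl (refl i f) = scl (demazure i f * (1 - x_pow (simple_root i)))"
    unfolding demazure_mult[OF i] scl_lin ..
  also have "\<dots> = scl (demazure i f) * (1 - x_pow (int n *s simple_root i))"
    by (simp add: right_diff_distrib scl_lin scl_x_pow_mult)
  finally show ?thesis ..
qed

text \<open>The Bernstein relation. Adding n\<beta> to the weight shifts the floor by a multiple of
  n and leaves the value of G unchanged, so the quotient splits into that of \<mu> and a divided
  difference of x^\<beta>.\<close>

lemma T_op_scl:
  fixes f :: "('r::{finite,linorder}, 'v) laurent"
  assumes i: "1 \<le> i" "i < CARD('r)"
  shows "T_op n sg i (scl f * x_pow \<mu>) = scl (refl i f) * T_op n sg i (x_pow \<mu>) + smul hecke_par (scl (demazure i f) * x_pow \<mu>)"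
proof (rule lin_eqI[of "\<lambda>f. T_op n sg i (scl f * x_pow \<mu>)"])
  fix \<beta> :: "'r weight"
  let ?\<alpha> = "simple_root i :: 'r weight"
  let ?a = "ip \<mu> ?\<alpha>" and ?b = "ip \<beta> ?\<alpha>" and ?y = "x_pow (int n *s ?\<alpha>) :: ('r, 'v) laurent"
  let ?s = "perm_act (s_perm i) :: 'r weight \<Rightarrow> 'r weight"
  have ip: "ip (int n *s \<beta> + \<mu>) ?\<alpha> = ?a + ?b * int n" by (simp add: ip_add_left ip_scale)
  have tf: "t_floor n (?a + ?b * int n) = t_floor n ?a + ?b * int n"
    by (simp add: t_floor_def)
  have sb: "int n *s ?s \<beta> = int n *s \<beta> - (?b * int n) *s ?\<alpha>"
    by (simp add: perm_act_s_perm_eq[OF i] vec_eq_iff algebra_simps)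
  have q: "T_quot i (int n *s \<beta> + \<mu>) = x_pow (int n *s ?s \<beta>) * T_quot i \<mu> + scl (demazure i (x_pow \<beta>)) * x_pow \<mu>"
  proof (rule T_quot_eqI[OF i])
    have "(x_pow (int n *s ?s \<beta>) * T_quot i \<mu> + scl (demazure i (x_pow \<beta>)) * x_pow \<mu>) * (1 - ?y)
       = x_pow (int n *s ?s \<beta>) * (T_quot i \<mu> * (1 - ?y)) + (scl (demazure i (x_pow \<beta>)) * (1 - ?y)) * x_pow \<mu>"
      by (simp add: algebra_simps)
    also have "\<dots> = x_pow (int n *s \<beta> + \<mu>) - x_pow (int n *s ?s \<beta> + (\<mu> - t_floor n ?a *s ?\<alpha>))"
      unfolding T_quot_mult[OF i] scl_demazure[OF i] 
      by (simp add: left_diff_distrib right_diff_distrib flip: x_pow_add)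
    also have "int n *s ?s \<beta> + (\<mu> - t_floor n ?a *s ?\<alpha>) = int n *s \<beta> + \<mu> - t_floor n (ip (int n *s \<beta> + \<mu>) ?\<alpha>) *s ?\<alpha>"
      unfolding ip tf sb by (simp add: vec_eq_iff algebra_simps)
    finally show "(x_pow (int n *s ?s \<beta>) * T_quot i \<mu> + scl (demazure i (x_pow \<beta>)) * x_pow \<mu>) * (1 - ?y)
       = x_pow (int n *s \<beta> + \<mu>) - x_pow (int n *s \<beta> + \<mu> - t_floor n (ip (int n *s \<beta> + \<mu>) ?\<alpha>) *s ?\<alpha>)" .
  qed
  have g: "Gpar n sg (?a + ?b * int n) = Gpar n sg ?a" by (rule Gpar_cong) simp
  have "T_op n sg i (scl (x_pow \<beta>) * x_pow \<mu>) = smul hecke_par (T_quot i (int n *s \<beta> + \<mu>)) 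
      + smul (Gpar n sg ?a) (x_pow (int n *s ?s \<beta> + ?s \<mu>))"
    by (simp add: T_op_x_pow ip g perm_act_add perm_act_scale flip: x_pow_add)
  also have "\<dots> = scl (refl i (x_pow \<beta>)) * T_op n sg i (x_pow \<mu>) + smul hecke_par (scl (demazure i (x_pow \<beta>)) * x_pow \<mu>)"
    unfolding q by (simp add: T_op_x_pow smul_simps distrib_left smul_mult x_pow_add)
  finally show "T_op n sg i (scl (x_pow \<beta>) * x_pow \<mu>)
     = scl (refl i (x_pow \<beta>)) * T_op n sg i (x_pow \<mu>) + smul hecke_par (scl (demazure i (x_pow \<beta>)) * x_pow \<mu>)" .
qed (auto intro!: lin_intros lin_comp[OF lin_scl] lin_comp[OF lin_T_op] lin_comp[OF lin_refl] lin_comp[OF lin_demazure])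

end

section \<open>The closed alcove and its orbit under words of reflections\<close>

lemma fund_alcove_weights_bounds:
  fixes lam :: "'r::{finite,linorder} weight"
  assumes "lam \<in> fund_alcove_weights n" "a < b"
  shows "lam $ b \<le> lam $ a" "lam $ a - lam $ b \<le> int n"
proof -
  have dec: "lam $ coord j \<le> lam $ coord i" if "i \<le> j" "1 \<le> i" "j \<le> CARD('r)" for i j
    using that
  proof (induction j rule: dec_induct)
    case (step m)
    then have "lam $ coord (m + 1) \<le> lam $ coord m" using assms(1) by (simp add: fund_alcove_weights_def)
    with step show ?case by simp
  qed simp
  have le: "lam $ b \<le> lam $ a" if "a \<le> b" for a b
    using dec[of "coord_index a" "coord_index b"] that by (simp add: coord_index_le_iff)
  show "lam $ b \<le> lam $ a" using le assms by simp
  have "lam $ a \<le> lam $ coord 1" using dec[of 1 "coord_index a"] by simp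
  moreover have "lam $ coord CARD('r) \<le> lam $ b" using dec[of "coord_index b" "CARD('r)"] by simp
  ultimately show "lam $ a - lam $ b \<le> int n" using assms(1) by (simp add: fund_alcove_weights_def)
qed

definition refl_act :: "nat \<Rightarrow> nat \<Rightarrow> 'r::{finite,linorder} weight \<Rightarrow> 'r weight"
  where "refl_act n i = aff_act (s_aff n i)"

lemma refl_act_simps: "refl_act n 0 \<nu> = int n *s theta + perm_act s_theta \<nu>"
  "i \<noteq> 0 \<Longrightarrow> refl_act n i \<nu> = perm_act (s_perm i) \<nu>"
  by (simp_all add: refl_act_def s_aff_def aff_act_def vec_eq_iff)

abbreviation word_act :: "nat \<Rightarrow> nat list \<Rightarrow> 'r::{finite,linorder} weight \<Rightarrow> 'r weight"
  where "word_act n ws \<equiv> foldr (refl_act n) ws"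

lemma coord_first_last_ne:
  assumes "CARD('r) \<ge> 2" shows "coord 1 \<noteq> (coord CARD('r) :: 'r::{finite,linorder})"
  using coord_eq_iff[where 'a='r, of 1 "CARD('r)"] assms by auto

lemma theta_nth: 
  assumes "CARD('r) \<ge> 2"
  shows "(theta :: 'r::{finite,linorder} weight) $ a = (if a = coord 1 then 1 else if a = coord CARD('r) then -1 else 0)"
  using coord_first_last_ne[OF assms] by (auto simp: theta_def)

lemma refl_act_0_nth:
  assumes "CARD('r) \<ge> 2"
  shows "refl_act n 0 \<nu> $ a = (if a = coord 1 then \<nu> $ coord CARD('r) + int n else 
     if a = coord CARD('r) then \<nu> $ coord 1 - int n else (\<nu> :: 'r::{finite,linorder} weight) $ a)"
  using coord_first_last_ne[OF assms]
  by (auto simp: refl_act_simps theta_nth[OF assms] s_theta_def Transposition.transpose_def)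

lemma refl_act_form:
  assumes "i < CARD('r)" "bij u"
  shows "\<exists>\<beta>' u'. bij u' \<and> refl_act n i (int n *s \<beta> + perm_act u lam) = int n *s \<beta>' + perm_act u' (lam :: 'r::{finite,linorder} weight)"
proof (cases "i = 0")
  case True
  have "refl_act n i (int n *s \<beta> + perm_act u lam) = int n *s (theta + perm_act s_theta \<beta>) + perm_act (s_theta \<circ> u) lam"
    using assms True by (simp add: refl_act_simps perm_act_add perm_act_scale perm_act_comp vector_add_ldistrib)
  then show ?thesis using assms bij_comp'[OF bij_s_theta assms(2)] by blast
next
  case False
  have "refl_act n i (int n *s \<beta> + perm_act u lam) = int n *s (perm_act (s_perm i) \<beta>) + perm_act (s_perm i \<circ> u) lam"
    using assms False by (simp add: refl_act_simps perm_act_add perm_act_scale perm_act_comp)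
  then show ?thesis using assms bij_comp'[OF bij_s_perm assms(2)] by blast
qed

text \<open>This form exhibits each weight of the orbit as the exponent attached to some basis
  element x^\<beta> T_u.\<close>

lemma word_act_form:
  assumes "set ws \<subseteq> {0..<CARD('r)}"
  shows "\<exists>\<beta> u. bij u \<and> word_act n ws lam = int n *s \<beta> + perm_act u (lam :: 'r::{finite,linorder} weight)"
  using assms
proof (induction ws)
  case Nil
  have "word_act n [] lam = int n *s 0 + perm_act id lam" by simp
  then show ?case using bij_id by blast
next
  case (Cons i ws)
  then obtain \<beta> u where "bij u" "word_act n ws lam = int n *s \<beta> + perm_act u lam" by auto
  then show ?case using refl_act_form[of i u n \<beta> lam] Cons.prems by simp
qed

lemma sum_two_changed:
  fixes f g :: "'r::finite \<Rightarrow> int"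
  assumes "p \<noteq> q" "\<And>a. a \<noteq> p \<Longrightarrow> a \<noteq> q \<Longrightarrow> g a = f a"
  shows "sum g UNIV - sum f UNIV = g p + g q - f p - f q"
proof -
  have *: "sum h UNIV = h p + (h q + sum h (UNIV - {p} - {q}))" for h :: "'r \<Rightarrow> int"
    using assms(1) by (simp add: sum.remove[of UNIV p h] sum.remove[of "UNIV - {p}" q h])
  have "sum g (UNIV - {p} - {q}) = sum f (UNIV - {p} - {q})" using assms(2) by (intro sum.cong) auto
  then show ?thesis using *[of g] *[of f] by simp
qed

lemma refl_act_invol:
  assumes "CARD('r) \<ge> 2" shows "refl_act n i (refl_act n i \<nu>) = (\<nu> :: 'r::{finite,linorder} weight)"
proof (cases "i = 0")
  case True
  show ?thesis unfolding True vec_eq_iff refl_act_0_nth[OF assms] using coord_first_last_ne[OF assms] by auto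
qed (simp add: refl_act_simps)

text \<open>
  The induction is on the squared distance to an interior point of the closed alcove, scaled by
  \<open>r\<close> to make it integral.
\<close>

lemma reach_fund_alcove:
  fixes \<mu> :: "'r::{finite,linorder} weight"
  assumes r2: "CARD('r) \<ge> 2" and n1: "n \<ge> 1"
  shows "\<exists>ws lam. set ws \<subseteq> {0..<CARD('r)} \<and> lam \<in> fund_alcove_weights n \<and> \<mu> = word_act n ws lam"
proof -
  define R where "R = int CARD('r)"
  define f where "f \<mu> a = (R * \<mu> $ a + int n * int (coord_index a))\<^sup>2" for \<mu> :: "'r weight" and a
  have Rpos: "R > 0" unfolding R_def using r2 by simp
  have npos: "int n > 0" using n1 by simp
  show ?thesis
  proof (induction "nat (\<Sum>a\<in>UNIV. f \<mu> a)" arbitrary: \<mu> rule: less_induct)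
    case less
    have step: ?case if st: "i < CARD('r)" "sum (f (refl_act n i \<mu>)) UNIV < sum (f \<mu>) UNIV" for i
    proof -
      have "0 \<le> sum (f (refl_act n i \<mu>)) UNIV" by (rule sum_nonneg) (simp add: f_def)
      then obtain ws lam where *: "set ws \<subseteq> {0..<CARD('r)}" "lam \<in> fund_alcove_weights n" "refl_act n i \<mu> = word_act n ws lam"
        using less[of "refl_act n i \<mu>"] st(2) by (metis order_le_less_trans nat_mono_iff)
      have "\<mu> = word_act n (i # ws) lam" using refl_act_invol[OF r2, of n i \<mu>] *(3) by simp
      then show ?case using * st by (intro exI[of _ "i # ws"] exI[of _ lam]) simp
    qed
    consider "\<mu> \<in> fund_alcove_weights n" | i where "1 \<le> i" "i < CARD('r)" "\<mu> $ coord i < \<mu> $ coord (i+1)"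
      | "\<mu> $ coord 1 - \<mu> $ coord CARD('r) > int n"
      unfolding fund_alcove_weights_def by fastforce
    then show ?case
    proof cases
      case 1
      then show ?thesis by (intro exI[of _ "[]"] exI[of _ \<mu>]) simp
    next
      case (2 i)
      have ne: "coord i \<noteq> (coord (i+1)::'r)" using coord_less_Suc[OF 2(1,2)] by simp
      have "sum (f (refl_act n i \<mu>)) UNIV - sum (f \<mu>) UNIV
        = f (refl_act n i \<mu>) (coord i) + f (refl_act n i \<mu>) (coord (i+1)) - f \<mu> (coord i) - f \<mu> (coord (i+1))"
        by (rule sum_two_changed[OF ne]) (use 2 in \<open>simp add: f_def refl_act_simps s_perm_def Transposition.transpose_def\<close>)
      also have "\<dots> = 2 * R * int n * (\<mu> $ coord i - \<mu> $ coord (i+1))"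
        using 2 coord_index_coord[where 'a='r, of i] coord_index_coord[where 'a='r, of "i+1"]
        by (simp add: f_def refl_act_simps s_perm_def power2_eq_square algebra_simps)
      also have "\<dots> < 0" using 2 Rpos npos by (intro mult_pos_neg) auto
      finally show ?thesis using step 2 by simp
    next
      case 3
      note ne = coord_first_last_ne[OF r2]
      have "sum (f (refl_act n 0 \<mu>)) UNIV - sum (f \<mu>) UNIV
        = f (refl_act n 0 \<mu>) (coord 1) + f (refl_act n 0 \<mu>) (coord CARD('r)) - f \<mu> (coord 1) - f \<mu> (coord CARD('r))"
        by (rule sum_two_changed[OF ne]) (simp add: f_def refl_act_0_nth[OF r2] del: One_nat_def)
      also have "\<dots> = 2 * int n * R * (\<mu> $ coord CARD('r) + int n - \<mu> $ coord 1)"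
        using ne coord_index_coord[where 'a='r, of 1] coord_index_coord[where 'a='r, of "CARD('r)"] r2
        by (simp add: f_def refl_act_0_nth[OF r2] power2_eq_square algebra_simps R_def[symmetric] del: One_nat_def)
      also have "\<dots> < 0" using 3 Rpos npos by (intro mult_pos_neg) auto
      finally show ?thesis using step[of 0] r2 by simp
    qed
  qed
qed

section \<open>Evaluation of the Hecke algebra at a monomial of the closed alcove\<close>

context metaplectic_params begin

text \<open>The coefficient of x^{u lam} in T_u x^{lam} for \<open>lam\<close> in the closed alcove.
  As a product over inversions it does not refer to a reduced word.\<close>

definition inv_coeff :: "'r::{finite,linorder} weight \<Rightarrow> ('r \<Rightarrow> 'r) \<Rightarrow> 'v pfield"
  where "inv_coeff lam u = (\<Prod>(a, b)\<in>Inv u. sigma n sg (lam $ a - lam $ b))"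

lemma inv_coeff_nz [simp]: "inv_coeff lam u \<noteq> 0"
  by (auto simp: inv_coeff_def)

lemma inv_coeff_id [simp]: "inv_coeff lam id = 1"
proof -
  have "Inv id = ({} :: ('a \<times> 'a) set)" by (auto simp: Inv_def)
  then show ?thesis by (simp add: inv_coeff_def)
qed

lemma ip_perm_act_simple_root: "ip (perm_act u lam) (simple_root i) = lam $ inv u (coord i) - lam $ inv u (coord (i + 1))"
  by (simp add: ip_simple_root)

lemma inv_coeff_s_perm:
  assumes "bij (u :: 'r::{finite,linorder} \<Rightarrow> 'r)" "1 \<le> i" "i < CARD('r)" "inv u (coord i) < inv u (coord (i + 1))"
  shows "inv_coeff lam (s_perm i \<circ> u) = sigma n sg (ip (perm_act u lam) (simple_root i)) * inv_coeff lam u"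
  using Inv_s_perm[OF assms] by (simp add: inv_coeff_def ip_perm_act_simple_root)

text \<open>The rule for T_i T_u applied to x^{lam}. The bounds of the closed alcove put the pairing
  into [0, n] at an ascent and into [-n, 0] at a descent, so the short formulas for T_i
  apply.\<close>

lemma T_op_perm_act:
  fixes lam :: "'r::{finite,linorder} weight"
  assumes lam: "lam \<in> fund_alcove_weights n" and u: "bij u" and i: "1 \<le> i" "i < CARD('r)"
  shows "smul (inv_coeff lam u) (T_op n sg i (x_pow (perm_act u lam))) = 
    smul (inv_coeff lam (s_perm i \<circ> u)) (x_pow (perm_act (s_perm i \<circ> u) lam)) 
    + smul (inv_coeff lam u * kd (ldesc u i)) (x_pow (perm_act u lam))"
proof -
  let ?a = "ip (perm_act u lam) (simple_root i)"
  have s: "perm_act (s_perm i \<circ> u) lam = perm_act (s_perm i) (perm_act u lam)"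
    by (rule perm_act_comp[OF bij_s_perm u])
  have ne: "inv u (coord i) \<noteq> inv u (coord (i+1))" using coord_less_Suc[OF i] u by (metis inv_f_f_bij(2) order_less_irrefl)
  show ?thesis
  proof (cases "ldesc u i")
    case False
    then have asc: "inv u (coord i) < inv u (coord (i+1))" using ne by simp
    have "0 \<le> ?a" "?a \<le> int n" unfolding ip_perm_act_simple_root
      using fund_alcove_weights_bounds[OF lam asc] by simp_all
    from T_op_pos[OF i this] show ?thesis
      unfolding inv_coeff_s_perm[OF u i asc] s using False by (simp add: kd_def smul_simps mult.commute)
  next
    case True
    let ?u' = "s_perm i \<circ> u"
    have u': "bij ?u'" using u by simp
    have asc: "inv ?u' (coord i) < inv ?u' (coord (i+1))"
      unfolding inv_s_perm_comp(1)[OF u] s_perm_coord[OF i] using True .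
    have "s_perm i \<circ> ?u' = u" by (simp add: o_assoc)
    \<comment> \<open>\<open>u\<close> arises from the shorter \<open>?u'\<close> by an ascent at
      \<open>i\<close>, so its coefficient contains one factor more, taken at the negated
      pairing.\<close>
    then have c: "inv_coeff lam u = sigma n sg (- ?a) * inv_coeff lam ?u'"
      using inv_coeff_s_perm[OF u' i asc, of lam] 
      by (simp add: ip_perm_act_simple_root inv_s_perm_comp(1)[OF u] s_perm_coord[OF i, simplified] del: o_apply)
    have a: "- int n \<le> ?a" "?a \<le> 0" unfolding ip_perm_act_simple_root
      using fund_alcove_weights_bounds[OF lam True] by simp_all
    show ?thesis
    proof (cases "?a = 0")
      case a0: True
      have "perm_act (s_perm i) (perm_act u lam) = perm_act u lam"
        unfolding perm_act_s_perm_eq[OF i] a0 by (simp add: vec_eq_iff)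
      \<comment> \<open>On the wall \<sigma>(0) = k, and the claim becomes the quadratic relation k
        * k = 1 + (k - k^{-1}) * k.\<close>
      moreover have "inv_coeff lam u * kpar = inv_coeff lam ?u' + inv_coeff lam u * hecke_par"
        unfolding c a0 by (simp add: sigma_0 hecke_par_def algebra_simps)
      ultimately show ?thesis using T_op_pos[OF i, of "perm_act u lam"] True
        unfolding s by (simp add: a0 sigma_0 smul_simps kd_def flip: smul_simps(2))
    next
      case False
      then have "Gpar n sg ?a = sigma n sg ?a" using a by (simp add: sigma_def)
      then have "inv_coeff lam u * Gpar n sg ?a = inv_coeff lam ?u'"
        unfolding c using sigma_neg[OF False] by (simp add: ac_simps)
      then show ?thesis using T_op_neg[OF i a(1)] False a True
        unfolding s by (simp add: smul_simps kd_def add.commute)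
    qed
  qed
qed

text \<open>The action of a Hecke algebra element on x^{lam}, computed from its coefficients in the
  basis x^\<beta> T_u. The source is free, so stabilizers of \<open>lam\<close> cause no
  ambiguity.\<close>

definition ev :: "'r::{finite,linorder} weight \<Rightarrow> ('r, 'v) hmod \<Rightarrow> ('r, 'v) laurent"
  where "ev lam F = (\<Sum>u | bij u. smul (inv_coeff lam u) (scl (F u) * x_pow (perm_act u lam)))"

lemma ev_add: "ev lam (hadd F H) = ev lam F + ev lam H"
  and ev_smul: "ev lam (hsmul c F) = smul c (ev lam F)"
  by (simp_all add: ev_def hadd_def hsmul_def scl_lin smul_simps distrib_right sum.distrib smul_sum smul_mult mult.commute[of c])

lemma ev_hx: "ev lam (hx \<beta> F) = x_pow (int n *s \<beta>) * ev lam F"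
proof -
  have "scl (x_pow \<beta> * F u) = x_pow (int n *s \<beta>) * scl (F u)" for u
    using scl_x_pow_mult[of "F u" \<beta>] by (simp only: mult.commute)
  then show ?thesis by (simp add: ev_def hx_def sum_distrib_left smul_mult mult.assoc)
qed

lemma ev_mon: "bij u \<Longrightarrow> ev lam (mon \<beta> u) = smul (inv_coeff lam u) (x_pow (int n *s \<beta> + perm_act u lam))"
proof -
  assume u: "bij u"
  have "ev lam (mon \<beta> u) = (\<Sum>v | bij v. if v = u then smul (inv_coeff lam u) (x_pow (int n *s \<beta> + perm_act u lam)) else 0)"
    unfolding ev_def by (rule sum.cong) (auto simp: mon_def scl_lin smul_simps x_pow_add)
  then show ?thesis using u by simp
qed

text \<open>Reindexing by \<open>s_perm i\<close> collects everything that comes from one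
  coefficient \<open>F u\<close>; the Bernstein relation then treats the polynomial factor and
  \<open>T_op_perm_act\<close> the monomial.\<close>

lemma ev_LT:
  fixes lam :: "'r::{finite,linorder} weight"
  assumes lam: "lam \<in> fund_alcove_weights n" and i: "1 \<le> i" "i < CARD('r)"
  shows "ev lam (LT i F) = T_op n sg i (ev lam F)"
proof -
  let ?S = "{u :: 'r \<Rightarrow> 'r. bij u}" and ?c = "inv_coeff lam" and ?x = "\<lambda>u. x_pow (perm_act u lam) :: ('r, 'v) laurent"
  have re: "(\<Sum>u\<in>?S. g (s_perm i \<circ> u)) = (\<Sum>u\<in>?S. g u)" for g :: "('r \<Rightarrow> 'r) \<Rightarrow> ('r, 'v) laurent"
    by (rule sum.reindex_bij_witness[of _ "\<lambda>u. s_perm i \<circ> u" "\<lambda>u. s_perm i \<circ> u"]) (simp_all add: o_assoc del: o_apply)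
  have ss: "s_perm i \<circ> (s_perm i \<circ> u) = u" for u :: "'r \<Rightarrow> 'r" by (simp add: o_assoc)
  have "ev lam (LT i F) = (\<Sum>u\<in>?S. smul (?c u) (scl (refl i (F (s_perm i \<circ> u))) * ?x u)) +
     (\<Sum>u\<in>?S. smul (?c u * kd (ldesc u i)) (scl (refl i (F u)) * ?x u) + smul (?c u * hecke_par) (scl (demazure i (F u)) * ?x u))"
    unfolding ev_def sum.distrib[symmetric]
    by (rule sum.cong) (simp_all add: LT_def scl_lin distrib_right smul_simps smul_mult del: o_apply)
  also have "(\<Sum>u\<in>?S. smul (?c u) (scl (refl i (F (s_perm i \<circ> u))) * ?x u)) 
    = (\<Sum>u\<in>?S. smul (?c (s_perm i \<circ> u)) (scl (refl i (F u)) * ?x (s_perm i \<circ> u)))"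
    using re[of "\<lambda>u. smul (?c u) (scl (refl i (F (s_perm i \<circ> u))) * ?x u)"] unfolding ss by simp
  also have "\<dots> + (\<Sum>u\<in>?S. smul (?c u * kd (ldesc u i)) (scl (refl i (F u)) * ?x u) + smul (?c u * hecke_par) (scl (demazure i (F u)) * ?x u))
    = (\<Sum>u\<in>?S. scl (refl i (F u)) * smul (?c u) (T_op n sg i (?x u)) + smul (?c u * hecke_par) (scl (demazure i (F u)) * ?x u))"
    unfolding sum.distrib[symmetric]
  proof (rule sum.cong)
    fix u assume "u \<in> ?S"
    then have u: "bij u" by simp
    show "smul (?c (s_perm i \<circ> u)) (scl (refl i (F u)) * ?x (s_perm i \<circ> u)) 
      + (smul (?c u * kd (ldesc u i)) (scl (refl i (F u)) * ?x u) + smul (?c u * hecke_par) (scl (demazure i (F u)) * ?x u))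
      = scl (refl i (F u)) * smul (?c u) (T_op n sg i (?x u)) + smul (?c u * hecke_par) (scl (demazure i (F u)) * ?x u)"
      unfolding T_op_perm_act[OF lam u i] by (simp add: distrib_left smul_mult del: o_apply)
  qed simp
  also have "\<dots> = (\<Sum>u\<in>?S. smul (?c u) (T_op n sg i (scl (F u) * ?x u)))"
    by (rule sum.cong) (simp_all add: T_op_scl[OF i] smul_mult smul_simps)
  also have "\<dots> = T_op n sg i (ev lam F)"
    unfolding ev_def by (simp add: lin_sum[OF lin_T_op] lin_smul[OF lin_T_op])
  finally show ?thesis .
qed

lemma x_pow_eq_ev:
  fixes \<mu> :: "'r::{finite,linorder} weight"
  assumes "CARD('r) \<ge> 2"
  shows "\<exists>lam F. lam \<in> fund_alcove_weights n \<and> gen F \<and> x_pow \<mu> = ev lam F"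
proof -
  obtain ws lam where ws: "set ws \<subseteq> {0..<CARD('r)}" "lam \<in> fund_alcove_weights n" "\<mu> = word_act n ws lam"
    using reach_fund_alcove[OF assms n1] by blast
  obtain \<beta> u where u: "bij u" "\<mu> = int n *s \<beta> + perm_act u lam"
    using word_act_form[OF ws(1)] ws(3) by blast
  have "x_pow \<mu> = ev lam (hsmul (inverse (inv_coeff lam u)) (mon \<beta> u))"
    unfolding ev_smul ev_mon[OF u(1)] u(2) by (simp add: smul_simps)
  then show ?thesis using ws(2) gen_smul[OF gen_mon[OF u(1)]] by blast
qed

text \<open>The images of the maps \<open>ev lam\<close> for all \<open>lam\<close> in the closed
  alcove contain every monomial, so an identity of linear operators may be tested on them.\<close>

lemma T_op_relation:
  fixes S S' :: "('r::{finite,linorder}, 'v) laurent \<Rightarrow> ('r, 'v) laurent"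
  assumes "CARD('r) \<ge> 2" "lin S" "lin S'"
    and "\<And>lam F. lam \<in> fund_alcove_weights n \<Longrightarrow> gen F \<Longrightarrow> S (ev lam F) = S' (ev lam F)"
  shows "S f = S' f"
proof (rule lin_eqI[OF assms(2,3)])
  fix \<mu> :: "'r weight"
  obtain lam F where "lam \<in> fund_alcove_weights n" "gen F" "(x_pow \<mu> :: ('r, 'v) laurent) = ev lam F"
    using x_pow_eq_ev[OF assms(1)] by blast
  then show "S (x_pow \<mu>) = S' (x_pow \<mu>)" using assms(4) by simp
qed

lemma T_op_quadratic:
  fixes f :: "('r::{finite,linorder}, 'v) laurent"
  assumes i: "1 \<le> i" "i < CARD('r)"
  shows "T_op n sg i (T_op n sg i f) = f + smul hecke_par (T_op n sg i f)"
proof (rule T_op_relation[of "\<lambda>f. T_op n sg i (T_op n sg i f)"])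
  fix lam :: "'r weight" and F :: "('r, 'v) hmod" assume "lam \<in> fund_alcove_weights n" "gen F"
  then show "T_op n sg i (T_op n sg i (ev lam F)) = ev lam F + smul hecke_par (T_op n sg i (ev lam F))"
    using LT_quadratic[OF i, of F] by (simp only: ev_add ev_smul ev_LT[OF _ i, symmetric])
qed (use i in \<open>auto intro!: lin_intros lin_comp[OF lin_T_op]\<close>)

lemma T_op_commute:
  fixes f :: "('r::{finite,linorder}, 'v) laurent"
  assumes i: "1 \<le> i" "i < CARD('r)" and j: "1 \<le> j" "j < CARD('r)" and ij: "j \<noteq> i" "j \<noteq> i + 1" "i \<noteq> j + 1"
  shows "T_op n sg i (T_op n sg j f) = T_op n sg j (T_op n sg i f)"
proof (rule T_op_relation[of "\<lambda>f. T_op n sg i (T_op n sg j f)"])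
  fix lam :: "'r weight" and F :: "('r, 'v) hmod" assume "lam \<in> fund_alcove_weights n" "gen F"
  then show "T_op n sg i (T_op n sg j (ev lam F)) = T_op n sg j (T_op n sg i (ev lam F))"
    using LT_commute[OF i j ij, of F] by (simp only: ev_LT[OF _ i, symmetric] ev_LT[OF _ j, symmetric])
qed (use i in \<open>auto intro!: lin_intros lin_comp[OF lin_T_op]\<close>)

lemma T_op_braid:
  fixes f :: "('r::{finite,linorder}, 'v) laurent"
  assumes i: "1 \<le> i" "i + 1 < CARD('r)"
  shows "T_op n sg i (T_op n sg (i + 1) (T_op n sg i f)) = T_op n sg (i + 1) (T_op n sg i (T_op n sg (i + 1) f))"
proof (rule T_op_relation[of "\<lambda>f. T_op n sg i (T_op n sg (i + 1) (T_op n sg i f))"])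
  have i': "1 \<le> i + 1" "i < CARD('r)" using i by auto
  fix lam :: "'r weight" and F :: "('r, 'v) hmod" assume lam: "lam \<in> fund_alcove_weights n" and F: "gen F"
  show "T_op n sg i (T_op n sg (i + 1) (T_op n sg i (ev lam F))) = T_op n sg (i + 1) (T_op n sg i (T_op n sg (i + 1) (ev lam F)))"
    using LT_braid[OF i F] unfolding ev_LT[OF lam i(1) i'(2), symmetric] ev_LT[OF lam i'(1) i(2), symmetric] by simp
qed (use i in \<open>auto intro!: lin_intros lin_comp[OF lin_T_op]\<close>)

end

section \<open>Relations of the Cherednik operators\<close>

lemma comp_list_simps [simp]: "comp_list [] f = f" "comp_list (g # gs) f = g (comp_list gs f)"
  by (simp_all add: comp_list_def)

lemma comp_list_append [simp]: "comp_list (gs @ hs) f = comp_list gs (comp_list hs f)"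
  by (induction gs) auto

text \<open>Only these relations enter the rearrangement of operator words, so the ring of Laurent
  polynomials is abstracted away. In the application \<open>qs\<close> is the scalar q^{-n} and
  \<open>Xm\<close> is multiplication by x^{-n\<theta>}.\<close>

locale hecke_operators =
  fixes T Ti :: "nat \<Rightarrow> 'a \<Rightarrow> 'a" and om :: "'a \<Rightarrow> 'a" and X :: "nat \<Rightarrow> 'a \<Rightarrow> 'a" and qs Xm :: "'a \<Rightarrow> 'a" and r :: nat
  assumes r2: "r \<ge> 2"
    and T_Ti: "\<And>i f. 1 \<le> i \<Longrightarrow> i < r \<Longrightarrow> T i (Ti i f) = f"
    and Ti_T: "\<And>i f. 1 \<le> i \<Longrightarrow> i < r \<Longrightarrow> Ti i (T i f) = f"
    and braid: "\<And>i f. 1 \<le> i \<Longrightarrow> i + 1 < r \<Longrightarrow> T i (T (i + 1) (T i f)) = T (i + 1) (T i (T (i + 1) f))"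
    and comm: "\<And>i j f. 1 \<le> i \<Longrightarrow> i + 1 < j \<Longrightarrow> j < r \<Longrightarrow> T i (T j f) = T j (T i f)"
    and om_T: "\<And>i f. 1 \<le> i \<Longrightarrow> i + 1 < r \<Longrightarrow> om (T i f) = T (i + 1) (om f)"
    and X_T: "\<And>i f. 1 \<le> i \<Longrightarrow> i < r \<Longrightarrow> T i (X i (T i f)) = X (i + 1) f"
    and X_comm: "\<And>i a f. 1 \<le> i \<Longrightarrow> i < r \<Longrightarrow> 1 \<le> a \<Longrightarrow> a \<le> r \<Longrightarrow> a \<noteq> i \<Longrightarrow> a \<noteq> i + 1 \<Longrightarrow> T i (X a f) = X a (T i f)"
    and om_X: "\<And>i f. 1 \<le> i \<Longrightarrow> i < r \<Longrightarrow> om (X i f) = X (i + 1) (om f)"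
    and om_X_last: "\<And>f. om (X r f) = qs (X 1 (om f))"
    and Xm: "\<And>f. Xm (X 1 f) = X r f"
begin

abbreviation Tw :: "nat list \<Rightarrow> 'a \<Rightarrow> 'a" where "Tw ws \<equiv> comp_list (map T ws)"
abbreviation Tiw :: "nat list \<Rightarrow> 'a \<Rightarrow> 'a" where "Tiw ws \<equiv> comp_list (map Ti ws)"

definition Y :: "nat \<Rightarrow> 'a \<Rightarrow> 'a"
  where "Y i f = Tiw (rev [1..<i]) (om (Tw (rev [i..<r]) f))"

text \<open>The length-zero element acting from the left; conjugation by it relates neighbouring T_i
  and neighbouring Y_i.\<close>

definition P :: "'a \<Rightarrow> 'a"
  where "P f = X 1 (Tw [1..<r] f)"

lemma far_comm: 
  assumes "1 \<le> i" "i < r" "1 \<le> j" "j < r" "j \<noteq> i + 1" "i \<noteq> j + 1"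
  shows "T i (T j f) = T j (T i f)"
  using assms comm[of i j f] comm[of j i f] by (cases i j rule: linorder_cases) auto

lemma comm_Ti:
  assumes "1 \<le> j" "j < r" "\<And>f. S (T j f) = T j (S f)"
  shows "S (Ti j f) = Ti j (S f)"
  by (metis assms T_Ti Ti_T)

lemma intertwine_Ti:
  assumes "1 \<le> i" "i < r" "1 \<le> j" "j < r" "\<And>f. S (T j f) = T i (S f)"
  shows "S (Ti j f) = Ti i (S f)"
  by (metis assms T_Ti Ti_T)

lemma Tw_comm:
  assumes "\<And>j f. j \<in> set js \<Longrightarrow> S (T j f) = T j (S f)"
  shows "S (Tw js f) = Tw js (S f)"
  using assms by (induction js) auto

lemma Tw_Ti: "set ws \<subseteq> {1..<r} \<Longrightarrow> Tw ws (Tiw (rev ws) f) = f"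
  by (induction ws arbitrary: f) (auto simp: T_Ti)

lemma Y_Suc: 
  assumes "1 \<le> i" "i < r" 
  shows "Y (i + 1) f = Ti i (Y i (Ti i f))"
proof -
  have 1: "rev [1..<i + 1] = i # rev [1..<i]" using assms by simp
  have 2: "rev [i..<r] = rev [i + 1..<r] @ [i]" using assms by (simp add: upt_conv_Cons)
  show ?thesis unfolding Y_def 1 2 using assms by (simp add: T_Ti del: upt_Suc)
qed

text \<open>Passing through T_{r-1} ... T_1, the braid relation lowers the index of T_i by one;
  \<open>om\<close> raises it again.\<close>

lemma T_Y1:
  assumes "2 \<le> i" "i < r" 
  shows "T i (Y 1 f) = Y 1 (T i f)"
proof -
  have "[1..<r] = [1..<i-1] @ [i-1..<r]" using assms upt_add_eq_append[of 1 "i-1" "r-(i-1)"] by simp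
  also have "[i-1..<r] = (i-1) # i # [i+1..<r]" using assms by (simp add: upt_conv_Cons)
  finally have l: "rev [1..<r] = rev [i+1..<r] @ [i, i-1] @ rev [1..<i-1]" by simp
  have "Tw (rev [1..<r]) (T i f) = Tw (rev [i+1..<r]) (T i (T (i-1) (Tw (rev [1..<i-1]) (T i f))))"
    unfolding l by simp
  also have "Tw (rev [1..<i-1]) (T i f) = T i (Tw (rev [1..<i-1]) f)"
    by (rule Tw_comm[symmetric]) (use assms in \<open>auto intro!: far_comm\<close>)
  also have "T i (T (i-1) (T i (Tw (rev [1..<i-1]) f))) = T (i-1) (T i (T (i-1) (Tw (rev [1..<i-1]) f)))"
    using braid[of "i-1"] assms by simp
  also have "Tw (rev [i+1..<r]) (T (i-1) (T i (T (i-1) (Tw (rev [1..<i-1]) f)))) = T (i-1) (Tw (rev [1..<r]) f)"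
    unfolding l by (simp, rule Tw_comm[symmetric]) (use assms in \<open>auto intro!: far_comm\<close>)
  finally show ?thesis using assms om_T[of "i-1"] by (simp add: Y_def)
qed

text \<open>Each Y_{k+1} is Y_k between two factors T_k^{-1}. If T_i does not commute with these
  factors, Y_j is unfolded down to Y_i, and T_i passes through as T_{i+1}, which commutes with
  Y_i.\<close>

lemma T_Y:
  assumes "1 \<le> j" "j \<le> r" "1 \<le> i" "i < r" "j \<noteq> i" "j \<noteq> i + 1"
  shows "T i (Y j f) = Y j (T i f)"
  using assms
proof (induction j arbitrary: i f rule: less_induct)
  case (less j)
  show ?case
  proof (cases "j = 1")
    case True then show ?thesis using T_Y1[of i f] less.prems by simp
  next
    case False
    define k where "k = j - 1"
    have k: "1 \<le> k" "j = k + 1" "k < r" using False less.prems by (auto simp: k_def)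
    show ?thesis
    proof (cases "k = i + 1")
      case False
      have 1: "T i (Ti k f) = Ti k (T i f)" for f
        by (rule comm_Ti) (use k False less.prems in \<open>auto intro!: far_comm\<close>)
      have 2: "T i (Y k f) = Y k (T i f)" for f
        by (rule less.IH) (use k False less.prems in auto)
      show ?thesis using k by (simp add: Y_Suc[simplified] 1 2)
    next
      case ki: True
      have i: "1 \<le> i" "i + 1 < r" using less.prems ki k by auto
      \<comment> \<open>The braid relation with two of its factors inverted; the statement
        \<open>c\<close> is its mirror image for the factors on the other side.\<close>
      have a: "T i (Ti (i+1) (Ti i f)) = Ti (i+1) (Ti i (T (i+1) f))" for f
      proof -
        have "T i (T (i+1) (T i (Ti (i+1) (Ti i f)))) = T (i+1) (T i (T (i+1) (Ti (i+1) (Ti i f))))"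
          using braid[OF i] .
        also have "\<dots> = T (i+1) f" using i by (simp add: T_Ti)
        finally have "Ti (i+1) (Ti i (T i (T (i+1) (T i (Ti (i+1) (Ti i f)))))) = Ti (i+1) (Ti i (T (i+1) f))" by simp
        then show ?thesis using i by (simp add: Ti_T)
      qed
      have c: "T (i+1) (Ti i (Ti (i+1) f)) = Ti i (Ti (i+1) (T i f))" for f
      proof -
        have "T (i+1) (T i (T (i+1) (Ti i (Ti (i+1) f)))) = T i (T (i+1) (T i (Ti i (Ti (i+1) f))))"
          using braid[OF i] by simp
        also have "\<dots> = T i f" using i by (simp add: T_Ti)
        finally have "Ti i (Ti (i+1) (T (i+1) (T i (T (i+1) (Ti i (Ti (i+1) f)))))) = Ti i (Ti (i+1) (T i f))" by simp
        then show ?thesis using i by (simp add: Ti_T)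
      qed
      have b: "T (i+1) (Y i f) = Y i (T (i+1) f)" for f
        by (rule less.IH) (use i ki k in auto)
      have e: "Y j f = Ti (i+1) (Ti i (Y i (Ti i (Ti (i+1) f))))" for f
        using Y_Suc[of "i+1" f] Y_Suc[of i] i unfolding k(2) ki by simp
      show ?thesis unfolding e by (simp only: a b c)
    qed
  qed
qed

lemma Tw_X: "j \<le> r \<Longrightarrow> 1 \<le> j \<Longrightarrow> Tw (rev [1..<j]) (X 1 (Tw [1..<j] f)) = X j f"
proof (induction j arbitrary: f)
  case (Suc j)
  show ?case
  proof (cases "j = 0")
    case False
    then show ?thesis using Suc.IH[of "T j f"] Suc.prems X_T[of j f] by simp
  qed simp
qed simp

text \<open>The word T_{r-1} ... T_1 of Y_1 meets X_1 T_1 ... T_{r-1}, and the repeated rule T_i X_i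
  T_i = X_{i+1} leaves X_r. Moving X_r through \<open>om\<close> costs the scalar.\<close>

lemma Y1_P: "Y 1 (P f) = qs (P (Y r f))"
proof -
  have "Y 1 (P f) = om (X r f)" using Tw_X[of r f] r2 by (simp add: Y_def P_def)
  also have "\<dots> = qs (X 1 (om f))" by (rule om_X_last)
  also have "X 1 (om f) = P (Y r f)" by (simp add: P_def Y_def Tw_Ti)
  finally show ?thesis .
qed

lemma T_P:
  assumes i: "1 \<le> i" "i + 1 < r"
  shows "T (i + 1) (P f) = P (T i f)"
proof -
  have "[1..<r] = [1..<i] @ [i..<r]" using assms upt_add_eq_append[of 1 i "r-i"] by simp
  also have "[i..<r] = i # (i+1) # [i+2..<r]" using assms by (simp add: upt_conv_Cons)
  finally have l: "[1..<r] = [1..<i] @ [i, i+1] @ [i+2..<r]" by simp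
  have "Tw [1..<r] (T i f) = Tw [1..<i] (T i (T (i+1) (Tw [i+2..<r] (T i f))))"
    unfolding l by simp
  also have "Tw [i+2..<r] (T i f) = T i (Tw [i+2..<r] f)"
    by (rule Tw_comm[symmetric]) (use assms in \<open>auto intro!: far_comm\<close>)
  also have "T i (T (i+1) (T i (Tw [i+2..<r] f))) = T (i+1) (T i (T (i+1) (Tw [i+2..<r] f)))"
    using braid i by simp
  also have "Tw [1..<i] (T (i+1) (T i (T (i+1) (Tw [i+2..<r] f)))) = T (i+1) (Tw [1..<r] f)"
    unfolding l by (simp, rule Tw_comm[symmetric, where S="T (Suc i)"]) (use assms in \<open>auto intro!: far_comm\<close>)
  finally show ?thesis using X_comm[of "i+1" 1] i by (simp add: P_def)
qed

text \<open>X_1 commutes with T_2, ..., T_{r-1}, becomes X_2 behind \<open>om\<close>, and T_1^{-1}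
  X_2 = X_1 T_1. What remains of the word commutes with Y_1.\<close>

lemma Y2_P: "Y 2 (P f) = P (Y 1 f)"
proof -
  have l: "[1..<r] = 1 # [2..<r]" using r2 by (simp add: upt_conv_Cons numeral_2_eq_2)
  have u: "rev [1..<2] = [1::nat]" by (simp add: upt_conv_Cons)
  have X2: "Ti 1 (X 2 f) = X 1 (T 1 f)" for f using X_T[of 1 f] r2 Ti_T[of 1] by (simp add: numeral_2_eq_2) metis
  have "Tw (rev [2..<r]) (X 1 (Tw [1..<r] f)) = X 1 (Tw (rev [2..<r]) (Tw [1..<r] f))"
    by (rule Tw_comm[symmetric]) (use X_comm in auto)
  also have "Tw (rev [2..<r]) (Tw [1..<r] f) = Tw (rev [1..<r]) (Tw [2..<r] f)" unfolding l by simp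
  finally have "Y 2 (P f) = Ti 1 (om (X 1 (Tw (rev [1..<r]) (Tw [2..<r] f))))"
    unfolding Y_def P_def u by simp
  also have "\<dots> = Ti 1 (X 2 (Y 1 (Tw [2..<r] f)))" using om_X[of 1] r2 by (simp add: Y_def numeral_2_eq_2)
  also have "\<dots> = X 1 (T 1 (Y 1 (Tw [2..<r] f)))" by (rule X2)
  also have "Y 1 (Tw [2..<r] f) = Tw [2..<r] (Y 1 f)"
    by (rule Tw_comm) (use T_Y1 in auto)
  finally show ?thesis unfolding P_def l by simp
qed

lemma Y_P:
  assumes "1 \<le> i" "i < r"
  shows "Y (i + 1) (P f) = P (Y i f)"
  using assms
proof (induction i arbitrary: f rule: nat_induct_at_least)
  case base
  then show ?case using Y2_P[of f] by (simp add: numeral_2_eq_2)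
next
  case (Suc i)
  have P: "Ti (i+1) (P f) = P (Ti i f)" for f
    by (rule intertwine_Ti[symmetric]) (use Suc.hyps Suc.prems T_P in auto)
  have "Y (i + 1 + 1) (P f) = Ti (i+1) (Y (i+1) (Ti (i+1) (P f)))" by (rule Y_Suc) (use Suc in auto)
  also have "\<dots> = P (Ti i (Y i (Ti i f)))" unfolding P using Suc P by simp
  also have "\<dots> = P (Y (i+1) f)" using Y_Suc[of i f] Suc by simp
  finally show ?case by simp
qed

text \<open>Solved for P T_{r-1}, this says that the operator T_{s_\<theta>}^{-1} x^{-n\<theta>} is
  the conjugate of T_{r-1} by P, so the affine generator inherits everything known about
  T_{r-1}.\<close>

lemma T_theta_P: "Tw ([1..<r] @ rev [1..<r-1]) (P (T (r - 1) f)) = Xm (P f)"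
proof -
  let ?A = "[1..<r-1]"
  have r1: "1 \<le> r - 1" "r - 1 < r" "r - 1 + 1 = r" using r2 by auto
  have l: "[1..<r] = ?A @ [r-1]" using upt_Suc_append[of 1 "r-1"] r1 by simp
  have "Tw ([1..<r] @ rev ?A) (P (T (r - 1) f)) = Tw ?A (T (r-1) (Tw (rev ?A) (X 1 (Tw ?A (T (r-1) (T (r-1) f))))))"
    unfolding l P_def by simp
  also have "\<dots> = Tw ?A (X r (T (r-1) f))"
    using Tw_X[of "r-1"] X_T[of "r-1"] r1 by simp
  also have "\<dots> = X r (Tw ?A (T (r-1) f))"
    by (rule Tw_comm[symmetric]) (use X_comm in auto)
  also have "\<dots> = Xm (P f)" unfolding P_def Xm l by simp
  finally show ?thesis .
qed

end

section \<open>Rotation of weights and the length-zero affine map\<close>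

lemmas cyc_inv_first' [simp] = cyc_inv_first[unfolded One_nat_def]

lemma s_perm_eq_iff [simp]: "s_perm i a = s_perm i b \<longleftrightarrow> a = b"
  by (metis s_perm_invol)

lemma rotate_weight_eq: "rotate_weight \<mu> = perm_act cyc (\<mu> :: 'r::{finite,linorder} weight)"
proof -
  have "rotate_weight \<mu> $ a = \<mu> $ cyc_inv a" for a
  proof (cases "coord_index a = 1")
    case True
    then have a: "a = coord 1" by (metis coord_coord_index)
    have "coord 1 \<noteq> (coord (i+1) :: 'r)" if "i \<in> {1..<CARD('r)}" for i
      using coord_eq_iff[where 'a='r, of 1 "i+1"] that by simp
    then have "(\<Sum>i\<in>{1..<CARD('r)}. \<mu> $ coord i *s eps (coord (i + 1))) $ a = 0"
      unfolding a by (simp add: sum_component)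
    then show ?thesis by (simp add: rotate_weight_def a)
  next
    case False
    define k where "k = coord_index a - 1"
    have k: "k \<in> {1..<CARD('r)}" "a = coord (k + 1)" "cyc_inv a = coord k"
      using False coord_index_bounds[of a] by (auto simp: k_def cyc_inv_def simp del: coord_index_bounds)
    have "coord 1 \<noteq> a" using False coord_index_coord[where 'a='r, of 1] by (metis One_nat_def Suc_leI le_refl zero_less_card_finite)
    moreover have "(\<Sum>i\<in>{1..<CARD('r)}. \<mu> $ coord i *s eps (coord (i + 1))) $ a 
      = (\<Sum>i\<in>{1..<CARD('r)}. if i = k then \<mu> $ coord k else 0)"
      unfolding sum_component
    proof (rule sum.cong)
      fix i assume "i \<in> {1..<CARD('r)}"
      then show "(\<mu> $ coord i *s eps (coord (i + 1))) $ a = (if i = k then \<mu> $ coord k else 0)"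
        unfolding k(2) using coord_eq_iff[where 'a='r, of "k+1" "i+1"] k(1) by auto
    qed simp
    ultimately show ?thesis using k by (simp add: rotate_weight_def)
  qed
  then show ?thesis by (simp add: vec_eq_iff)
qed

lemma lin_omega [simp]: "lin omega"
  by (simp add: omega_def lin_lin_ext)

lemma omega_x_pow: "omega (x_pow \<mu> :: ('r::{finite,linorder}, 'v::{finite,linorder}) laurent) 
   = smul (qpar powi (- (\<mu> $ coord CARD('r)))) (x_pow (perm_act cyc \<mu>))"
  by (simp add: omega_def rotate_weight_eq)

text \<open>The map from (\<nu>_1, ..., \<nu>_r) to (\<nu>_r + n, \<nu>_1, ...,
  \<nu>_{r-1}).\<close>

definition pi_act :: "nat \<Rightarrow> 'r::{finite,linorder} weight \<Rightarrow> 'r weight"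
  where "pi_act n \<nu> = int n *s eps (coord 1) + perm_act cyc \<nu>"

definition pi_inv_act :: "nat \<Rightarrow> 'r::{finite,linorder} weight \<Rightarrow> 'r weight"
  where "pi_inv_act n \<nu> = perm_act cyc_inv (\<nu> - int n *s eps (coord 1))"

lemma pi_act_inv [simp]: "pi_act n (pi_inv_act n \<nu>) = \<nu>"
  by (simp add: pi_act_def pi_inv_act_def perm_act_comp[symmetric])

lemma pi_act_nth: "pi_act n \<nu> $ a = \<nu> $ cyc_inv a + (if a = coord 1 then int n else 0)"
  by (simp add: pi_act_def)

lemma pi_inv_act_nth: "pi_inv_act n \<nu> $ a = \<nu> $ cyc a - (if cyc a = coord 1 then int n else 0)"
  by (simp add: pi_inv_act_def)

lemma cyc_coord: "1 \<le> i \<Longrightarrow> i < CARD('r) \<Longrightarrow> cyc (coord i) = (coord (i + 1) :: 'r::{finite,linorder})"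
  by (simp add: cyc_def)

lemma cyc_inv_coord: "1 \<le> i \<Longrightarrow> i < CARD('r) \<Longrightarrow> cyc_inv (coord (i + 1)) = (coord i :: 'r::{finite,linorder})"
  by (metis cyc_coord cyc_cyc_inv(2))

lemma cyc_eq_first: "cyc a = coord 1 \<longleftrightarrow> a = (coord CARD('r) :: 'r::{finite,linorder})"
  by (metis cyc_cyc_inv(2) cyc_last)

text \<open>The counterpart for weights of the conjugation of T_{r-1} into the affine
  generator.\<close>

lemma refl_act_0_pi_act:
  fixes \<nu> :: "'r::{finite,linorder} weight"
  assumes r2: "CARD('r) \<ge> 2"
  shows "refl_act n 0 (pi_act n \<nu>) = pi_act n (perm_act (s_perm (CARD('r) - 1)) \<nu>)"
proof -
  let ?r = "CARD('r)"
  have r1: "1 \<le> ?r - 1" "?r - 1 < ?r" "?r - 1 + 1 = ?r" using r2 by auto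
  have a: "cyc_inv (coord 1) = (coord ?r :: 'r)" "cyc_inv (coord ?r) = (coord (?r - 1) :: 'r)"
    using cyc_inv_coord[where 'r='r, of "?r - 1"] r1 by simp_all
  have s: "s_perm (?r - 1) (coord ?r) = (coord (?r - 1) :: 'r)" "s_perm (?r - 1) (coord (?r - 1)) = (coord ?r :: 'r)"
    using s_perm_coord[where 'a='r, of "?r - 1"] r1 by simp_all
  note ne = coord_first_last_ne[OF r2]
  have "refl_act n 0 (pi_act n \<nu>) $ b = pi_act n (perm_act (s_perm (?r - 1)) \<nu>) $ b" for b
  proof -
    consider "b = coord 1" | "b = coord ?r" | "b \<noteq> coord 1" "b \<noteq> coord ?r" by blast
    then show ?thesis
    proof cases
      case 3
      then have "cyc_inv b \<noteq> coord ?r" "cyc_inv b \<noteq> coord (?r - 1)"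
        using a by (metis cyc_cyc_inv(1))+
      then have "s_perm (?r - 1) (cyc_inv b) = cyc_inv b" using r1 by (simp add: s_perm_def)
      then show ?thesis using 3 by (simp add: refl_act_0_nth[OF r2] pi_act_nth del: One_nat_def)
    qed (use ne a s in \<open>simp_all add: refl_act_0_nth[OF r2] pi_act_nth del: One_nat_def\<close>)
  qed
  then show ?thesis by (simp add: vec_eq_iff)
qed

section \<open>The Hecke and shift relations for the operators on Laurent polynomials\<close>

context metaplectic_params begin

text \<open>The inverse T_i - (k - k^{-1}) provided by the quadratic relation.\<close>

definition T_hinv :: "nat \<Rightarrow> ('r::{finite,linorder}, 'v) laurent \<Rightarrow> ('r, 'v) laurent"
  where "T_hinv i f = T_op n sg i f - smul hecke_par f"

lemma T_T_hinv:
  fixes f :: "('r::{finite,linorder}, 'v) laurent"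
  assumes i: "1 \<le> i" "i < CARD('r)"
  shows "T_op n sg i (T_hinv i f) = f" "T_hinv i (T_op n sg i f) = f"
  using T_op_quadratic[OF i, of f] by (simp_all add: T_hinv_def lin_diff[OF lin_T_op] lin_smul[OF lin_T_op])

lemma bij_T_op:
  assumes i: "1 \<le> i" "i < CARD('r)"
  shows "bij (T_op n sg i :: ('r::{finite,linorder}, 'v) laurent \<Rightarrow> _)"
  by (rule o_bij[of "T_hinv i"]) (use T_T_hinv[OF i] in auto)

lemma T_inv_eq:
  assumes i: "1 \<le> i" "i < CARD('r)"
  shows "T_inv n sg i f = (T_hinv i f :: ('r::{finite,linorder}, 'v) laurent)"
  unfolding T_inv_def using T_T_hinv[OF i] bij_T_op[OF i] by (metis inv_f_f_bij(1))

lemma T_op_x_pow_mult: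
  fixes f :: "('r::{finite,linorder}, 'v) laurent"
  assumes i: "1 \<le> i" "i < CARD('r)"
  shows "T_op n sg i (x_pow (int n *s \<beta>) * f) = x_pow (int n *s perm_act (s_perm i) \<beta>) * T_op n sg i f
    + smul hecke_par (scl (demazure i (x_pow \<beta>)) * f)"
proof (rule lin_eqI[of "\<lambda>f. T_op n sg i (x_pow (int n *s \<beta>) * f)"])
  fix \<mu> :: "'r weight"
  show "T_op n sg i (x_pow (int n *s \<beta>) * x_pow \<mu>) = x_pow (int n *s perm_act (s_perm i) \<beta>) * T_op n sg i (x_pow \<mu>)
    + smul hecke_par (scl (demazure i (x_pow \<beta>)) * x_pow \<mu>)"
    using T_op_scl[OF i, of "x_pow \<beta>" \<mu>] by simp
qed (auto intro!: lin_intros lin_comp[OF lin_T_op])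

lemma omega_mult:
  fixes f :: "('r::{finite,linorder}, 'v) laurent"
  shows "omega (f * x_pow \<beta>) = smul (qpar powi (- (\<beta> $ coord CARD('r)))) (omega f * x_pow (perm_act cyc \<beta>))"
proof (rule lin_eqI[of "\<lambda>f. omega (f * x_pow \<beta>)"])
  fix \<mu> :: "'r weight"
  show "omega (x_pow \<mu> * x_pow \<beta> :: ('r, 'v) laurent) = smul (qpar powi (- (\<beta> $ coord CARD('r)))) (omega (x_pow \<mu>) * x_pow (perm_act cyc \<beta>))"
  proof -
    have "- ((\<mu> + \<beta>) $ coord CARD('r)) = - (\<beta> $ coord CARD('r)) + - (\<mu> $ coord CARD('r))" by simp
    then have "qpar powi (- ((\<mu> + \<beta>) $ coord CARD('r))) = (qpar powi (- (\<beta> $ coord CARD('r))) * qpar powi (- (\<mu> $ coord CARD('r))) :: 'v pfield)"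
      by (simp only: power_int_add[OF disjI1[OF qpar_nz]])
    then show ?thesis unfolding x_pow_add[symmetric, of \<mu>] omega_x_pow
      by (simp add: smul_mult smul_simps perm_act_add x_pow_add)
  qed
qed (auto intro!: lin_intros lin_comp[OF lin_omega])

lemma perm_act_cyc_simple_root:
  assumes "1 \<le> i" "i + 1 < CARD('r)"
  shows "perm_act cyc (simple_root i) = (simple_root (i + 1) :: 'r::{finite,linorder} weight)"
  using cyc_coord[where 'r='r, of i] cyc_coord[where 'r='r, of "i+1"] assms
  by (simp add: simple_root_def perm_act_diff perm_act_eps)

text \<open>For i + 1 < r the root \<alpha>_i does not involve the last coordinate. All exponents in
  T_i x^\<mu> therefore share the power of q, and the rotation turns \<alpha>_i into
  \<alpha>_{i+1}.\<close>

lemma omega_T_op: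
  fixes f :: "('r::{finite,linorder}, 'v) laurent"
  assumes i: "1 \<le> i" "i + 1 < CARD('r)"
  shows "omega (T_op n sg i f) = T_op n sg (i + 1) (omega f)"
proof (rule lin_eqI[of "\<lambda>f. omega (T_op n sg i f)"])
  have i': "i < CARD('r)" "1 \<le> i + 1" using i by auto
  fix \<mu> :: "'r weight"
  let ?\<mu>' = "perm_act cyc \<mu>" and ?q = "qpar powi (- (\<mu> $ coord CARD('r))) :: 'v pfield"
  have ci: "cyc_inv (coord (i + 1)) = (coord i :: 'r)" "cyc_inv (coord (i + 2)) = (coord (i + 1) :: 'r)"
    using cyc_inv_coord[where 'r='r, of i] cyc_inv_coord[where 'r='r, of "i+1"] i by simp_all
  have ip: "ip ?\<mu>' (simple_root (i + 1)) = ip \<mu> (simple_root i)"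
    using ci by (simp add: ip_simple_root)
  have last: "(simple_root i :: 'r weight) $ coord CARD('r) = 0"
    using i coord_eq_iff[where 'a='r, of "CARD('r)" i] coord_eq_iff[where 'a='r, of "CARD('r)" "i+1"]
    by (simp add: simple_root_def)
  let ?y = "\<lambda>i. x_pow (int n *s simple_root i) :: ('r, 'v) laurent"
  have y: "omega (g * (1 - ?y i)) = omega g * (1 - ?y (i + 1))" for g
    by (simp add: right_diff_distrib lin_diff[OF lin_omega] omega_mult last perm_act_scale perm_act_cyc_simple_root[OF i] smul_simps del: vector_scalar_mult_def)
  have q: "omega (T_quot i \<mu> :: ('r, 'v) laurent) = smul ?q (T_quot (i + 1) ?\<mu>')"
  proof (rule one_minus_x_pow_cancel[OF n_simple_root_nz[OF i'(2) i(2)]])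
    have "omega (T_quot i \<mu>) * (1 - ?y (i + 1)) = omega (x_pow \<mu> - (x_pow (\<mu> - t_floor n (ip \<mu> (simple_root i)) *s simple_root i) :: ('r, 'v) laurent))"
      unfolding y[symmetric] T_quot_mult[OF i(1) i'(1)] ..
    also have "\<dots> = smul ?q (x_pow ?\<mu>' - x_pow (?\<mu>' - t_floor n (ip \<mu> (simple_root i)) *s simple_root (i+1)))"
      by (simp add: lin_diff[OF lin_omega] omega_x_pow last perm_act_diff perm_act_scale perm_act_cyc_simple_root[OF i, simplified] smul_simps)
    also have "\<dots> = smul ?q (T_quot (i + 1) ?\<mu>') * (1 - ?y (i + 1))"
      unfolding smul_mult T_quot_mult[OF i'(2) i(2)] ip ..
    finally show "omega (T_quot i \<mu>) * (1 - ?y (i + 1)) = smul ?q (T_quot (i + 1) ?\<mu>') * (1 - ?y (i + 1))" .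
  qed
  have s: "perm_act cyc (perm_act (s_perm i) \<mu>) = perm_act (s_perm (i + 1)) ?\<mu>'"
    unfolding perm_act_s_perm_eq[OF i(1) i'(1)] perm_act_s_perm_eq[OF i'(2) i(2)] ip
    by (simp only: perm_act_diff perm_act_scale perm_act_cyc_simple_root[OF i])
  have l: "perm_act (s_perm i) \<mu> $ coord CARD('r) = \<mu> $ coord CARD('r)"
    unfolding perm_act_s_perm_eq[OF i(1) i'(1)] by (simp add: last)
  show "omega (T_op n sg i (x_pow \<mu> :: ('r, 'v) laurent)) = T_op n sg (i + 1) (omega (x_pow \<mu>))"
    unfolding omega_x_pow lin_smul[OF lin_T_op] T_op_x_pow lin_add[OF lin_omega] lin_smul[OF lin_omega] q s l ip
    by (simp add: smul_simps mult.commute)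
qed (auto intro!: lin_intros lin_comp[OF lin_T_op] lin_comp[OF lin_omega])

definition X_mult :: "nat \<Rightarrow> ('r::{finite,linorder}, 'v) laurent \<Rightarrow> ('r, 'v) laurent"
  where "X_mult a f = x_pow (int n *s eps (coord a)) * f"

definition X_theta_inv :: "('r::{finite,linorder}, 'v) laurent \<Rightarrow> ('r, 'v) laurent"
  where "X_theta_inv f = x_pow (- (int n *s theta)) * f"

lemma perm_act_cyc_n_eps: "perm_act cyc (int n *s eps a) = int n *s eps (cyc a)"
  by (simp add: perm_act_scale perm_act_eps)

lemma hecke_operators_laurent:
  assumes r2: "CARD('r::{finite,linorder}) \<ge> 2"
  shows "hecke_operators (T_op n sg :: nat \<Rightarrow> ('r, 'v) laurent \<Rightarrow> _) T_hinv omega X_mult 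
     (smul (qpar powi (- int n))) X_theta_inv CARD('r)"
proof
  show "CARD('r) \<ge> 2" by fact
  fix f :: "('r, 'v) laurent"
  show "T_op n sg i (T_hinv i f) = f" "T_hinv i (T_op n sg i f) = f" if "1 \<le> i" "i < CARD('r)" for i
    using T_T_hinv[OF that] by auto
  show "T_op n sg i (T_op n sg (i + 1) (T_op n sg i f)) = T_op n sg (i + 1) (T_op n sg i (T_op n sg (i + 1) f))" 
    if "1 \<le> i" "i + 1 < CARD('r)" for i
    using T_op_braid[OF that] .
  show "T_op n sg i (T_op n sg j f) = T_op n sg j (T_op n sg i f)" 
    if "1 \<le> i" "i + 1 < j" "j < CARD('r)" for i j
    using that by (intro T_op_commute) auto
  show "omega (T_op n sg i f) = T_op n sg (i + 1) (omega f)" if "1 \<le> i" "i + 1 < CARD('r)" for i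
    using omega_T_op[OF that] .
  \<comment> \<open>The divided difference of x_i is -x_{i+1}, so its contribution cancels the
    linear term of the quadratic relation.\<close>
  show "T_op n sg i (X_mult i (T_op n sg i f)) = X_mult (i + 1) f" if i: "1 \<le> i" "i < CARD('r)" for i
    unfolding X_mult_def T_op_x_pow_mult[OF i] demazure_eps[OF i]
    by (simp add: perm_act_eps s_perm_coord[OF i, simplified] T_op_quadratic[OF i] lin_neg[OF lin_scl] smul_simps smul_mult distrib_left)
  show "T_op n sg i (X_mult a f) = X_mult a (T_op n sg i f)" 
    if i: "1 \<le> i" "i < CARD('r)" and a: "1 \<le> a" "a \<le> CARD('r)" "a \<noteq> i" "a \<noteq> i + 1" for i a
  proof -
    have "coord a \<noteq> (coord i :: 'r)" "coord a \<noteq> (coord (i+1) :: 'r)"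
      using i a coord_eq_iff[where 'a='r, of a i] coord_eq_iff[where 'a='r, of a "i+1"] by auto
    then show ?thesis unfolding X_mult_def T_op_x_pow_mult[OF i] demazure_eps[OF i]
      by (simp add: perm_act_eps s_perm_def scl_lin smul_simps)
  qed
  show "omega (X_mult i f) = X_mult (i + 1) (omega f)" if i: "1 \<le> i" "i < CARD('r)" for i
  proof -
    have "coord CARD('r) \<noteq> (coord i :: 'r)" using i coord_eq_iff[where 'a='r, of "CARD('r)" i] by auto
    then show ?thesis using omega_mult[of f "int n *s eps (coord i)"] cyc_coord[OF i]
      by (simp add: X_mult_def mult.commute perm_act_cyc_n_eps smul_simps)
  qed
  show "omega (X_mult CARD('r) f) = smul (qpar powi (- int n)) (X_mult 1 (omega f))"
    using omega_mult[of f "int n *s eps (coord CARD('r))"]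
    by (simp add: X_mult_def mult.commute perm_act_cyc_n_eps del: One_nat_def)
  have "- (int n *s theta) + int n *s eps (coord 1) = (int n *s eps (coord CARD('r)) :: 'r weight)"
    by (simp add: theta_def vec_eq_iff algebra_simps)
  then show "X_theta_inv (X_mult 1 f) = X_mult CARD('r) f"
    by (simp add: X_theta_inv_def X_mult_def flip: mult.assoc x_pow_add del: One_nat_def)
qed

section \<open>The spectrum\<close>

text \<open>The function \<gamma> at n\<beta> + n^2 d\<delta>; with this parametrization the
  divisions in \<open>gamma\<close> are exact and it becomes multiplicative.\<close>

definition gm :: "'r::{finite,linorder} weight \<Rightarrow> int \<Rightarrow> 'r weight \<Rightarrow> 'v pfield"
  where "gm \<beta> d \<nu> = gamma n sg (int n *s \<beta>, (int n)\<^sup>2 * d) \<nu>"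

lemma gm_eq: "gm \<beta> d \<nu> = qpar powi (- d * int n - ip \<beta> \<nu>) * (\<Prod>\<alpha>\<in>pos_roots. sigma n sg (ip \<nu> \<alpha>) powi (ip \<beta> \<alpha>))"
  using n1 by (simp add: gm_def gamma_def ip_scale)

lemma gm_add: "gm (\<beta> + \<beta>') (d + d') \<nu> = gm \<beta> d \<nu> * gm \<beta>' d' \<nu>"
proof -
  have "- (d + d') * int n - ip (\<beta> + \<beta>') \<nu> = (- d * int n - ip \<beta> \<nu>) + (- d' * int n - ip \<beta>' \<nu>)"
    by (simp add: ip_add_left algebra_simps)
  then have "qpar powi (- (d + d') * int n - ip (\<beta> + \<beta>') \<nu>) = 
     (qpar powi (- d * int n - ip \<beta> \<nu>) * qpar powi (- d' * int n - ip \<beta>' \<nu>) :: 'v pfield)"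
    by (simp only: power_int_add[OF disjI1[OF qpar_nz]])
  moreover have "(\<Prod>\<alpha>\<in>pos_roots. sigma n sg (ip \<nu> \<alpha>) powi (ip (\<beta> + \<beta>') \<alpha>)) = 
    (\<Prod>\<alpha>\<in>pos_roots. sigma n sg (ip \<nu> \<alpha>) powi (ip \<beta> \<alpha>)) * (\<Prod>\<alpha>\<in>pos_roots. sigma n sg (ip \<nu> \<alpha>) powi (ip \<beta>' \<alpha>))"
    by (simp add: ip_add_left power_int_add prod.distrib)
  ultimately show ?thesis unfolding gm_eq by (simp only: ac_simps)
qed

lemma gm_zero: "gm 0 d \<nu> = qpar powi (- d * int n)"
  by (simp add: gm_eq)

text \<open>The values of \<sigma> have exponent 0, so only the explicit power of q counts.
  Separation of eigenvalues and nonvanishing of denominators both rest on this.\<close>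

lemma qdeg_gm: "qdeg (gm \<beta> d \<nu>) (- d * int n - ip \<beta> \<nu>)"
proof -
  have "qdeg (\<Prod>\<alpha>\<in>pos_roots. sigma n sg (ip \<nu> \<alpha>) powi (ip \<beta> \<alpha>)) 0"
    by (rule qdeg_prod) (use qdeg_power_int[OF qdeg_sigma] in simp)
  from qdeg_mult[OF qdeg_power_int[OF qdeg_qpar, of "- d * int n - ip \<beta> \<nu>"] this] show ?thesis unfolding gm_eq by simp
qed

lemma gm_nz [simp]: "gm \<beta> d \<nu> \<noteq> 0"
  using qdeg_nonzero[OF qdeg_gm] .

lemma gm_minus: "gm (- \<beta>) (- d) \<nu> = inverse (gm \<beta> d \<nu>)"
  using gm_add[of "- \<beta>" \<beta> "- d" d \<nu>] by (simp add: gm_zero field_simps)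

definition yval :: "'r::{finite,linorder} \<Rightarrow> 'r weight \<Rightarrow> 'v pfield"
  where "yval a \<nu> = gm (eps a) 0 \<nu>"

lemma yval_gamma: "gamma n sg (int n *s eps a, 0) \<nu> = yval a \<nu>"
  by (simp add: yval_def gm_def)

text \<open>The contribution of the positive root between \<open>a\<close> and \<open>b\<close> to
  the eigenvalue of index \<open>a\<close>. The order of \<open>a\<close> and \<open>b\<close>
  matters only for equal entries, where it decides between k and k^{-1}.\<close>

definition pair_factor :: "'r::{finite,linorder} \<Rightarrow> 'r \<Rightarrow> 'r weight \<Rightarrow> 'v pfield"
  where "pair_factor a b \<nu> = (if a < b then sigma n sg (\<nu> $ a - \<nu> $ b) else inverse (sigma n sg (\<nu> $ b - \<nu> $ a)))"

lemma pair_factor_ne: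
  assumes "\<nu> $ a \<noteq> \<nu> $ b" shows "pair_factor a b \<nu> = sigma n sg (\<nu> $ a - \<nu> $ b)"
proof -
  have "sigma n sg (\<nu> $ a - \<nu> $ b) * sigma n sg (\<nu> $ b - \<nu> $ a) = 1"
    using sigma_neg[of "\<nu> $ a - \<nu> $ b"] assms by simp
  then have "inverse (sigma n sg (\<nu> $ b - \<nu> $ a)) = sigma n sg (\<nu> $ a - \<nu> $ b)"
    by (metis inverse_unique mult.commute)
  then show ?thesis by (simp add: pair_factor_def)
qed

text \<open>Positive roots are pairs of positions, and a root not involving \<open>a\<close> enters
  with exponent 0.\<close>

lemma yval_eq: "yval a \<nu> = qpar powi (- (\<nu> $ a)) * (\<Prod>b\<in>UNIV - {a}. pair_factor a b \<nu>)"
  for a :: "'r::{finite,linorder}"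
proof -
  let ?D = "{(p, q :: 'r). p < q}" and ?g = "\<lambda>(p, q). sigma n sg (\<nu> $ p - \<nu> $ q) powi ((if a = p then 1 else 0) - (if a = q then 1 else 0))"
  have pr: "pos_roots = (\<lambda>(p, q). eps p - eps q) ` ?D" by (auto simp: pos_roots_def)
  have inj: "inj_on (\<lambda>(p, q). eps p - eps q :: 'r weight) ?D"
  proof (rule inj_onI, clarify)
    fix p q p' q' :: 'r assume lt: "p < q" "p' < q'" and e: "eps p - eps q = (eps p' - eps q' :: 'r weight)"
    have "(eps p - eps q :: 'r weight) $ p = 1" "(eps p - eps q :: 'r weight) $ q = -1" using lt by auto
    then have "(if p = p' then 1 else 0) - (if p = q' then 1 else 0) = (1::int)"
      "(if q = p' then 1 else 0) - (if q = q' then 1 else 0) = (-1::int)"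
      unfolding e by simp_all
    then show "p = p' \<and> q = q'" by (auto split: if_splits)
  qed
  have "(\<Prod>\<alpha>\<in>pos_roots. sigma n sg (ip \<nu> \<alpha>) powi (ip (eps a) \<alpha>)) = prod ?g ?D"
    unfolding pr by (subst prod.reindex[OF inj], rule prod.cong) (auto simp: ip_diff ip_eps)
  also have "\<dots> = prod ?g ((\<lambda>q. (a, q)) ` {q. a < q} \<union> (\<lambda>p. (p, a)) ` {p. p < a})"
    by (rule prod.mono_neutral_right) (auto simp: image_iff split: if_splits)
  also have "\<dots> = prod ?g ((\<lambda>q. (a, q)) ` {q. a < q}) * prod ?g ((\<lambda>p. (p, a)) ` {p. p < a})"
    by (rule prod.union_disjoint) auto
  also have "prod ?g ((\<lambda>q. (a, q)) ` {q. a < q}) = (\<Prod>q | a < q. pair_factor a q \<nu>)"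
    by (subst prod.reindex) (auto simp: inj_on_def pair_factor_def intro!: prod.cong)
  also have "prod ?g ((\<lambda>p. (p, a)) ` {p. p < a}) = (\<Prod>p | p < a. pair_factor a p \<nu>)"
    by (subst prod.reindex) (auto simp: inj_on_def pair_factor_def power_int_minus intro!: prod.cong)
  also have "(\<Prod>q | a < q. pair_factor a q \<nu>) * (\<Prod>p | p < a. pair_factor a p \<nu>) = (\<Prod>b\<in>{q. a < q} \<union> {p. p < a}. pair_factor a b \<nu>)"
    by (rule prod.union_disjoint[symmetric]) auto
  also have "{q. a < q} \<union> {p. p < a} = UNIV - {a}" by auto
  finally show ?thesis by (simp add: yval_def gm_eq ip_eps_left)
qed

text \<open>For a multiple d of n, exactly one of d and n - d is positive, so the values are k^{-1}
  and k. Otherwise n - d has the residue of -d. This makes the spectrum compatible with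
  \<open>pi_act\<close>, which shifts one entry by n.\<close>

lemma sigma_compl: "sigma n sg d * sigma n sg (int n - d) = 1"
proof (cases "int n dvd d")
  case True
  then have "int n dvd int n - d" by simp
  moreover have "d > 0 \<Longrightarrow> d \<ge> int n" using True by (simp add: zdvd_imp_le)
  ultimately show ?thesis using True n1 by (cases "d > 0") (auto simp: sigma_def Gpar_dvd)
next
  case False
  then have 1: "\<not> int n dvd int n - d" by (metis diff_diff_eq2 add_diff_cancel_left' dvd_diff dvd_refl)
  have "Gpar n sg (int n - d) = Gpar n sg (- d)"
    by (rule Gpar_cong) (metis minus_mod_self1 uminus_add_conv_diff mod_add_self1 add.commute)
  then show ?thesis using Gpar_neg[OF False] 1 False by (simp add: sigma_def)
qed

text \<open>The reflection changes the order of a single pair, and for distinct entries the factor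
  of this pair does not depend on the order.\<close>

lemma yval_s_perm:
  fixes \<nu> :: "'r::{finite,linorder} weight"
  assumes i: "1 \<le> i" "i < CARD('r)" and ne: "\<nu> $ coord i \<noteq> \<nu> $ coord (i+1)"
  shows "yval a (perm_act (s_perm i) \<nu>) = yval (s_perm i a) \<nu>"
proof -
  have f: "pair_factor a b (perm_act (s_perm i) \<nu>) = pair_factor (s_perm i a) (s_perm i b) \<nu>" if "a \<noteq> b" for a b
  proof (cases "{a, b} = {coord i, coord (i+1)}")
    case True
    then have "\<nu> $ s_perm i a \<noteq> \<nu> $ s_perm i b"
      using ne s_perm_coord[OF i] by (auto simp: doubleton_eq_iff)
    then show ?thesis by (simp add: pair_factor_ne)
  next
    case False
    from s_perm_less_iff[OF i that False] show ?thesis by (simp add: pair_factor_def)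
  qed
  have "(\<Prod>b\<in>UNIV - {a}. pair_factor a b (perm_act (s_perm i) \<nu>)) = (\<Prod>b\<in>UNIV - {s_perm i a}. pair_factor (s_perm i a) b \<nu>)"
    by (rule prod.reindex_bij_witness[of _ "s_perm i" "s_perm i"]) (auto simp: f)
  then show ?thesis by (simp add: yval_eq)
qed

text \<open>Rotation makes the last position the first, reverses its order against all others and
  adds n to its entry; \<open>sigma_compl\<close> shows that the two changes cancel in every
  factor.\<close>

lemma yval_pi_act:
  fixes \<nu> :: "'r::{finite,linorder} weight"
  shows "yval (cyc a) (pi_act n \<nu>) = (if a = coord CARD('r) then qpar powi (- int n) else 1) * yval a \<nu>"
proof -
  let ?r = "coord CARD('r) :: 'r"
  have last: "coord_index ?r = CARD('r)" by (rule coord_index_coord) (use coord_index_bounds(1,3)[of a] in linarith, simp)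
  have val: "pi_act n \<nu> $ cyc a = \<nu> $ a + (if a = ?r then int n else 0)" for a
    by (simp add: pi_act_nth cyc_eq_first del: One_nat_def)
  have less: "cyc a < cyc b \<longleftrightarrow> (if b = ?r then False else if a = ?r then True else a < b)" if "a \<noteq> b" for a b :: 'r
  proof -
    have "a = ?r \<longleftrightarrow> coord_index a = CARD('r)" "b = ?r \<longleftrightarrow> coord_index b = CARD('r)" using last by (metis coord_coord_index)+
    then show ?thesis using that coord_index_bounds[of a] coord_index_bounds[of b]
      by (auto simp: coord_index_less_iff[of "cyc a"] coord_index_less_iff[of a b] coord_index_cyc simp del: coord_index_bounds)
  qed
  have inv: "inverse (sigma n sg (int n - d)) = sigma n sg d" for d
    using sigma_compl[of d] by (metis inverse_unique mult.commute)
  have f: "pair_factor (cyc a) (cyc b) (pi_act n \<nu>) = pair_factor a b \<nu>" if "a \<noteq> b" for a b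
  proof -
    have m: "a < ?r" if "a \<noteq> ?r" for a using that last coord_index_bounds(3)[of a]
      by (metis coord_index_less_iff coord_index_inj le_less)
    consider "b = ?r" | "a = ?r" "b \<noteq> ?r" | "a \<noteq> ?r" "b \<noteq> ?r" by blast
    then show ?thesis
    proof cases
      case 1
      have e: "\<nu> $ b + int n - \<nu> $ a = int n - (\<nu> $ a - \<nu> $ b)" by simp
      have ar: "a \<noteq> ?r" using 1 that by simp
      have "pair_factor (cyc a) (cyc b) (pi_act n \<nu>) = inverse (sigma n sg (\<nu> $ b + int n - \<nu> $ a))"
        unfolding pair_factor_def val less[OF that] using 1 ar by simp
      also have "\<dots> = pair_factor a b \<nu>" unfolding e inv pair_factor_def using 1 m[OF ar] by simp
      finally show ?thesis .
    next
      case 2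
      have e: "\<nu> $ a + int n - \<nu> $ b = int n - (\<nu> $ b - \<nu> $ a)" by simp
      have nl: "\<not> a < b" using m[of b] 2 by auto
      have "pair_factor (cyc a) (cyc b) (pi_act n \<nu>) = inverse (inverse (sigma n sg (\<nu> $ a + int n - \<nu> $ b)))"
        unfolding pair_factor_def val less[OF that] using 2 by simp
      also have "\<dots> = pair_factor a b \<nu>" unfolding e inv pair_factor_def using nl by simp
      finally show ?thesis .
    next
      case 3
      then show ?thesis unfolding pair_factor_def val less[OF that] by auto
    qed
  qed
  have "(\<Prod>b\<in>UNIV - {cyc a}. pair_factor (cyc a) b (pi_act n \<nu>)) = (\<Prod>b\<in>UNIV - {a}. pair_factor a b \<nu>)"
  proof (rule prod.reindex_bij_witness[of _ cyc cyc_inv])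
    fix b assume b: "b \<in> UNIV - {cyc a}"
    then have "a \<noteq> cyc_inv b" by auto
    from f[OF this] show "pair_factor a (cyc_inv b) \<nu> = pair_factor (cyc a) b (pi_act n \<nu>)" by simp
    show "cyc_inv b \<in> UNIV - {a}" using b by auto
  next
    fix b assume b: "b \<in> UNIV - {a}"
    show "cyc b \<in> UNIV - {cyc a}" using b by (metis DiffE DiffI UNIV_I cyc_cyc_inv(2) singletonD singletonI)
  qed simp_all
  moreover have "qpar powi (- (pi_act n \<nu> $ cyc a)) = (if a = ?r then qpar powi (- int n) else 1) * (qpar powi (- (\<nu> $ a)) :: 'v pfield)"
  proof -
    have "- (\<nu> $ a + int n) = - int n + - (\<nu> $ a)" by simp
    then show ?thesis unfolding val by (simp only: power_int_add[OF disjI1[OF qpar_nz]] split: if_split) simp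
  qed
  ultimately show ?thesis by (simp only: yval_eq mult.assoc)
qed

end

section \<open>Walls and right multiplication\<close>

lemma lin_comp_list: "(\<And>i. i \<in> set ws \<Longrightarrow> lin (T i)) \<Longrightarrow> lin (comp_list (map T ws))"
proof (induction ws)
  case (Cons i ws)
  have "lin (T i)" "lin (comp_list (map T ws))" using Cons by auto
  from lin_comp[OF this] show ?case by (simp add: lin_def)
qed (simp add: lin_def)

abbreviation LTw :: "nat list \<Rightarrow> ('r::{finite,linorder}, 'v::{finite,linorder}) hmod \<Rightarrow> ('r, 'v) hmod"
  where "LTw ws \<equiv> comp_list (map LT ws)"

definition hone :: "('r::{finite,linorder}, 'v::{finite,linorder}) hmod"
  where "hone = mon 0 id"

lemma LTw_reduced:
  assumes "perm_reduced ws (p :: 'r::{finite,linorder} \<Rightarrow> 'r)"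
  shows "LTw ws hone = (mon 0 p :: ('r, 'v::{finite,linorder}) hmod)"
  by (rule perm_reduced_induct[OF assms, where P="\<lambda>ws p. LTw ws hone = mon 0 p"]) (simp_all add: LT_mon0_asc hone_def)

text \<open>The permutation built so far sends position 1 to j and fixes position j + 1, so the next
  letter j is an ascent.\<close>

lemma LTw_down:
  assumes "1 \<le> j" "j \<le> CARD('r)"
  shows "\<exists>p. bij p \<and> LTw (rev [1..<j]) hone = (mon 0 p :: ('r::{finite,linorder}, 'v::{finite,linorder}) hmod) \<and>
    (\<forall>a. coord_index (p a) = (if coord_index a = 1 then j else if coord_index a \<le> j then coord_index a - 1 else coord_index a))"
  using assms
proof (induction j rule: nat_induct_at_least)
  case base
  have "coord_index a \<le> 1 \<longleftrightarrow> coord_index a = 1" for a :: 'r using coord_index_bounds(1)[of a] by linarith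
  then show ?case
    by (intro exI[of _ id] conjI allI) (rule bij_id, simp add: hone_def del: id_apply, simp)
next
  case (Suc j)
  then obtain p where p: "bij p" "LTw (rev [1..<j]) hone = (mon 0 p :: ('r, 'v) hmod)"
    "\<And>a. coord_index (p a) = (if coord_index a = 1 then j else if coord_index a \<le> j then coord_index a - 1 else coord_index a)"
    by auto
  have j: "1 \<le> j" "j < CARD('r)" using Suc by auto
  have "p (coord 1) = coord j" "p (coord (j + 1)) = coord (j + 1)"
    using p(3)[of "coord 1"] p(3)[of "coord (j+1)"] j by (metis coord_coord_index coord_index_coord le_trans One_nat_def order_refl less_imp_le,
      metis coord_coord_index coord_index_coord Suc_eq_plus1 Suc_leI le_add2 not_less_eq_eq order_refl add_cancel_right_left not_one_le_zero)
  then have "inv p (coord j) = coord 1" "inv p (coord (j+1)) = coord (j+1)" using p(1) by (metis inv_f_f_bij(1))+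
  then have asc: "inv p (coord j) < inv p (coord (j + 1))"
    using j coord_strict_mono[where 'a='r, of 1 "j+1"] by simp
  have "LTw (rev [1..<Suc j]) hone = (mon 0 (s_perm j \<circ> p) :: ('r, 'v) hmod)"
    using Suc.hyps p(2) LT_mon0_asc[OF p(1) j asc] by simp
  moreover have "coord_index ((s_perm j \<circ> p) a) = (if coord_index a = 1 then Suc j else if coord_index a \<le> Suc j then coord_index a - 1 else coord_index a)" for a
    using j p(3)[of a] coord_index_bounds(1)[of a] by (auto simp: coord_index_s_perm[OF j] simp del: coord_index_bounds)
  ultimately show ?case using bij_comp'[OF bij_s_perm[of j] p(1)] by blast
qed

lemma LTw_up:
  assumes "1 \<le> j" "j \<le> CARD('r)"
  shows "\<exists>p. bij p \<and> LTw [j..<CARD('r)] hone = (mon 0 p :: ('r::{finite,linorder}, 'v::{finite,linorder}) hmod) \<and>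
    (\<forall>a. coord_index (p a) = (if coord_index a = CARD('r) then j else if j \<le> coord_index a then coord_index a + 1 else coord_index a))"
  using assms(2,1)
proof (induction j rule: inc_induct)
  case base
  have "CARD('r) \<le> coord_index a \<longleftrightarrow> coord_index a = CARD('r)" for a :: 'r using coord_index_bounds(3)[of a] by linarith
  then show ?case
    by (intro exI[of _ id] conjI allI) (rule bij_id, simp add: hone_def del: id_apply, simp)
next
  case (step j)
  then obtain p where p: "bij p" "LTw [Suc j..<CARD('r)] hone = (mon 0 p :: ('r, 'v) hmod)"
    "\<And>a. coord_index (p a) = (if coord_index a = CARD('r) then Suc j else if Suc j \<le> coord_index a then coord_index a + 1 else coord_index a)"
    by auto
  have j: "1 \<le> j" "j < CARD('r)" using step by auto
  have i: "coord_index (coord j :: 'r) = j" "coord_index (coord CARD('r) :: 'r) = CARD('r)" 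
    using j by (auto intro!: coord_index_coord)
  have "p (coord CARD('r)) = coord (j+1)" "p (coord j) = coord j"
    using p(3)[of "coord CARD('r)"] p(3)[of "coord j"] j unfolding i
    by (metis coord_coord_index Suc_eq_plus1, metis coord_coord_index Suc_n_not_le_n less_irrefl)
  then have "inv p (coord (j+1)) = coord CARD('r)" "inv p (coord j) = coord j" using p(1) by (metis inv_f_f_bij(1))+
  then have asc: "inv p (coord j) < inv p (coord (j + 1))"
    using j coord_strict_mono[where 'a='r, of j "CARD('r)"] by simp
  have "[j..<CARD('r)] = j # [Suc j..<CARD('r)]" using j by (simp add: upt_conv_Cons)
  then have "LTw [j..<CARD('r)] hone = (mon 0 (s_perm j \<circ> p) :: ('r, 'v) hmod)"
    using p(2) LT_mon0_asc[OF p(1) j asc] by simp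
  moreover have "coord_index ((s_perm j \<circ> p) a) = (if coord_index a = CARD('r) then j else if j \<le> coord_index a then coord_index a + 1 else coord_index a)" for a
    using j p(3)[of a] coord_index_bounds(3)[of a] by (auto simp: coord_index_s_perm[OF j] simp del: coord_index_bounds)
  ultimately show ?case using bij_comp'[OF bij_s_perm[of j] p(1)] by blast
qed

lemma LTw_cyc_inv: "LTw (rev [1..<CARD('r)]) hone = (mon 0 cyc_inv :: ('r::{finite,linorder}, 'v::{finite,linorder}) hmod)"
proof -
  obtain p where p: "LTw (rev [1..<CARD('r)]) hone = (mon 0 p :: ('r, 'v) hmod)"
    "\<And>a. coord_index (p a) = (if coord_index a = 1 then CARD('r) else if coord_index a \<le> CARD('r) then coord_index a - 1 else coord_index a)"
    using LTw_down[where 'r='r, of "CARD('r)"] by (auto simp: Suc_leI)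
  have "p = cyc_inv" by (rule ext, subst coord_index_inj[symmetric]) (simp add: p(2) coord_index_cyc_inv del: coord_index_inj)
  then show ?thesis using p(1) by simp
qed

lemma LTw_cyc: "LTw [1..<CARD('r)] hone = (mon 0 cyc :: ('r::{finite,linorder}, 'v::{finite,linorder}) hmod)"
proof -
  obtain p where p: "LTw [1..<CARD('r)] hone = (mon 0 p :: ('r, 'v) hmod)"
    "\<And>a. coord_index (p a) = (if coord_index a = CARD('r) then 1 else if 1 \<le> coord_index a then coord_index a + 1 else coord_index a)"
    using LTw_up[where 'r='r, of 1] by (auto simp: Suc_leI)
  have "p = cyc" by (rule ext, subst coord_index_inj[symmetric]) (simp add: p(2) coord_index_cyc del: coord_index_inj)
  then show ?thesis using p(1) by simp
qed

lemma gen_LT: "gen (F :: ('r::{finite,linorder}, 'v::{finite,linorder}) hmod) \<Longrightarrow> 1 \<le> i \<Longrightarrow> i < CARD('r) \<Longrightarrow> gen (LT i F)"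
proof (induction rule: gen.induct)
  case gen_one
  have "LT i (mon 0 id) = (mon 0 (s_perm i \<circ> id) :: ('r, 'v) hmod)"
    using gen_one coord_less_Suc[OF gen_one] by (intro LT_mon0_asc) simp_all
  then show ?case using gen_mon[of "s_perm i \<circ> id :: 'r \<Rightarrow> 'r" 0, where 'v='v] by simp
qed (simp_all add: LT_RT LT_RP LT_RPi LT_lin gen.intros)

definition LTi :: "nat \<Rightarrow> ('r::{finite,linorder}, 'v::{finite,linorder}) hmod \<Rightarrow> ('r, 'v) hmod"
  where "LTi i F = hadd (LT i F) (hsmul (- hecke_par) F)"

lemma LTi_LT: "gen (F :: ('r::{finite,linorder}, 'v::{finite,linorder}) hmod) \<Longrightarrow> 1 \<le> i \<Longrightarrow> i < CARD('r) \<Longrightarrow> LTi i (LT i F) = F"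
  unfolding LTi_def LT_quadratic by (auto simp: hadd_def hsmul_def fun_eq_iff smul_simps)

lemma leftop_LTi: "1 \<le> i \<Longrightarrow> i < CARD('r) \<Longrightarrow> leftop (LTi i :: ('r::{finite,linorder}, 'v::{finite,linorder}) hmod \<Rightarrow> _)"
proof -
  assume "1 \<le> i" "i < CARD('r)"
  then have "leftop (\<lambda>F :: ('r, 'v) hmod. hadd (LT i F) (hsmul (- hecke_par) F))"
    by (intro leftop_add leftop_smul leftop_LT leftop_id)
  then show ?thesis by (simp add: leftop_def LTi_def)
qed

lemma leftop_comp_list: "(\<And>i. i \<in> set ws \<Longrightarrow> leftop (T i)) \<Longrightarrow> leftop (comp_list (map T ws))"
proof (induction ws)
  case (Cons i ws)
  have "leftop (T i)" "leftop (comp_list (map T ws))" using Cons by auto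
  from leftop_comp[OF this] show ?case by (simp add: leftop_def)
qed (simp add: leftop_def)

definition LP :: "('r::{finite,linorder}, 'v::{finite,linorder}) hmod \<Rightarrow> ('r, 'v) hmod"
  where "LP F = hx (eps (coord 1)) (LTw [1..<CARD('r)] F)"

definition LPi :: "('r::{finite,linorder}, 'v::{finite,linorder}) hmod \<Rightarrow> ('r, 'v) hmod"
  where "LPi F = comp_list (map LTi (rev [1..<CARD('r)])) (hx (- eps (coord 1)) F)"

lemma leftop_LP: "leftop (LP :: ('r::{finite,linorder}, 'v::{finite,linorder}) hmod \<Rightarrow> _)"
  and leftop_LPi: "leftop (LPi :: ('r, 'v) hmod \<Rightarrow> _)"
proof -
  have "leftop (LTw [1..<CARD('r)] :: ('r, 'v) hmod \<Rightarrow> _)"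
    by (rule leftop_comp_list) (use leftop_LT in auto)
  from leftop_comp[OF leftop_hx[of "eps (coord 1)"] this]
  show "leftop (LP :: ('r, 'v) hmod \<Rightarrow> _)" by (simp add: leftop_def LP_def)
  have "leftop (comp_list (map LTi (rev [1..<CARD('r)])) :: ('r, 'v) hmod \<Rightarrow> _)"
    by (rule leftop_comp_list) (use leftop_LTi in auto)
  from leftop_comp[OF this leftop_hx[of "- eps (coord 1)"]]
  show "leftop (LPi :: ('r, 'v) hmod \<Rightarrow> _)" by (simp add: leftop_def LPi_def)
qed

lemma LTi_LTw:
  assumes "gen (F :: ('r::{finite,linorder}, 'v::{finite,linorder}) hmod)" "set ws \<subseteq> {1..<CARD('r)}"
  shows "gen (LTw ws F) \<and> comp_list (map LTi (rev ws)) (LTw ws F) = F"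
  using assms(2) by (induction ws) (use assms(1) in \<open>auto simp: gen_LT LTi_LT\<close>)

lemma hx_hx: "hx (- \<beta>) (hx \<beta> F) = F"
  by (simp add: hx_def)

lemma LPi_LP: "gen (F :: ('r::{finite,linorder}, 'v::{finite,linorder}) hmod) \<Longrightarrow> LPi (LP F) = F"
  using LTi_LTw[of F "[1..<CARD('r)]"] by (simp add: LPi_def LP_def hx_hx)

lemma hx_mon: "hx \<beta> (mon \<gamma> u) = mon (\<beta> + \<gamma>) u"
  by (auto simp: hx_def mon_def fun_eq_iff x_pow_add)

text \<open>Agreement at the unit shows that \<open>LP\<close> and \<open>RP\<close> multiply by the
  same element from different sides.\<close>

lemma LP_one: "LP hone = RP hone"
  by (simp add: LP_def LTw_cyc hx_mon del: One_nat_def) (simp add: hone_def RP_mon del: One_nat_def)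

lemma LPi_one: "LPi hone = RPi hone"
proof -
  have "LP (RPi hone) = RPi (LP hone)" using leftop_LP unfolding leftop_def by metis
  also have "\<dots> = hone" unfolding LP_one RPi_RP unfolding hone_def by (rule restr_mon) simp
  finally have "LP (RPi hone) = hone" .
  then show ?thesis using LPi_LP[OF gen_RPi[OF gen_one]] unfolding hone_def by metis
qed

text \<open>For i = 0, left multiplication by the affine generator P T_{r-1} P^{-1}. The factors of
  \<open>Rgen\<close> appear in the opposite order because they act from the right.\<close>

definition Lgen :: "nat \<Rightarrow> ('r::{finite,linorder}, 'v::{finite,linorder}) hmod \<Rightarrow> ('r, 'v) hmod"
  where "Lgen i F = (if i = 0 then LP (LT (CARD('r) - 1) (LPi F)) else LT i F)"

definition Rgen :: "nat \<Rightarrow> ('r::{finite,linorder}, 'v::{finite,linorder}) hmod \<Rightarrow> ('r, 'v) hmod"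
  where "Rgen i F = (if i = 0 then RPi (RT (CARD('r) - 1) (RP F)) else RT i F)"

lemma leftop_Lgen:
  assumes "CARD('r) \<ge> 2" "i < CARD('r)"
  shows "leftop (Lgen i :: ('r::{finite,linorder}, 'v::{finite,linorder}) hmod \<Rightarrow> _)"
proof (cases "i = 0")
  case True
  have "leftop (LT (CARD('r) - 1) :: ('r, 'v) hmod \<Rightarrow> _)"
    by (rule leftop_LT) (use assms in auto)
  from leftop_comp[OF leftop_LP leftop_comp[OF this leftop_LPi]]
  show ?thesis using True by (simp add: leftop_def Lgen_def)
next
  case False
  then show ?thesis using leftop_LT[of i] assms by (simp add: leftop_def Lgen_def)
qed

lemma leftop_Rgen:
  assumes "CARD('r) \<ge> 2" "i < CARD('r)" "leftop (S :: ('r::{finite,linorder}, 'v::{finite,linorder}) hmod \<Rightarrow> _)"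
  shows "S (Rgen i F) = Rgen i (S F)"
  using assms unfolding leftop_def Rgen_def by simp

lemma LT_RT_one:
  assumes "1 \<le> i" "i < CARD('r)"
  shows "LT i hone = RT i (hone :: ('r::{finite,linorder}, 'v::{finite,linorder}) hmod)"
proof -
  have "LT i hone = (mon 0 (s_perm i \<circ> id) :: ('r, 'v) hmod)" unfolding hone_def
    using assms coord_less_Suc[OF assms] by (intro LT_mon0_asc) simp_all
  moreover have "RT i hone = hadd (mon 0 (id \<circ> s_perm i)) (hsmul (kd (rdesc (id :: 'r \<Rightarrow> 'r) i)) (mon 0 id :: ('r, 'v) hmod))"
    unfolding hone_def by (rule RT_mon) simp
  ultimately show ?thesis using coord_less_Suc[OF assms] by (simp add: kd_def hadd_hsmul(7) order_less_not_sym)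
qed

text \<open>For i = 0 the factors next to the unit are replaced by right factors one after another,
  each then passing the left factors that remain.\<close>

lemma Lgen_one:
  assumes "CARD('r) \<ge> 2" "i < CARD('r)"
  shows "Lgen i hone = Rgen i (hone :: ('r::{finite,linorder}, 'v::{finite,linorder}) hmod)"
proof (cases "i = 0")
  case True
  have r1: "1 \<le> CARD('r) - 1" "CARD('r) - 1 < CARD('r)" using assms by auto
  have "LP (LT (CARD('r) - 1) (LPi hone)) = RPi (LP (LT (CARD('r) - 1) (hone :: ('r, 'v) hmod)))"
    unfolding LPi_one LT_RPi[OF r1] using leftop_LP unfolding leftop_def by metis
  also have "\<dots> = RPi (RT (CARD('r) - 1) (LP hone))"
    unfolding LT_RT_one[OF r1] using leftop_LP r1 unfolding leftop_def by metis
  finally show ?thesis using True by (simp add: Lgen_def Rgen_def LP_one)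
next
  case False
  then show ?thesis using LT_RT_one[of i] assms by (simp add: Lgen_def Rgen_def)
qed

text \<open>The direction of the wall crossed is the image of \<alpha>_i, or of -\<theta> for i = 0,
  under the linear part of \<open>w\<close>; the alcove is on the negative side if this image is a
  negative root.\<close>

definition neg_side_alcove :: "'r::{finite,linorder} aff \<Rightarrow> nat \<Rightarrow> bool"
  where "neg_side_alcove w i \<longleftrightarrow> (if i = 0 then snd w (coord 1) < snd w (coord CARD('r)) else snd w (coord (i + 1)) < snd w (coord i))"

definition wmon :: "'r::{finite,linorder} aff \<Rightarrow> ('r, 'v::{finite,linorder}) hmod"
  where "wmon w = mon (fst w) (snd w)"

definition wmult :: "'r::{finite,linorder} aff \<Rightarrow> nat \<Rightarrow> 'r aff"
  where "wmult w i = w \<otimes>\<^bsub>WCox 1\<^esub> s_aff 1 i"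

lemma wmult_eq: "wmult w i = (if i = 0 then (fst w + perm_act (snd w) theta, snd w \<circ> s_theta) else (fst w, snd w \<circ> s_perm i))"
  by (simp add: wmult_def WCox_def s_aff_def case_prod_beta)

text \<open>For i = 0, conjugation by the length-zero element replaces the affine letter by r - 1.
  The element permutes the basis, so the second term is decided by the right descent of
  \<open>?u \<circ> cyc\<close>.\<close>

lemma Rgen_wmon:
  assumes "CARD('r) \<ge> 2" "i < CARD('r)" "bij (snd w)"
  shows "Rgen i (wmon w) = hadd (wmon (wmult w i)) (hsmul (kd (neg_side_alcove w i)) (wmon w :: ('r::{finite,linorder}, 'v::{finite,linorder}) hmod))"
proof (cases "i = 0")
  case False
  then show ?thesis using RT_mon[OF assms(3), of i] by (simp add: Rgen_def wmon_def neg_side_alcove_def wmult_eq)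
next
  case True
  let ?r = "CARD('r)" and ?\<beta> = "fst w" and ?u = "snd w"
  have r1: "1 \<le> ?r - 1" "?r - 1 < ?r" "?r - 1 + 1 = ?r" using assms by auto
  have s: "s_perm (?r - 1) (coord ?r) = (coord (?r - 1) :: 'r)" "s_perm (?r - 1) (coord (?r - 1)) = (coord ?r :: 'r)"
    using s_perm_coord[where 'a='r, of "?r - 1"] r1 by simp_all
  have c: "cyc (coord (?r - 1)) = (coord ?r :: 'r)" using cyc_coord[where 'r='r, of "?r - 1"] r1 by simp
  have b: "bij (?u \<circ> cyc)" "bij (?u \<circ> cyc \<circ> s_perm (?r - 1))"
    using assms(3) by (simp_all del: o_apply add: bij_comp')
  \<comment> \<open>Rotation moves the last two positions to the last and the first one, so it
    conjugates s_{r-1} into s_\<theta>.\<close>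
  have st: "cyc \<circ> s_perm (?r - 1) \<circ> cyc_inv = (s_theta :: 'r \<Rightarrow> 'r)"
  proof -
    have "cyc \<circ> s_perm (?r - 1) = Transposition.transpose (cyc (coord (?r - 1))) (cyc (coord ?r)) \<circ> (cyc :: 'r \<Rightarrow> 'r)"
      using transpose_comp_eq[OF bij_cyc(1), of "cyc (coord (?r - 1)) :: 'r" "cyc (coord ?r)"] r1
      by (simp add: s_perm_def del: cyc_last)
    then have "cyc \<circ> s_perm (?r - 1) \<circ> cyc_inv = Transposition.transpose (coord ?r) (coord 1 :: 'r)"
      unfolding c cyc_last by (simp add: comp_assoc)
    then show ?thesis by (simp add: s_theta_def transpose_commute)
  qed
  have "RP (wmon w) = (mon (?\<beta> + eps (?u (coord 1))) (?u \<circ> cyc) :: ('r, 'v) hmod)"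
    unfolding wmon_def by (rule RP_mon[OF assms(3)])
  then have "RT (?r - 1) (RP (wmon w)) = hadd (mon (?\<beta> + eps (?u (coord 1))) (?u \<circ> cyc \<circ> s_perm (?r - 1)))
     (hsmul (kd (?u (coord 1) < ?u (coord ?r))) (RP (wmon w) :: ('r, 'v) hmod))"
    using RT_mon[OF b(1), of "?r - 1"] r1 c by simp
  then have "Rgen i (wmon w) = hadd (RPi (mon (?\<beta> + eps (?u (coord 1))) (?u \<circ> cyc \<circ> s_perm (?r - 1))))
     (hsmul (kd (?u (coord 1) < ?u (coord ?r))) (RPi (RP (wmon w)) :: ('r, 'v) hmod))"
    using True by (simp add: Rgen_def RPi_lin)
  also have "RPi (RP (wmon w)) = (wmon w :: ('r, 'v) hmod)"
    unfolding RPi_RP wmon_def by (rule restr_mon[OF assms(3)])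
  also have "RPi (mon (?\<beta> + eps (?u (coord 1))) (?u \<circ> cyc \<circ> s_perm (?r - 1))) = (wmon (wmult w i) :: ('r, 'v) hmod)"
  proof -
    have "?\<beta> + eps (?u (coord 1)) - eps ((?u \<circ> cyc \<circ> s_perm (?r - 1)) (coord ?r)) = ?\<beta> + perm_act ?u theta"
      using s c by (simp add: theta_def perm_act_diff perm_act_eps[OF assms(3)] del: One_nat_def)
    moreover have "?u \<circ> cyc \<circ> s_perm (?r - 1) \<circ> cyc_inv = ?u \<circ> s_theta"
      using st by (simp only: comp_assoc)
    ultimately show ?thesis using True by (simp only: RPi_mon[OF b(2)] wmult_eq wmon_def if_True fst_conv snd_conv add_diff_eq[symmetric] simp_thms)
  qed
  finally show ?thesis using True by (simp add: neg_side_alcove_def)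
qed

section \<open>Linearity of the Cherednik operators\<close>

context metaplectic_params begin

lemma lin_T_hinv [simp]: "lin (T_hinv i)"
proof -
  have "lin (\<lambda>f. T_op n sg i f - smul hecke_par f)"
    by (rule lin_intros) (auto intro: lin_intros)
  then show ?thesis by (simp add: lin_def T_hinv_def)
qed

lemma Y_op_eq:
  assumes "i \<le> CARD('r)"
  shows "Y_op n sg i f = comp_list (map T_hinv (rev [1..<i])) (omega (comp_list (map (T_op n sg) (rev [i..<CARD('r)])) (f :: ('r::{finite,linorder}, 'v) laurent)))"
proof -

  have "map (T_inv n sg) (rev [1..<i]) = (map T_hinv (rev [1..<i]) :: (('r, 'v) laurent \<Rightarrow> _) list)"
    by (rule map_cong) (use assms T_inv_eq[where 'r='r] in \<open>auto simp: fun_eq_iff\<close>)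
  then show ?thesis unfolding Y_op_def o_apply by (rule arg_cong)
qed

lemma lin_Y_op: "i \<le> CARD('r) \<Longrightarrow> lin (Y_op n sg i :: ('r::{finite,linorder}, 'v) laurent \<Rightarrow> _)"
proof -
  assume i: "i \<le> CARD('r)"
  have "lin (comp_list (map T_hinv (rev [1..<i])) :: ('r, 'v) laurent \<Rightarrow> _)"
    "lin (comp_list (map (T_op n sg) (rev [i..<CARD('r)])) :: ('r, 'v) laurent \<Rightarrow> _)"
    by (rule lin_comp_list; simp)+
  from lin_comp[OF this(1) lin_comp[OF lin_omega this(2)]] show ?thesis by (simp add: lin_def Y_op_eq[OF i])
qed

section \<open>Intertwiners\<close>

definition pi_op :: "('r::{finite,linorder}, 'v) laurent \<Rightarrow> ('r, 'v) laurent"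
  where "pi_op f = X_mult 1 (comp_list (map (T_op n sg) [1..<CARD('r)]) f)"

definition pi_inv_op :: "('r::{finite,linorder}, 'v) laurent \<Rightarrow> ('r, 'v) laurent"
  where "pi_inv_op f = comp_list (map T_hinv (rev [1..<CARD('r)])) (x_pow (- (int n *s eps (coord 1))) * f)"

lemma T_word_cancel:
  assumes "set ws \<subseteq> {1..<CARD('r)}"
  shows "comp_list (map T_hinv (rev ws)) (comp_list (map (T_op n sg) ws) f) = (f :: ('r::{finite,linorder}, 'v) laurent)"
    "comp_list (map (T_op n sg) ws) (comp_list (map T_hinv (rev ws)) f) = f"
proof -
  show "comp_list (map T_hinv (rev ws)) (comp_list (map (T_op n sg) ws) f) = f" for f :: "('r, 'v) laurent"
    using assms by (induction ws) (auto simp: T_T_hinv)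
  show "comp_list (map (T_op n sg) ws) (comp_list (map T_hinv (rev ws)) f) = f"
    using assms by (induction ws arbitrary: f) (auto simp: T_T_hinv)
qed

lemma pi_op_inv: "pi_op (pi_inv_op f) = f" "pi_inv_op (pi_op f) = f"
  for f :: "('r::{finite,linorder}, 'v) laurent"
proof -
  have s: "set [1..<CARD('r)] \<subseteq> {1..<CARD('r)}" by auto
  show "pi_op (pi_inv_op f) = f" "pi_inv_op (pi_op f) = f"
    unfolding pi_op_def pi_inv_op_def X_mult_def T_word_cancel[OF s]
    by (simp_all add: T_word_cancel[OF s] del: One_nat_def)
qed

lemma lin_pi_op: "lin (pi_op :: ('r::{finite,linorder}, 'v) laurent \<Rightarrow> _)"
proof -
  have "lin (comp_list (map (T_op n sg) [1..<CARD('r)]) :: ('r, 'v) laurent \<Rightarrow> _)"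
    by (rule lin_comp_list) simp
  then show "lin (pi_op :: ('r, 'v) laurent \<Rightarrow> _)" by (auto simp: lin_def pi_op_def X_mult_def distrib_left smul_mult)
qed

text \<open>The abstract relations read for the actual operators. For the last one, injectivity of
  the word for T_{s_\<theta>} is what gives its \<open>inv\<close> in \<open>T_check\<close> a
  meaning.\<close>

lemma Y_op_relations:
  fixes f :: "('r::{finite,linorder}, 'v) laurent"
  assumes r2: "CARD('r) \<ge> 2"
  shows "1 \<le> i \<Longrightarrow> i < CARD('r) \<Longrightarrow> Y_op n sg (i + 1) f = T_hinv i (Y_op n sg i (T_hinv i f))"
    and "1 \<le> j \<Longrightarrow> j \<le> CARD('r) \<Longrightarrow> 1 \<le> i \<Longrightarrow> i < CARD('r) \<Longrightarrow> j \<noteq> i \<Longrightarrow> j \<noteq> i + 1 \<Longrightarrow>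
       T_op n sg i (Y_op n sg j f) = Y_op n sg j (T_op n sg i f)"
    and "1 \<le> i \<Longrightarrow> i < CARD('r) \<Longrightarrow> Y_op n sg (i + 1) (pi_op f) = pi_op (Y_op n sg i f)"
    and "Y_op n sg 1 (pi_op f) = smul (qpar powi (- int n)) (pi_op (Y_op n sg CARD('r) f))"
    and "T_check n sg 0 (pi_op f) = pi_op (T_op n sg (CARD('r) - 1) f)"
proof -
  interpret H: hecke_operators "T_op n sg :: nat \<Rightarrow> ('r, 'v) laurent \<Rightarrow> _" T_hinv omega X_mult 
     "smul (qpar powi (- int n))" X_theta_inv "CARD('r)"
    by (rule hecke_operators_laurent[OF r2])
  have Y: "Y_op n sg i g = H.Y i g" if "i \<le> CARD('r)" for i and g :: "('r, 'v) laurent"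
    unfolding Y_op_eq[OF that] H.Y_def ..
  have P: "pi_op g = H.P g" for g :: "('r, 'v) laurent"
    unfolding pi_op_def H.P_def ..
  show "1 \<le> i \<Longrightarrow> i < CARD('r) \<Longrightarrow> Y_op n sg (i + 1) f = T_hinv i (Y_op n sg i (T_hinv i f))"
    using H.Y_Suc[of i f] Y[of "i+1" f] Y[of i] by simp
  show "1 \<le> j \<Longrightarrow> j \<le> CARD('r) \<Longrightarrow> 1 \<le> i \<Longrightarrow> i < CARD('r) \<Longrightarrow> j \<noteq> i \<Longrightarrow> j \<noteq> i + 1 \<Longrightarrow>
       T_op n sg i (Y_op n sg j f) = Y_op n sg j (T_op n sg i f)"
    using H.T_Y[of j i f] Y[of j] by simp
  show "1 \<le> i \<Longrightarrow> i < CARD('r) \<Longrightarrow> Y_op n sg (i + 1) (pi_op f) = pi_op (Y_op n sg i f)"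
    using H.Y_P[of i f] Y[of "i+1"] Y[of i] P by simp
  show "Y_op n sg 1 (pi_op f) = smul (qpar powi (- int n)) (pi_op (Y_op n sg CARD('r) f))"
    using H.Y1_P[of f] Y[of 1] Y[of "CARD('r)"] P r2 by simp
  let ?W = "[1..<CARD('r)] @ rev [1..<CARD('r)-1]"
  have W: "set ?W \<subseteq> {1..<CARD('r)}" by auto
  have "T_word n sg ?W (pi_op (T_op n sg (CARD('r) - 1) f)) = X_theta_inv (pi_op f)"
    using H.T_theta_P[of f] unfolding P T_word_def by simp
  moreover have "inj (T_word n sg ?W :: ('r, 'v) laurent \<Rightarrow> _)"
    unfolding T_word_def by (rule inj_on_inverseI[of _ "comp_list (map T_hinv (rev ?W))"]) (rule T_word_cancel(1)[OF W])
  ultimately have "inv (T_word n sg ?W) (X_theta_inv (pi_op f)) = pi_op (T_op n sg (CARD('r) - 1) f)"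
    by (metis inv_f_f)
  then show "T_check n sg 0 (pi_op f) = pi_op (T_op n sg (CARD('r) - 1) f)"
    by (simp add: T_check_def X_theta_inv_def del: One_nat_def)
qed

text \<open>Together with \<open>aff_lev\<close> the affine simple roots after division by n and
  n^2, the form expected by \<open>gm\<close>.\<close>

definition aff_dir :: "nat \<Rightarrow> 'r::{finite,linorder} weight"
  where "aff_dir i = (if i = 0 then - theta else simple_root i)"

definition aff_lev :: "nat \<Rightarrow> int"
  where "aff_lev i = (if i = 0 then 1 else 0)"

lemma aff_simple_root_eq: "aff_simple_root n i = (int n *s aff_dir i, (int n)\<^sup>2 * aff_lev i)"
  by (simp add: aff_simple_root_def aff_dir_def aff_lev_def vec_eq_iff)

lemma gamma_neg: "gamma n sg (- (int n *s \<beta>, (int n)\<^sup>2 * d)) \<nu> = inverse (gm \<beta> d \<nu>)"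
proof -
  have "- (int n *s \<beta>, (int n)\<^sup>2 * d) = (int n *s (- \<beta>), (int n)\<^sup>2 * (- d))" by (simp add: vec_eq_iff)
  then show ?thesis using gm_minus[of \<beta> d \<nu>] by (simp add: gm_def)
qed

text \<open>The scalar by which (k^{-1} - k) R_i acts on the eigenvector of \<nu>.\<close>

definition bcoef :: "nat \<Rightarrow> 'r::{finite,linorder} weight \<Rightarrow> 'v pfield"
  where "bcoef i \<nu> = (inverse kpar - kpar) / (1 - gamma n sg (- aff_simple_root n i) \<nu>)"

definition eig :: "'r::{finite,linorder} weight \<Rightarrow> ('r, 'v) laurent \<Rightarrow> bool"
  where "eig \<nu> f \<longleftrightarrow> (\<forall>i\<in>{1..CARD('r)}. Y_op n sg i f = smul (yval (coord i) \<nu>) f)"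

lemma gm_diff_eps: "gm (eps a - eps b) d \<nu> = qpar powi (- d * int n) * yval a \<nu> / yval b \<nu>"
  using gm_add[of "eps a" "- eps b" 0 0 \<nu>] gm_minus[of "eps b" 0 \<nu>] gm_add[of "eps a - eps b" 0 0 d \<nu>]
  by (simp add: yval_def gm_zero divide_inverse)

lemma yval_nz [simp]: "yval a \<nu> \<noteq> 0"
  by (simp add: yval_def)

lemma gamma_simple: "i \<noteq> 0 \<Longrightarrow> gamma n sg (- aff_simple_root n i) \<nu> = yval (coord (i + 1)) \<nu> / yval (coord i) \<nu>"
  unfolding aff_simple_root_eq gamma_neg by (simp add: aff_dir_def aff_lev_def simple_root_def gm_diff_eps)

lemma gamma_zero: "gamma n sg (- aff_simple_root n 0) \<nu> = qpar powi (int n) * yval (coord 1) \<nu> / yval (coord CARD('r)) (\<nu> :: 'r::{finite,linorder} weight)"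
proof -
  have "- theta = (eps (coord CARD('r)) - eps (coord 1) :: 'r weight)" by (simp add: theta_def)
  then show ?thesis unfolding aff_simple_root_eq gamma_neg
    by (simp add: aff_dir_def aff_lev_def gm_diff_eps power_int_minus divide_inverse del: One_nat_def)
qed

text \<open>The exponent of q in \<gamma> is, up to sign, the value of the affine root at \<nu>,
  whereas 1 has exponent 0.\<close>

lemma gamma_neg_ne_1:
  assumes "ip (aff_dir i) \<nu> + aff_lev i * int n \<noteq> 0"
  shows "gamma n sg (- aff_simple_root n i) \<nu> \<noteq> 1"
proof
  assume "gamma n sg (- aff_simple_root n i) \<nu> = 1"
  then have "gm (aff_dir i) (aff_lev i) \<nu> = 1" unfolding aff_simple_root_eq gamma_neg by simp
  from qdeg_unique[OF qdeg_gm[of "aff_dir i" "aff_lev i" \<nu>, unfolded this] qdeg_1] show False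
    using assms by simp
qed

text \<open>Since Y_{i+1} = T_i^{-1} Y_i T_i^{-1}, both Y_i and Y_{i+1} preserve the span of f and
  T_i f; the scalar is what completes T_i f to an eigenvector with the two eigenvalues
  exchanged.\<close>

lemma eig_T_op:
  fixes f :: "('r::{finite,linorder}, 'v) laurent"
  assumes r2: "CARD('r) \<ge> 2" and i: "1 \<le> i" "i < CARD('r)" and ne: "\<nu> $ coord i \<noteq> \<nu> $ coord (i+1)" and f: "eig \<nu> f"
  shows "eig (perm_act (s_perm i) \<nu>) (T_op n sg i f + smul (bcoef i \<nu>) f)"
  unfolding eig_def
proof
  let ?y = "\<lambda>j. yval (coord j) \<nu>" and ?b = "bcoef i \<nu>" and ?T = "T_op n sg i :: ('r, 'v) laurent \<Rightarrow> _"
  define h where "h = (hecke_par :: 'v pfield)"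
  have Yf: "Y_op n sg j f = smul (?y j) f" if "1 \<le> j" "j \<le> CARD('r)" for j using f that by (simp add: eig_def)
  have "ip (aff_dir i) \<nu> + aff_lev i * int n \<noteq> 0"
    using i ne by (simp add: aff_dir_def aff_lev_def simple_root_def ip_diff_left ip_eps_left)
  from gamma_neg_ne_1[OF this] have "?y (i+1) / ?y i \<noteq> 1" using gamma_simple[of i \<nu>] i by simp
  then have "?b * (1 - ?y (i+1) / ?y i) = - h"
    unfolding bcoef_def using gamma_simple[of i \<nu>] i by (simp add: h_def hecke_par_def)
  then have "?b * (1 - ?y (i+1) / ?y i) * ?y i = - h * ?y i" by simp
  \<comment> \<open>The definition of the scalar with denominators cleared, as \<gamma> is the
    quotient of the two eigenvalues.\<close>
  then have b: "?b * (?y i - ?y (i+1)) = - h * ?y i"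
    by (simp add: algebra_simps)
  then have b1: "h * ?y i + ?b * ?y i = ?y (i+1) * ?b" by (simp add: algebra_simps)
  fix j assume "j \<in> {1..CARD('r)}"
  then have j: "1 \<le> j" "j \<le> CARD('r)" by auto
  have yv: "yval (coord j) (perm_act (s_perm i) \<nu>) = yval (s_perm i (coord j)) \<nu>"
    by (rule yval_s_perm[OF i ne])
  have Ti: "T_hinv i g = ?T g - smul h g" for g by (simp add: T_hinv_def h_def)
  have Y2: "Y_op n sg (i+1) (?T f) = smul (?y i) (?T f - smul h f)"
    using Y_op_relations(1)[OF r2 i, of "?T f"] T_T_hinv(2)[OF i, of f] Yf[of i] i
    by (simp add: lin_smul[OF lin_T_hinv] Ti lin_smul[OF lin_T_op] smul_simps mult.commute)
  have TT: "?T (?T f) = f + smul h (?T f)" using T_op_quadratic[OF i, of f] by (simp add: h_def)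
  have Y1: "Y_op n sg i (?T f) = smul (?y (i+1)) (?T f) + smul (h * ?y i) f"
  proof -
    have "Y_op n sg i (?T f) = ?T (Y_op n sg (i+1) (?T (?T f)))"
      using Y_op_relations(1)[OF r2 i, of "?T (?T f)"] T_T_hinv[OF i] by simp
    also have "\<dots> = ?T (smul (?y (i+1)) f + smul h (smul (?y i) (?T f - smul h f)))"
      unfolding TT using lin_Y_op[of "i+1"] i Yf[of "i+1"] Y2 by (simp add: lin_add[OF lin_Y_op] lin_smul[OF lin_Y_op])
    also have "\<dots> = smul (?y (i+1)) (?T f) + smul (h * ?y i) f"
      by (simp add: lin_add[OF lin_T_op] lin_smul[OF lin_T_op] lin_diff[OF lin_T_op] TT smul_simps)
    finally show ?thesis .
  qed
  have linY: "Y_op n sg j (?T f + smul ?b f) = Y_op n sg j (?T f) + smul ?b (Y_op n sg j f)"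
    using j by (simp add: lin_add[OF lin_Y_op] lin_smul[OF lin_Y_op])
  consider "j = i" | "j = i + 1" | "j \<noteq> i" "j \<noteq> i + 1" by blast
  then show "Y_op n sg j (?T f + smul ?b f) = smul (yval (coord j) (perm_act (s_perm i) \<nu>)) (?T f + smul ?b f)"
  proof cases
    case 1
    have "Y_op n sg j (?T f + smul ?b f) = smul (?y (i+1)) (?T f) + smul (h * ?y i + ?b * ?y i) f"
      unfolding linY using Y1 Yf[OF j] 1 by (simp add: smul_simps)
    then show ?thesis unfolding b1 yv using 1 s_perm_coord[OF i] by (simp add: smul_simps)
  next
    case 2
    have e: "?y (i+1) * ?b - ?y i * h = ?y i * ?b" using b1 by (simp add: algebra_simps)
    have "Y_op n sg j (?T f + smul ?b f) = smul (?y i) (?T f) + smul (?y i * ?b) f"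
      unfolding linY e[symmetric] using Y2 Yf[OF j] 2 by (simp add: smul_simps mult.commute)
    then show ?thesis unfolding yv using 2 s_perm_coord[OF i] by (simp add: smul_simps)
  next
    case 3
    have "coord j \<noteq> (coord i :: 'r)" "coord j \<noteq> (coord (i+1) :: 'r)"
      using 3 j i coord_eq_iff[where 'a='r, of j i] coord_eq_iff[where 'a='r, of j "i+1"] by auto
    then have s: "s_perm i (coord j) = (coord j :: 'r)" by (simp add: s_perm_def)
    have "Y_op n sg j (?T f) = ?T (Y_op n sg j f)" using Y_op_relations(2)[OF r2 j i 3] by simp
    then show ?thesis unfolding linY yv s using Yf[OF j]
      by (simp add: lin_smul[OF lin_T_op] smul_simps mult.commute)
  qed
qed

text \<open>\<open>pi_op\<close> is injective and shifts the index of the Y_i cyclically; the factor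
  q^{-n} at the turn is the one by which the eigenvalues change under \<open>pi_act\<close>.\<close>

lemma eig_pi_op:
  fixes f :: "('r::{finite,linorder}, 'v) laurent"
  assumes r2: "CARD('r) \<ge> 2"
  shows "eig (pi_act n \<nu>) (pi_op f) \<longleftrightarrow> eig \<nu> f"
proof -
  have inj: "pi_op g = pi_op g' \<longleftrightarrow> g = g'" for g g' :: "('r, 'v) laurent" by (metis pi_op_inv(2))
  have 1: "Y_op n sg (i + 1) (pi_op f) = smul (yval (coord (i + 1)) (pi_act n \<nu>)) (pi_op f) \<longleftrightarrow> Y_op n sg i f = smul (yval (coord i) \<nu>) f"
    if i: "1 \<le> i" "i < CARD('r)" for i
  proof -
    have "coord i \<noteq> (coord CARD('r) :: 'r)" using i coord_eq_iff[where 'a='r, of i "CARD('r)"] by auto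
    then have "yval (coord (i + 1)) (pi_act n \<nu>) = yval (coord i) \<nu>"
      using yval_pi_act[of "coord i" \<nu>] cyc_coord[where 'r='r, OF i] by simp
    then show ?thesis unfolding Y_op_relations(3)[OF r2 i] by (simp add: inj flip: lin_smul[OF lin_pi_op])
  qed
  have 2: "Y_op n sg 1 (pi_op f) = smul (yval (coord 1) (pi_act n \<nu>)) (pi_op f) \<longleftrightarrow> Y_op n sg CARD('r) f = smul (yval (coord CARD('r)) \<nu>) f"
  proof -
    have y: "yval (coord 1) (pi_act n \<nu>) = qpar powi (- int n) * yval (coord CARD('r)) \<nu>"
      using yval_pi_act[of "coord CARD('r)" \<nu>] by (simp del: One_nat_def)
    have canc: "smul (qpar powi (- int n)) g = smul (qpar powi (- int n)) g' \<longleftrightarrow> g = g'" for g g' :: "('r, 'v) laurent"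
    proof
      assume "smul (qpar powi (- int n)) g = smul (qpar powi (- int n)) g'"
      then have "smul (inverse (qpar powi (- int n))) (smul (qpar powi (- int n)) g) = smul (inverse (qpar powi (- int n))) (smul (qpar powi (- int n)) g')" by simp
      then show "g = g'" by (simp add: smul_simps(3,4))
    qed simp
    have e: "smul (qpar powi (- int n) * yval (coord CARD('r)) \<nu>) (pi_op f) = 
      smul (qpar powi (- int n)) (pi_op (smul (yval (coord CARD('r)) \<nu>) f))"
      by (simp add: lin_smul[OF lin_pi_op] smul_simps(3))
    show ?thesis unfolding Y_op_relations(4)[OF r2] y e by (simp only: canc inj)
  qed
  \<comment> \<open>The eigenvalue conditions are split at the first index here and at the last one
    in \<open>B\<close>, so that the cyclic shift matches them one by one.\<close>
  have A: "(\<forall>i\<in>{1..CARD('r)}. Q i) \<longleftrightarrow> Q 1 \<and> (\<forall>i. 1 \<le> i \<longrightarrow> i < CARD('r) \<longrightarrow> Q (i + 1))" for Q :: "nat \<Rightarrow> bool"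
  proof (intro iffI ballI conjI allI impI)
    fix i assume Q: "Q 1 \<and> (\<forall>i. 1 \<le> i \<longrightarrow> i < CARD('r) \<longrightarrow> Q (i + 1))" and "i \<in> {1..CARD('r)}"
    then show "Q i" by (cases "i = 1") (auto dest!: spec[of _ "i - 1"])
  qed (use r2 in auto)
  have B: "(\<forall>i\<in>{1..CARD('r)}. Q i) \<longleftrightarrow> Q CARD('r) \<and> (\<forall>i. 1 \<le> i \<longrightarrow> i < CARD('r) \<longrightarrow> Q i)" for Q :: "nat \<Rightarrow> bool"
    using r2 by (auto simp: le_less)
  show ?thesis unfolding eig_def A[of "\<lambda>i. Y_op n sg i (pi_op f) = smul (yval (coord i) (pi_act n \<nu>)) (pi_op f)"]
    B[of "\<lambda>i. Y_op n sg i f = smul (yval (coord i) \<nu>) f"] using 1 2 by blast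
qed

lemma refl_act_eq_iff:
  fixes \<nu> :: "'r::{finite,linorder} weight"
  assumes "CARD('r) \<ge> 2" "i < CARD('r)"
  shows "refl_act n i \<nu> = \<nu> \<longleftrightarrow> ip (aff_dir i) \<nu> + aff_lev i * int n = 0"
proof (cases "i = 0")
  case True
  note ne = coord_first_last_ne[OF assms(1)]
  show ?thesis unfolding vec_eq_iff True refl_act_0_nth[OF assms(1)] using ne
    by (auto simp: aff_dir_def aff_lev_def theta_def ip_diff_left ip_minus_left ip_eps_left dest: spec[of _ "coord 1"] simp del: One_nat_def)
next
  case False
  then have i: "1 \<le> i" "i < CARD('r)" using assms by auto
  have "refl_act n i \<nu> = \<nu> \<longleftrightarrow> ip \<nu> (simple_root i) *s simple_root i = (0 :: 'r weight)"
    unfolding refl_act_simps(2)[OF False] perm_act_s_perm_eq[OF i] by simp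
  also have "\<dots> \<longleftrightarrow> ip \<nu> (simple_root i) = 0" using simple_root_nz[OF i] by (auto simp: vec_eq_iff)
  also have "ip \<nu> (simple_root i) = ip (simple_root i) \<nu>" by (simp add: ip_def mult.commute)
  finally show ?thesis using False by (simp add: aff_dir_def aff_lev_def)
qed

lemma eig_step:
  fixes f :: "('r::{finite,linorder}, 'v) laurent"
  assumes r2: "CARD('r) \<ge> 2" and i: "i < CARD('r)" and ne: "refl_act n i \<nu> \<noteq> \<nu>" and f: "eig \<nu> f"
  shows "eig (refl_act n i \<nu>) (T_check n sg i f + smul (bcoef i \<nu>) f)"
proof (cases "i = 0")
  case False
  then have i': "1 \<le> i" "i < CARD('r)" using i by auto
  have "\<nu> $ coord i \<noteq> \<nu> $ coord (i+1)"
    using ne False unfolding refl_act_eq_iff[OF r2 i] 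
    by (simp add: aff_dir_def aff_lev_def simple_root_def ip_diff_left ip_eps_left)
  from eig_T_op[OF r2 i' this f] False show ?thesis by (simp add: refl_act_simps T_check_def)
next
  case True
  let ?k = "CARD('r) - 1" and ?\<kappa> = "pi_inv_act n \<nu>" and ?h = "pi_inv_op f"
  have k: "1 \<le> ?k" "?k < CARD('r)" "?k + 1 = CARD('r)" using r2 by auto
  have h: "eig ?\<kappa> ?h" using f eig_pi_op[OF r2, of ?\<kappa> ?h] by (simp add: pi_op_inv)
  have s: "refl_act n 0 \<nu> = pi_act n (perm_act (s_perm ?k) ?\<kappa>)"
    using refl_act_0_pi_act[OF r2, of n ?\<kappa>] by simp
  have kne: "?\<kappa> $ coord ?k \<noteq> ?\<kappa> $ coord (?k + 1)"
  proof
    assume "?\<kappa> $ coord ?k = ?\<kappa> $ coord (?k + 1)"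
    then have "perm_act (s_perm ?k) ?\<kappa> = ?\<kappa>"
      unfolding perm_act_s_perm_eq[OF k(1,2)] by (simp add: ip_simple_root)
    then show False using ne s True by simp
  qed
  have "coord ?k \<noteq> (coord CARD('r) :: 'r)" using k coord_eq_iff[where 'a='r, of ?k "CARD('r)"] by auto
  then have y1: "yval (coord CARD('r)) \<nu> = yval (coord ?k) ?\<kappa>"
    using yval_pi_act[of "coord ?k" ?\<kappa>] cyc_coord[where 'r='r, OF k(1,2)] k(3) by simp
  have y2: "yval (coord 1) \<nu> = qpar powi (- int n) * yval (coord CARD('r)) ?\<kappa>"
    using yval_pi_act[of "coord CARD('r)" ?\<kappa>] by (simp del: One_nat_def)
  \<comment> \<open>The factor q^n in \<gamma> for i = 0 cancels the q^{-n} that the rotated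
    eigenvalue acquires.\<close>
  have b: "bcoef 0 \<nu> = bcoef ?k ?\<kappa>"
    unfolding bcoef_def gamma_zero y1 y2 using gamma_simple[of ?k ?\<kappa>] k by (simp add: power_int_minus)
  have "eig (refl_act n 0 \<nu>) (pi_op (T_op n sg ?k ?h + smul (bcoef ?k ?\<kappa>) ?h))"
    unfolding s eig_pi_op[OF r2] by (rule eig_T_op[OF r2 k(1,2) kne h])
  also have "pi_op (T_op n sg ?k ?h + smul (bcoef ?k ?\<kappa>) ?h) = T_check n sg 0 f + smul (bcoef 0 \<nu>) f"
    using Y_op_relations(5)[OF r2, of ?h] by (simp add: lin_add[OF lin_pi_op] lin_smul[OF lin_pi_op] pi_op_inv b)
  finally show ?thesis using True by simp
qed

section \<open>Monomials of the closed alcove as eigenvectors\<close>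

lemma ev_LTw:
  assumes "lam \<in> fund_alcove_weights n" "set ws \<subseteq> {1..<CARD('r)}"
  shows "ev lam (LTw ws F) = comp_list (map (T_op n sg) ws) (ev (lam :: 'r::{finite,linorder} weight) F)"
  using assms(2) by (induction ws) (auto simp: ev_LT[OF assms(1)])

lemma ev_hone: "ev lam hone = x_pow lam"
  unfolding hone_def by (simp add: ev_mon smul_simps)

lemma ev_LP: "lam \<in> fund_alcove_weights n \<Longrightarrow> ev lam (LP F) = pi_op (ev (lam :: 'r::{finite,linorder} weight) F)"
  unfolding LP_def ev_hx pi_op_def X_mult_def using ev_LTw[of lam "[1..<CARD('r)]" F] by simp

lemma ev_LPi: "lam \<in> fund_alcove_weights n \<Longrightarrow> ev lam (LPi F) = pi_inv_op (ev (lam :: 'r::{finite,linorder} weight) F)"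
proof -
  assume lam: "lam \<in> fund_alcove_weights n"
  have "ev lam (comp_list (map LTi ws) G) = comp_list (map T_hinv ws) (ev lam G)" if "set ws \<subseteq> {1..<CARD('r)}" for ws G
    using that by (induction ws) (auto simp: LTi_def ev_add ev_smul ev_LT[OF lam] T_hinv_def smul_simps)
  moreover have "int n *s (- eps (coord 1)) = - (int n *s eps (coord 1) :: 'r weight)" by (simp add: vec_eq_iff)
  ultimately show ?thesis unfolding LPi_def pi_inv_op_def by (simp add: ev_hx del: One_nat_def)
qed

lemma ev_Lgen:
  fixes lam :: "'r::{finite,linorder} weight"
  assumes "CARD('r) \<ge> 2" "i < CARD('r)" "lam \<in> fund_alcove_weights n"
  shows "ev lam (Lgen i F) = T_check n sg i (ev lam F)"
proof (cases "i = 0")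
  case True
  have k: "1 \<le> CARD('r) - 1" "CARD('r) - 1 < CARD('r)" using assms by auto
  have "ev lam (Lgen i F) = pi_op (T_op n sg (CARD('r) - 1) (pi_inv_op (ev lam F)))"
    using True by (simp add: Lgen_def ev_LP[OF assms(3)] ev_LT[OF assms(3) k] ev_LPi[OF assms(3)] del: One_nat_def)
  also have "\<dots> = T_check n sg 0 (pi_op (pi_inv_op (ev lam F)))" using Y_op_relations(5)[OF assms(1)] by simp
  finally show ?thesis using True by (simp add: pi_op_inv)
next
  case False
  then show ?thesis using ev_LT[OF assms(3), of i F] assms by (simp add: Lgen_def T_check_def)
qed

text \<open>The inverse of \<open>pi_act\<close> permutes the walls: the bound by n becomes the last
  order condition, and the first order condition becomes the bound.\<close>

lemma pi_inv_act_fund: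
  fixes lam :: "'r::{finite,linorder} weight"
  assumes r2: "CARD('r) \<ge> 2" and lam: "lam \<in> fund_alcove_weights n"
  shows "pi_inv_act n lam \<in> fund_alcove_weights n"
proof -
  have v: "pi_inv_act n lam $ coord i = lam $ coord (i+1)" if "1 \<le> i" "i < CARD('r)" for i
  proof -
    have "coord (i+1) \<noteq> (coord 1 :: 'r)" using that coord_eq_iff[where 'a='r, of "i+1" 1] by simp
    then show ?thesis using cyc_coord[where 'r='r, OF that] by (simp add: pi_inv_act_nth del: One_nat_def)
  qed
  have l: "pi_inv_act n lam $ coord CARD('r) = lam $ coord 1 - int n" by (simp add: pi_inv_act_nth del: One_nat_def)
  have "pi_inv_act n lam $ coord (i+1) \<le> pi_inv_act n lam $ coord i" if i: "i \<in> {1..<CARD('r)}" for i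
  proof (cases "i + 1 = CARD('r)")
      case True
      have "lam $ coord 1 - int n \<le> lam $ coord CARD('r)" using lam by (simp add: fund_alcove_weights_def)
      then show ?thesis using v[of i] i l True by simp
    next
      case False
      then show ?thesis using v[of i] v[of "i+1"] i lam by (auto simp: fund_alcove_weights_def)
  qed
  moreover have "pi_inv_act n lam $ coord 1 - pi_inv_act n lam $ coord CARD('r) \<le> int n"
  proof -
    have "lam $ coord (1 + 1) \<le> lam $ coord 1" using lam r2 by (simp add: fund_alcove_weights_def)
    then show ?thesis using v[of 1] l r2 by simp
  qed
  ultimately show ?thesis by (simp add: fund_alcove_weights_def)
qed

text \<open>For Y_1 the word T_{r-1} ... T_1 produces a single monomial, which \<open>omega\<close>
  rotates back. The other Y_i follow by moving the alcove along \<open>pi_inv_act\<close>, which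
  lowers the index.\<close>

lemma eig_x_pow:
  fixes lam :: "'r::{finite,linorder} weight"
  assumes r2: "CARD('r) \<ge> 2" and lam: "lam \<in> fund_alcove_weights n"
  shows "eig lam (x_pow lam)"
proof -
  have first: "Y_op n sg 1 (x_pow lam) = smul (yval (coord 1) lam) (x_pow lam)"
    if lam: "lam \<in> fund_alcove_weights n" for lam :: "'r weight"
  proof -
    have s: "set (rev [1..<CARD('r)]) \<subseteq> {1..<CARD('r)}" by auto
    have c1: "coord_index (coord 1 :: 'r) = 1" using r2 by (intro coord_index_coord) auto
    \<comment> \<open>The inversions of the inverse rotation are the pairs starting at the first
      position, so the coefficient is the product of \<sigma>-factors in the first
      eigenvalue.\<close>
    have Inv: "Inv (cyc_inv :: 'r \<Rightarrow> 'r) = (\<lambda>b. (coord 1, b)) ` (UNIV - {coord 1})"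
    proof -
      have "a < b \<and> cyc_inv b < cyc_inv a \<longleftrightarrow> a = coord 1 \<and> b \<noteq> coord 1" for a b :: 'r
      proof -
        have e: "x = coord 1 \<longleftrightarrow> coord_index x = 1" for x :: 'r using c1 by (metis coord_coord_index)
        have "1 \<le> coord_index a" "coord_index a \<le> CARD('r)" "1 \<le> coord_index b" "coord_index b \<le> CARD('r)" by simp_all
        then show ?thesis unfolding e coord_index_less_iff coord_index_cyc_inv
          by (cases "coord_index a = 1"; cases "coord_index b = 1"; simp del: coord_index_bounds; linarith)
      qed
      then show ?thesis by (auto simp: Inv_def simp del: One_nat_def)
    qed
    have lt: "coord 1 < b" if "b \<noteq> coord 1" for b :: 'r
      using that c1 coord_index_bounds(1)[of b] unfolding coord_index_less_iff
      by (metis One_nat_def coord_coord_index le_less)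
    have coef: "inv_coeff lam cyc_inv = (\<Prod>b\<in>UNIV - {coord 1}. pair_factor (coord 1) b lam)"
      unfolding inv_coeff_def Inv by (subst prod.reindex) (auto simp: inj_on_def pair_factor_def lt simp del: One_nat_def intro!: prod.cong)
    have "Y_op n sg 1 (x_pow lam) = omega (comp_list (map (T_op n sg) (rev [1..<CARD('r)])) (ev lam hone))"
      using Y_op_eq[of 1 "x_pow lam"] r2 by (simp add: ev_hone)
    also have "\<dots> = omega (ev lam (mon 0 cyc_inv))"
      unfolding ev_LTw[OF lam s, symmetric] LTw_cyc_inv ..
    also have "\<dots> = smul (inv_coeff lam cyc_inv) (smul (qpar powi (- (lam $ coord 1))) (x_pow (perm_act cyc (perm_act cyc_inv lam))))"
      by (simp add: ev_mon lin_smul[OF lin_omega] omega_x_pow del: One_nat_def)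
    also have "perm_act cyc (perm_act cyc_inv lam) = lam" by (simp flip: perm_act_comp)
    finally show ?thesis unfolding coef yval_eq by (simp add: smul_simps mult.commute)
  qed
  have "\<forall>lam\<in>fund_alcove_weights n. Y_op n sg i (x_pow lam) = smul (yval (coord i) lam) (x_pow lam :: ('r, 'v) laurent)"
    if "1 \<le> i" "i \<le> CARD('r)" for i
    using that
  proof (induction i rule: nat_induct_at_least)
    case base
    show ?case using first by blast
  next
    case (Suc i)
    have i: "1 \<le> i" "i < CARD('r)" using Suc by auto
    show ?case
    proof
      fix lam :: "'r weight" assume lam: "lam \<in> fund_alcove_weights n"
      let ?k = "pi_inv_act n lam"
      have k: "?k \<in> fund_alcove_weights n" by (rule pi_inv_act_fund[OF r2 lam])
      define c where "c = inv_coeff ?k cyc"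
      have "pi_op (x_pow ?k) = ev ?k (LP hone)" unfolding ev_LP[OF k] ev_hone ..
      also have "\<dots> = smul c (x_pow (int n *s eps (coord 1) + perm_act cyc ?k))"
        unfolding LP_def LTw_cyc ev_hx by (simp add: ev_mon c_def x_pow_add smul_mult del: One_nat_def)
      also have "int n *s eps (coord 1) + perm_act cyc ?k = lam" using pi_act_inv[of n lam] unfolding pi_act_def .
      finally have P: "x_pow lam = smul (inverse c) (pi_op (x_pow ?k) :: ('r, 'v) laurent)"
        by (simp add: smul_simps c_def)
      have "coord i \<noteq> (coord CARD('r) :: 'r)" using i coord_eq_iff[where 'a='r, of i "CARD('r)"] by auto
      then have y: "yval (coord (i + 1)) lam = yval (coord i) ?k"
        using yval_pi_act[of "coord i" ?k] cyc_coord[where 'r='r, OF i] by simp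
      have IH: "Y_op n sg i (x_pow ?k) = smul (yval (coord i) ?k) (x_pow ?k :: ('r, 'v) laurent)" using Suc k by simp
      have "Y_op n sg (i + 1) (x_pow lam :: ('r, 'v) laurent) = smul (inverse c) (pi_op (Y_op n sg i (x_pow ?k)))"
        unfolding P using i by (simp add: lin_smul[OF lin_Y_op] Y_op_relations(3)[OF r2 i, simplified])
      also have "\<dots> = smul (yval (coord (i + 1)) lam) (x_pow lam)"
        unfolding IH y by (subst P) (simp add: lin_smul[OF lin_pi_op] smul_simps mult.commute)
      finally show "Y_op n sg (Suc i) (x_pow lam) = smul (yval (coord (Suc i)) lam) (x_pow lam :: ('r, 'v) laurent)" by simp
    qed
  qed
  then show ?thesis using lam by (simp add: eig_def)
qed

section \<open>Products of intertwiners along a word\<close>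

primrec tau_prod :: "'r::{finite,linorder} weight \<Rightarrow> nat list \<Rightarrow> ('r, 'v) laurent" where
  "tau_prod lam [] = x_pow lam"
| "tau_prod lam (i # ws) = T_check n sg i (tau_prod lam ws) + smul (bcoef i (word_act n ws lam)) (tau_prod lam ws)"

text \<open>No letter meets the weight on its own wall, as required by the eigenvector step and by
  the equivariance of the spectrum.\<close>

primrec regular_word :: "'r::{finite,linorder} weight \<Rightarrow> nat list \<Rightarrow> bool" where
  "regular_word lam [] = True"
| "regular_word lam (i # ws) \<longleftrightarrow> refl_act n i (word_act n ws lam) \<noteq> word_act n ws lam \<and> regular_word lam ws"

lemma eig_tau_prod:
  fixes lam :: "'r::{finite,linorder} weight"
  assumes "CARD('r) \<ge> 2" "lam \<in> fund_alcove_weights n" "set ws \<subseteq> {0..<CARD('r)}" "regular_word lam ws"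
  shows "eig (word_act n ws lam) (tau_prod lam ws)"
  using assms(3,4) by (induction ws) (auto simp: eig_x_pow assms(1,2) intro: eig_step[OF assms(1)])

text \<open>The factors T_i + b are multiplied from the right, beginning with the first letter,
  while \<open>left_prod\<close> applies the last letter first. Each scalar belongs to the weight
  reached by the letters after it, so it is the same in both.\<close>

primrec right_prod :: "'r::{finite,linorder} weight \<Rightarrow> nat list \<Rightarrow> ('r, 'v) hmod \<Rightarrow> ('r, 'v) hmod" where
  "right_prod lam [] F = F"
| "right_prod lam (i # ws) F = right_prod lam ws (hadd (Rgen i F) (hsmul (bcoef i (word_act n ws lam)) F))"

primrec left_prod :: "'r::{finite,linorder} weight \<Rightarrow> nat list \<Rightarrow> ('r, 'v) hmod" where
  "left_prod lam [] = hone"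
| "left_prod lam (i # ws) = hadd (Lgen i (left_prod lam ws)) (hsmul (bcoef i (word_act n ws lam)) (left_prod lam ws))"

lemma right_prod_leftop:
  fixes lam :: "'r::{finite,linorder} weight"
  assumes "CARD('r) \<ge> 2" "leftop S" "set ws \<subseteq> {0..<CARD('r)}"
  shows "S (right_prod lam ws F) = right_prod lam ws (S F)"
  using assms(3)
proof (induction ws arbitrary: F)
  case (Cons i ws)
  have "S (hadd G (hsmul c H)) = hadd (S G) (hsmul c (S H))" for G H c using assms(2) unfolding leftop_def by metis
  moreover have "S (Rgen i F) = Rgen i (S F)" using Cons.prems by (intro leftop_Rgen[OF assms(1) _ assms(2)]) auto
  ultimately show ?case using Cons by simp
qed simp

text \<open>Associativity: the outermost left factor passes all right factors, reaches the unit and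
  turns into the innermost right factor there.\<close>

lemma left_prod_eq_right_prod:
  fixes lam :: "'r::{finite,linorder} weight"
  assumes r2: "CARD('r) \<ge> 2" "set ws \<subseteq> {0..<CARD('r)}"
  shows "left_prod lam ws = right_prod lam ws hone"
  using assms(2)
proof (induction ws)
  case (Cons i ws)
  let ?c = "bcoef i (word_act n ws lam)"
  have i: "i < CARD('r)" and ws: "set ws \<subseteq> {0..<CARD('r)}" using Cons.prems by auto
  have lo: "leftop (\<lambda>F :: ('r, 'v) hmod. hadd (Lgen i F) (hsmul ?c F))"
    by (rule leftop_add[OF leftop_Lgen[OF r2(1) i] leftop_smul[OF leftop_id]])
  have "left_prod lam (i # ws) = right_prod lam ws (hadd (Lgen i hone) (hsmul ?c hone))"
    using right_prod_leftop[OF r2(1) lo ws, of lam hone] Cons.IH[OF ws] by simp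
  then show ?case using Lgen_one[OF r2(1) i, where 'v='v] by simp
qed simp

text \<open>T_u is a left operator as well, so it passes to the unit and becomes the element on
  which the right factors act.\<close>

lemma T_word_tau_prod:
  fixes lam :: "'r::{finite,linorder} weight"
  assumes r2: "CARD('r) \<ge> 2" and ws: "set ws \<subseteq> {0..<CARD('r)}" and lam: "lam \<in> fund_alcove_weights n"
    and us: "perm_reduced us u"
  shows "T_word n sg us (tau_prod lam ws) = ev lam (right_prod lam ws (mon 0 u))"
proof -
  have "tau_prod lam ws = ev lam (left_prod lam ws)"
    using ws by (induction ws) (auto simp: ev_hone ev_add ev_smul ev_Lgen[OF r2 _ lam])
  also have "\<dots> = ev lam (right_prod lam ws hone)" using left_prod_eq_right_prod[OF r2 ws] by simp
  finally have 1: "tau_prod lam ws = ev lam (right_prod lam ws hone)" .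
  note su = perm_reducedD(1)[OF us]
  have lo: "leftop (LTw us :: ('r, 'v) hmod \<Rightarrow> _)" by (rule leftop_comp_list, rule leftop_LT) (use su in auto)
  show ?thesis unfolding 1 T_word_def ev_LTw[OF lam su, symmetric] right_prod_leftop[OF r2 lo ws] LTw_reduced[OF us] ..
qed

lemma right_prod_lin: "right_prod lam ws (hadd F G) = hadd (right_prod lam ws F) (right_prod lam ws G)"
  "right_prod lam ws (hsmul c F) = hsmul c (right_prod lam ws F)"
proof -
  have R: "Rgen i (hadd F G) = hadd (Rgen i F) (Rgen i G)" "Rgen i (hsmul c F) = hsmul c (Rgen i F)" for i F G c
    by (simp_all add: Rgen_def RT_lin RP_lin RPi_lin)
  show "right_prod lam ws (hadd F G) = hadd (right_prod lam ws F) (right_prod lam ws G)"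
  proof (induction ws arbitrary: F G)
    case (Cons i ws)
    let ?c = "bcoef i (word_act n ws lam)"
    have "hadd (Rgen i (hadd F G)) (hsmul ?c (hadd F G)) = hadd (hadd (Rgen i F) (hsmul ?c F)) (hadd (Rgen i G) (hsmul ?c G))"
      by (simp only: R hadd_hsmul)
    then show ?case by (simp only: right_prod.simps Cons.IH)
  qed simp
  show "right_prod lam ws (hsmul c F) = hsmul c (right_prod lam ws F)"
  proof (induction ws arbitrary: F)
    case (Cons i ws)
    let ?c = "bcoef i (word_act n ws lam)"
    have "hadd (Rgen i (hsmul c F)) (hsmul ?c (hsmul c F)) = hsmul c (hadd (Rgen i F) (hsmul ?c F))"
      by (simp only: R hadd_hsmul mult.commute)
    then show ?case by (simp only: right_prod.simps Cons.IH)
  qed simp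
qed

end

section \<open>Alcove walks\<close>

lemma fund_alcove_bounds:
  fixes x :: "(real, 'r::{finite,linorder}) vec"
  assumes "x \<in> fund_alcove" "a < b"
  shows "x $ b < x $ a" "x $ a - x $ b < 1"
proof -
  have dec: "x $ coord j \<le> x $ coord i" if "i \<le> j" "1 \<le> i" "j \<le> CARD('r)" for i j
    using that
  proof (induction j rule: dec_induct)
    case (step m)
    then have "x $ coord (m + 1) < x $ coord m" using assms(1) by (simp add: fund_alcove_def)
    with step show ?case by simp
  qed simp
  have ia: "1 \<le> coord_index a" "coord_index a + 1 \<le> coord_index b" "coord_index b \<le> CARD('r)"
    using assms(2) by (simp_all add: coord_index_less_iff Suc_leI)
  have "x $ b \<le> x $ coord (coord_index a + 1)" using dec[of "coord_index a + 1" "coord_index b"] ia by simp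
  also have "\<dots> < x $ coord (coord_index a)"
  proof -
    have "coord_index a \<in> {1..<CARD('r)}" using ia by (simp del: coord_index_bounds)
    then show ?thesis using assms(1) unfolding fund_alcove_def by blast
  qed
  finally show "x $ b < x $ a" by simp
  have "x $ a \<le> x $ coord 1" using dec[of 1 "coord_index a"] ia by simp
  moreover have "x $ coord CARD('r) \<le> x $ b" using dec[of "coord_index b" "CARD('r)"] ia by simp
  ultimately show "x $ a - x $ b < 1" using assms(1) by (simp add: fund_alcove_def)
qed

lemma fund_alcove_nonempty: "\<exists>x. x \<in> (fund_alcove :: (real, 'r::{finite,linorder}) vec set)"
proof
  \<comment> \<open>Equally spaced coordinates -i/r: neighbours differ by 1/r, the extremes by (r -
    1)/r.\<close>
  let ?x = "(\<chi> a. - real (coord_index a) / real CARD('r)) :: (real, 'r) vec"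
  have c: "CARD('r) \<ge> 1" by (simp add: Suc_leI)
  have "?x $ coord 1 - ?x $ coord CARD('r) = (real CARD('r) - 1) / real CARD('r)"
    using c coord_index_coord[where 'a='r, of 1] coord_index_coord[where 'a='r, of "CARD('r)"]
    by (simp add: diff_divide_distrib del: One_nat_def)
  also have "\<dots> < 1" by simp
  finally show "?x \<in> fund_alcove"
    by (auto simp: fund_alcove_def divide_strict_right_mono)
qed

lemma ip_root: "ip (eps c - eps d) (v :: (real, 'r::finite) vec) = v $ c - v $ d"
proof -
  have "ip (eps c - eps d) v = ip (eps c) v - ip (eps d) v"
    by (simp add: ip_def left_diff_distrib sum_subtractf del: eps_nth)
  then show ?thesis by (simp add: ip_eps_left)
qed

text \<open>The reflections of level 1 on real points. Crossing a wall of an alcove means reflecting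
  before the group element is applied, as \<open>aff_act_wmult\<close> shows.\<close>

definition refl_real :: "nat \<Rightarrow> (real, 'r) vec \<Rightarrow> (real, 'r::{finite,linorder}) vec"
  where "refl_real i x = (if i = 0 then (\<chi> a. of_int ((theta :: 'r weight) $ a) + x $ s_theta a) else perm_act (s_perm i) x)"

lemma aff_act_real_nth: "aff_act w x $ a = of_int (fst w $ a) + x $ inv (snd w) a"
  by (simp add: aff_act_def)

lemma aff_act_wmult:
  assumes "bij (snd w)"
  shows "aff_act (wmult w i) x $ a = of_int (fst w $ a) + refl_real i x $ inv (snd w) a"
  using assms by (auto simp: aff_act_real_nth wmult_eq refl_real_def o_inv_distrib)

text \<open>Both numbers lie in the same open interval between consecutive integers, so no integer
  level separates them.\<close>

lemma no_integer_between:
  fixes D E :: real and K :: int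
  assumes "0 < D \<and> D < 1 \<and> 0 < E \<and> E < 1 \<or> -1 < D \<and> D < 0 \<and> -1 < E \<and> E < 0"
    "D + of_int K > 0" "E + of_int K < 0"
  shows False
  using assms(1)
proof
  assume h: "0 < D \<and> D < 1 \<and> 0 < E \<and> E < 1"
  then have "real_of_int K > -1" using assms by linarith
  then have "K \<ge> 0" by linarith
  then show False using h assms by linarith
next
  assume h: "-1 < D \<and> D < 0 \<and> -1 < E \<and> E < 0"
  then have "real_of_int K > 0" using assms by linarith
  then have "K \<ge> 1" by linarith
  then show False using h assms by linarith
qed

lemma refl_real_0_nth:
  assumes "CARD('r) \<ge> 2"
  shows "refl_real 0 x $ a = (if a = coord 1 then x $ coord CARD('r) + 1 else 
     if a = coord CARD('r) then x $ coord 1 - 1 else (x :: (real, 'r::{finite,linorder}) vec) $ a)"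
  using coord_first_last_ne[OF assms]
  by (auto simp: refl_real_def theta_nth[OF assms] s_theta_def Transposition.transpose_def)

lemma first_less: "a \<noteq> coord 1 \<Longrightarrow> coord 1 < (a :: 'r::{finite,linorder})"
  and less_last: "a \<noteq> coord CARD('r) \<Longrightarrow> a < (coord CARD('r) :: 'r::{finite,linorder})"
proof -
  have c: "coord_index (coord 1 :: 'r) = 1" "coord_index (coord CARD('r) :: 'r) = CARD('r)"
    by (rule coord_index_coord; simp add: Suc_leI)+
  show "a \<noteq> coord 1 \<Longrightarrow> coord 1 < a" 
    unfolding coord_index_less_iff c coord_index_inj[of a, symmetric] using coord_index_bounds(1)[of a] by linarith
  show "a \<noteq> coord CARD('r) \<Longrightarrow> a < coord CARD('r)" 
    unfolding coord_index_less_iff c coord_index_inj[of a, symmetric] using coord_index_bounds(3)[of a] by linarith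
qed

text \<open>A simple reflection permutes the positive affine roots other than its own, so all other
  root values stay between the same integers.\<close>

lemma refl_real_same_interval:
  fixes x :: "(real, 'r::{finite,linorder}) vec"
  assumes r2: "CARD('r) \<ge> 2" and i: "i < CARD('r)" and x: "x \<in> fund_alcove" and ne: "c \<noteq> d"
    and nw: "{c, d} \<noteq> (if i = 0 then {coord 1, coord CARD('r)} else {coord i, coord (i + 1)})"
  defines "D \<equiv> x $ c - x $ d" and "E \<equiv> refl_real i x $ c - refl_real i x $ d"
  shows "0 < D \<and> D < 1 \<and> 0 < E \<and> E < 1 \<or> -1 < D \<and> D < 0 \<and> -1 < E \<and> E < 0"
proof -
  note bd = fund_alcove_bounds[OF x]
  show ?thesis
  proof (cases "i = 0")
    case False
    then have i': "1 \<le> i" "i < CARD('r)" using i by auto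
    have E: "E = x $ s_perm i c - x $ s_perm i d" using False by (simp add: E_def refl_real_def)
    have "s_perm i c < s_perm i d \<longleftrightarrow> c < d" by (rule s_perm_less_iff[OF i' ne]) (use nw False in simp)
    then consider "c < d" "s_perm i c < s_perm i d" | "d < c" "s_perm i d < s_perm i c"
      using ne by (metis linorder_neqE s_perm_eq_iff)
    then show ?thesis
      by cases (use bd[of c d] bd[of "s_perm i c" "s_perm i d"] bd[of d c] bd[of "s_perm i d" "s_perm i c"] in \<open>auto simp: D_def E\<close>)
  next
    case True
    let ?f = "coord 1 :: 'r" and ?l = "coord CARD('r) :: 'r"
    have sym: "0 < x $ p - x $ q \<and> x $ p - x $ q < 1 \<and> 0 < refl_real 0 x $ p - refl_real 0 x $ q \<and> refl_real 0 x $ p - refl_real 0 x $ q < 1"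
      if pq: "p < q" and npq: "\<not> (p = ?f \<and> q = ?l)" for p q
    proof -
      have q1: "q \<noteq> ?f" using pq first_less[of p] by (metis order_less_asym order_less_irrefl)
      have p1: "p \<noteq> ?l" using pq less_last[of q] by (metis order_less_asym order_less_irrefl)
      consider "p = ?f" "q \<noteq> ?l" | "p \<noteq> ?f" "q = ?l" | "p \<noteq> ?f" "q \<noteq> ?l" using npq by blast
      then show ?thesis
        unfolding refl_real_0_nth[OF r2]
        by cases (use q1 p1 bd[OF pq] bd[of q ?l] less_last[of q] bd[of ?f p] first_less[of p] in \<open>auto simp del: One_nat_def\<close>)
    qed
    from ne consider "c < d" | "d < c" by force
    then show ?thesis
    proof cases
      case 1
      then have "\<not> (c = ?f \<and> d = ?l)" using nw True by auto
      from sym[OF 1 this] show ?thesis by (simp add: D_def E_def True)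
    next
      case 2
      then have "\<not> (d = ?f \<and> c = ?l)" using nw True by auto
      from sym[OF 2 this] show ?thesis by (simp add: D_def E_def True)
    qed
  qed
qed

text \<open>One direction exhibits the wall as a separating hyperplane. In the other, an arbitrary
  separating hyperplane is forced to be parallel to the wall of the letter.\<close>

lemma starts_pos_iff:
  fixes w :: "'r::{finite,linorder} aff"
  assumes r2: "CARD('r) \<ge> 2" and i: "i < CARD('r)" and u: "bij (snd w)"
  shows "starts_pos w i \<longleftrightarrow> \<not> neg_side_alcove w i"
proof -
  let ?u = "snd w" and ?\<beta> = "fst w"
  have fl: "coord 1 < (coord CARD('r) :: 'r)" using coord_first_last_ne[OF r2] by (intro first_less) simp
  have mem: "aff_act w x \<in> pos_side (eps c - eps d) s \<longleftrightarrow> x $ inv ?u c - x $ inv ?u d + of_int (?\<beta> $ c - ?\<beta> $ d + s) > 0"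
    "aff_act w x \<in> neg_side (eps c - eps d) s \<longleftrightarrow> x $ inv ?u c - x $ inv ?u d + of_int (?\<beta> $ c - ?\<beta> $ d + s) < 0"
    "aff_act (wmult w i) x \<in> neg_side (eps c - eps d) s \<longleftrightarrow> refl_real i x $ inv ?u c - refl_real i x $ inv ?u d + of_int (?\<beta> $ c - ?\<beta> $ d + s) < 0"
    for x :: "(real, 'r) vec" and c d s
    unfolding pos_side_def neg_side_def mem_Collect_eq ip_root aff_act_wmult[OF u] unfolding aff_act_real_nth
    by (simp_all add: algebra_simps)
  show ?thesis
  proof
    assume "\<not> neg_side_alcove w i"
    \<comment> \<open>With the level K below, the wall of the letter is given by x_a - x_b + K = 0
      and the fundamental alcove lies where this is positive; for i = 0 it is the far wall x_r - x_1
      + 1 = 0.\<close>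
    define a b where "a = (if i = 0 then coord CARD('r) else coord i :: 'r)" and "b = (if i = 0 then coord 1 else coord (i + 1) :: 'r)"
    define K where "K = (if i = 0 then 1 else 0 :: int)"
    have ab: "a \<noteq> b" using coord_first_last_ne[OF r2] coord_less_Suc[where 'r='r, of i] i by (auto simp: a_def b_def)
    then have "?u a \<noteq> ?u b" using u by (metis inv_f_f_bij(1))
    then have lt: "?u a < ?u b" using \<open>\<not> neg_side_alcove w i\<close> by (auto simp: neg_side_alcove_def a_def b_def split: if_splits)
    let ?\<alpha> = "eps (?u a) - eps (?u b) :: 'r weight" and ?s = "K - (?\<beta> $ ?u a - ?\<beta> $ ?u b)"
    have iu: "inv ?u (?u a) = a" "inv ?u (?u b) = b" using u by (simp_all add: inv_f_f_bij)
    have pos: "alcove w \<subseteq> pos_side ?\<alpha> ?s"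
    proof
      fix y assume "y \<in> alcove w"
      then obtain x :: "(real, 'r) vec" where x: "x \<in> fund_alcove" and y: "y = aff_act w x" unfolding alcove_def by blast
      have "x $ b < x $ a + real_of_int K"
      proof (cases "i = 0")
        case True
        then show ?thesis using fund_alcove_bounds[OF x fl] unfolding a_def b_def K_def by simp
      next
        case False
        then have "coord i < (coord (i + 1) :: 'r)" using i by (intro coord_less_Suc) auto
        from fund_alcove_bounds[OF x this] False show ?thesis unfolding a_def b_def K_def by simp
      qed
      then show "y \<in> pos_side ?\<alpha> ?s" unfolding y mem iu by simp
    qed
    have neg: "alcove (wmult w i) \<subseteq> neg_side ?\<alpha> ?s"
    proof
      fix y assume "y \<in> alcove (wmult w i)"
      then obtain x :: "(real, 'r) vec" where x: "x \<in> fund_alcove" and y: "y = aff_act (wmult w i) x" unfolding alcove_def by blast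
      have "refl_real i x $ a + real_of_int K < refl_real i x $ b"
      proof (cases "i = 0")
        case True
        then show ?thesis using fund_alcove_bounds[OF x fl] coord_first_last_ne[OF r2]
          unfolding a_def b_def K_def True refl_real_0_nth[OF r2] by simp
      next
        case False
        then have i': "1 \<le> i" by simp
        show ?thesis using fund_alcove_bounds[OF x coord_less_Suc[OF i' i]] s_perm_coord[OF i' i] False
          by (simp add: a_def b_def K_def refl_real_def)
      qed
      then show "y \<in> neg_side ?\<alpha> ?s" unfolding y mem iu by simp
    qed
    have "?\<alpha> \<in> pos_roots" using lt by (auto simp: pos_roots_def)
    then show "starts_pos w i" unfolding starts_pos_def separates_def wmult_def[symmetric] using pos neg by blast
  next
    assume "starts_pos w i"
    then obtain c d s where cd: "c < d" and sep: "separates (eps c - eps d) s (alcove w) (alcove (wmult w i))"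
      and pos: "alcove w \<subseteq> pos_side (eps c - eps d) s"
      unfolding starts_pos_def pos_roots_def wmult_def by blast
    obtain x :: "(real, 'r) vec" where x: "x \<in> fund_alcove" using fund_alcove_nonempty by blast
    let ?c = "inv ?u c" and ?d = "inv ?u d" and ?K = "?\<beta> $ c - ?\<beta> $ d + s"
    have p: "x $ ?c - x $ ?d + of_int ?K > 0" using pos x unfolding alcove_def mem(1)[symmetric] by blast
    have "\<not> alcove w \<subseteq> neg_side (eps c - eps d) s"
    proof
      assume "alcove w \<subseteq> neg_side (eps c - eps d) s"
      then have "x $ ?c - x $ ?d + of_int ?K < 0" using x unfolding alcove_def mem(2)[symmetric] by blast
      then show False using p by simp
    qed
    then have "alcove (wmult w i) \<subseteq> neg_side (eps c - eps d) s" using sep by (auto simp: separates_def)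
    then have n: "refl_real i x $ ?c - refl_real i x $ ?d + of_int ?K < 0" using x unfolding alcove_def mem(3)[symmetric] by blast
    have ne: "?c \<noteq> ?d" using cd u by (metis inv_f_f_bij(2) order_less_irrefl)
    \<comment> \<open>Every other root takes values in a common unit interval at the point and at
      its reflection, so it cannot separate them.\<close>
    have w: "{?c, ?d} = (if i = 0 then {coord 1, coord CARD('r)} else {coord i, coord (i + 1)})"
      using refl_real_same_interval[OF r2 i x ne] no_integer_between[OF _ p n] by blast
    have uc: "?u ?c = c" "?u ?d = d" using u by (simp_all add: inv_f_f_bij)
    show "\<not> neg_side_alcove w i"
    proof
      assume neg: "neg_side_alcove w i"
      show False
      proof (cases "i = 0")
        case True
        then have "?c = coord 1 \<and> ?d = coord CARD('r) \<or> ?c = coord CARD('r) \<and> ?d = coord 1"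
          using w by (auto simp: doubleton_eq_iff)
        moreover have "?u (coord 1) < ?u (coord CARD('r))" using neg True by (simp add: neg_side_alcove_def)
        ultimately have cd': "?c = coord 1" "?d = coord CARD('r)" using uc cd by auto
        have "0 < x $ coord 1 - x $ coord CARD('r)" "x $ coord 1 - x $ coord CARD('r) < 1"
          using fund_alcove_bounds[OF x fl] by auto
        \<comment> \<open>Reflection moves the difference beyond 1 without changing its sign, while
          the point itself forces the level to be at least 0; the reflected value can then not be
          negative.\<close>
        moreover have "refl_real i x $ ?c - refl_real i x $ ?d = 2 - (x $ coord 1 - x $ coord CARD('r))"
          unfolding cd' True refl_real_0_nth[OF r2] using coord_first_last_ne[OF r2] by simp
        moreover have "real_of_int ?K > -1" using p calculation unfolding cd' by linarith
        then have "?K \<ge> 0" by linarith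
        then have "real_of_int ?K \<ge> 0" by linarith
        ultimately show False using n by linarith
      next
        case False
        then have i': "1 \<le> i" using i by simp
        have "?c = coord i \<and> ?d = coord (i+1) \<or> ?c = coord (i+1) \<and> ?d = coord i"
          using w False by (auto simp: doubleton_eq_iff)
        moreover have "?u (coord (i+1)) < ?u (coord i)" using neg False by (simp add: neg_side_alcove_def)
        ultimately have cd': "?c = coord (i+1)" "?d = coord i" using uc cd by auto
        have "x $ coord (i+1) < x $ coord i" using fund_alcove_bounds[OF x coord_less_Suc[OF i' i]] by simp
        moreover have "refl_real i x $ ?c = x $ coord i" "refl_real i x $ ?d = x $ coord (i+1)"
          using False s_perm_coord[OF i' i] unfolding cd' by (simp_all add: refl_real_def)
        ultimately show False using n p unfolding cd' by linarith
      qed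
    qed
  qed
qed

lemma alcove_walks_Nil: "alcove_walks w [] = {[w]}"
  by (auto simp: alcove_walks_def length_Suc_conv)

lemma alcove_walks_length: "p \<in> alcove_walks w ws \<Longrightarrow> length p = length ws + 1"
  and alcove_walks_hd: "p \<in> alcove_walks w ws \<Longrightarrow> p ! 0 = w"
  by (auto simp: alcove_walks_def)

lemma interval_Suc: "{1..Suc m} = insert 1 (Suc ` {1..m})"
  by auto

lemma ball_Suc_interval: "(\<forall>j\<in>{1..Suc m}. Q j) \<longleftrightarrow> Q 1 \<and> (\<forall>j\<in>{1..m}. Q (Suc j))"
  unfolding interval_Suc by blast

lemma alcove_walks_Cons:
  "alcove_walks w (i # ws) = (\<lambda>p. w # p) ` (alcove_walks w ws \<union> alcove_walks (wmult w i) ws)"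
proof -
  have "p \<in> alcove_walks w (i # ws) \<longleftrightarrow> (\<exists>p'. p = w # p' \<and> p' \<in> alcove_walks w ws \<union> alcove_walks (wmult w i) ws)" for p
  proof (cases p)
    case Nil
    then show ?thesis by (simp add: alcove_walks_def)
  next
    case (Cons v p')
    have "(\<forall>j\<in>{1..length (i # ws)}. (v # p') ! j \<in> {(v # p') ! (j - 1), wmult ((v # p') ! (j - 1)) ((i # ws) ! (j - 1))})
      \<longleftrightarrow> p' ! 0 \<in> {v, wmult v i} \<and> (\<forall>j\<in>{1..length ws}. p' ! j \<in> {p' ! (j - 1), wmult (p' ! (j - 1)) (ws ! (j - 1))})"
      unfolding length_Cons ball_Suc_interval by (auto simp: nth_Cons')
    then show ?thesis unfolding Cons alcove_walks_def wmult_def[symmetric] by auto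
  qed
  then show ?thesis by auto
qed

text \<open>Crossing a wall changes the permutation part. Hence equality of consecutive entries
  really detects a fold, and walks that fold first are disjoint from walks that cross first.\<close>

lemma wmult_ne: "bij (snd w) \<Longrightarrow> CARD('r) \<ge> 2 \<Longrightarrow> i < CARD('r) \<Longrightarrow> wmult w i \<noteq> (w :: 'r::{finite,linorder} aff)"
proof
  assume u: "bij (snd w)" and r2: "CARD('r) \<ge> 2" and i: "i < CARD('r)" and e: "wmult w i = w"
  have 1: "\<exists>a b. a \<noteq> b \<and> snd (wmult w i) a = snd w b"
  proof (cases "i = 0")
    case True
    then show ?thesis using coord_first_last_ne[OF r2]
      by (intro exI[of _ "coord 1"] exI[of _ "coord CARD('r)"]) (simp add: wmult_eq s_theta_def)
  next
    case False
    then show ?thesis using coord_less_Suc[where 'r='r, of i] i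
      by (intro exI[of _ "coord i"] exI[of _ "coord (i+1)"]) (simp add: wmult_eq s_perm_def)
  qed
  then show False unfolding e using u by (metis inv_f_f_bij(1))
qed

lemma bij_snd_wmult: "bij (snd w) \<Longrightarrow> bij (snd (wmult w i))"
proof -
  assume u: "bij (snd w)"
  have "bij (snd w \<circ> s_theta)" "bij (snd w \<circ> s_perm i)" by (rule bij_comp'[OF u], simp)+
  then show ?thesis by (simp add: wmult_eq del: o_apply)
qed

lemma finite_alcove_walks: "finite (alcove_walks w ws)"
  by (induction ws arbitrary: w) (simp_all add: alcove_walks_Nil alcove_walks_Cons)

lemma bij_last_walk: "p \<in> alcove_walks w ws \<Longrightarrow> bij (snd w) \<Longrightarrow> bij (snd (last p))"
proof (induction ws arbitrary: w p)
  case Nil then show ?case by (simp add: alcove_walks_Nil)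
next
  case (Cons i ws)
  then obtain p' where p': "p = w # p'" "p' \<in> alcove_walks w ws \<or> p' \<in> alcove_walks (wmult w i) ws"
    unfolding alcove_walks_Cons by blast
  then have "p' \<noteq> []" using alcove_walks_length by fastforce
  then have "last p = last p'" using p' by simp
  then show ?case using p'(2) Cons.IH Cons.prems(2) bij_snd_wmult[OF Cons.prems(2)] by metis
qed

text \<open>The predicate \<open>Q\<close> serves positive and negative folds alike. Steps are
  counted from 1, so the first step contributes 1 and all later ones are shifted by
  \<open>Suc\<close>.\<close>

lemma folds_sets_Cons:
  assumes "length p = length ws + 1"
  shows "{j\<in>{1..length (i # ws)}. (w # p) ! j = (w # p) ! (j - 1) \<and> Q ((w # p) ! (j - 1)) ((i # ws) ! (j - 1))}
    = (if p ! 0 = w \<and> Q w i then {1} else {}) \<union> Suc ` {j\<in>{1..length ws}. p ! j = p ! (j - 1) \<and> Q (p ! (j - 1)) (ws ! (j - 1))}"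
proof -
  have "{1..length (i # ws)} = insert 1 (Suc ` {1..length ws})"
    unfolding length_Cons by (rule interval_Suc)
  moreover have "(w # p) ! Suc j = (w # p) ! (Suc j - 1) \<and> Q ((w # p) ! (Suc j - 1)) ((i # ws) ! (Suc j - 1)) \<longleftrightarrow>
     p ! j = p ! (j - 1) \<and> Q (p ! (j - 1)) (ws ! (j - 1))" if "j \<in> {1..length ws}" for j
    using that by (auto simp: nth_Cons')
  moreover have "{j\<in>insert 1 (Suc ` A). R j} = (if R 1 then {1} else {}) \<union> Suc ` {j\<in>A. R (Suc j)}" for A and R :: "nat \<Rightarrow> bool"
    by auto
  moreover have "((w # p) ! 1 = (w # p) ! (1 - 1) \<and> Q ((w # p) ! (1 - 1)) ((i # ws) ! (1 - 1))) \<longleftrightarrow> p ! 0 = w \<and> Q w i"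
    by simp
  ultimately show ?thesis by (simp only: conj_assoc cong: conj_cong)
qed

lemma pos_folds_eq: "pos_folds ws p = {j\<in>{1..length ws}. p ! j = p ! (j - 1) \<and> starts_pos (p ! (j - 1)) (ws ! (j - 1))}"
  and neg_folds_eq: "neg_folds ws p = {j\<in>{1..length ws}. p ! j = p ! (j - 1) \<and> \<not> starts_pos (p ! (j - 1)) (ws ! (j - 1))}"
  by (auto simp: pos_folds_def neg_folds_def folds_def)

lemma prod_interval_Suc: "prod g {1..Suc m} = g 1 * (\<Prod>j\<in>{1..m}. g (Suc j))"
proof -
  have "1 \<notin> Suc ` {1..m}" by auto
  then have "prod g (insert 1 (Suc ` {1..m})) = g 1 * prod g (Suc ` {1..m})" by (intro prod.insert) simp_all
  then show ?thesis unfolding interval_Suc by (subst (asm) prod.reindex) simp_all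
qed

lemma prod_Suc_image_insert:
  fixes g :: "nat \<Rightarrow> 'a::comm_monoid_mult"
  assumes "S \<subseteq> {1..m}"
  shows "prod g ((if b then {1} else {}) \<union> Suc ` S) = (if b then g 1 else 1) * (\<Prod>j\<in>S. g (Suc j))"
proof -
  have f: "finite S" using assms finite_subset by blast
  have "1 \<notin> Suc ` S" using assms by auto
  then show ?thesis using f by (auto simp: prod.reindex)
qed

text \<open>The root of a step depends only on its letter and the later ones, so a new first letter
  merely shifts the numbering.\<close>

lemma beta_Cons: "1 \<le> j \<Longrightarrow> beta n (i # ws) (Suc j) = beta n ws j"
  "beta n (i # ws) 1 = fold (lin_act n) ws (aff_simple_root n i)"
  by (simp_all add: beta_def nth_Cons')

section \<open>Equivariance of the spectrum and the weights of folds\<close>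

context metaplectic_params begin

text \<open>Derived from the finite case by conjugation with the length-zero map; the powers of q
  record the positions that pass the turn.\<close>

lemma yval_refl_act_0:
  fixes \<nu> :: "'r::{finite,linorder} weight"
  assumes r2: "CARD('r) \<ge> 2" and ne: "refl_act n 0 \<nu> \<noteq> \<nu>"
  shows "yval a (refl_act n 0 \<nu>) = qpar powi (- int n * theta $ a) * yval (s_theta a) \<nu>"
proof -
  let ?k = "CARD('r) - 1" and ?\<kappa> = "pi_inv_act n \<nu>" and ?r = "coord CARD('r) :: 'r"
  have k: "1 \<le> ?k" "?k < CARD('r)" "?k + 1 = CARD('r)" using r2 by auto
  have s: "refl_act n 0 \<nu> = pi_act n (perm_act (s_perm ?k) ?\<kappa>)"
    using refl_act_0_pi_act[OF r2, of n ?\<kappa>] by simp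
  have kne: "?\<kappa> $ coord ?k \<noteq> ?\<kappa> $ coord (?k + 1)"
  proof
    assume "?\<kappa> $ coord ?k = ?\<kappa> $ coord (?k + 1)"
    then have "perm_act (s_perm ?k) ?\<kappa> = ?\<kappa>"
      unfolding perm_act_s_perm_eq[OF k(1,2)] by (simp add: ip_simple_root)
    then show False using ne s by simp
  qed
  note fl = coord_first_last_ne[OF r2]
  define c where "c = cyc_inv a"
  have a: "a = cyc c" by (simp add: c_def)
  have kr: "coord ?k \<noteq> ?r" using k coord_eq_iff[where 'a='r, of ?k "CARD('r)"] by auto
  have sk: "s_perm ?k ?r = coord ?k" "s_perm ?k (coord ?k) = ?r" using s_perm_coord[where 'a='r, OF k(1,2)] k(3) by simp_all
  have ck: "cyc (coord ?k) = ?r" using cyc_coord[where 'r='r, OF k(1,2)] k(3) by simp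
  have st: "s_theta (cyc c) = cyc (s_perm ?k c)"
  proof -
    consider "c = ?r" | "c = coord ?k" | "c \<noteq> ?r" "c \<noteq> coord ?k" by blast
    then show ?thesis
    proof cases
      case 3
      then have "cyc c \<noteq> coord 1" "cyc c \<noteq> ?r" using cyc_eq_first ck by (metis, metis cyc_cyc_inv(2))
      moreover have "s_perm ?k c = c" using 3 k(3) by (simp add: s_perm_def)
      ultimately show ?thesis by (simp add: s_theta_def)
    qed (use sk ck in \<open>simp_all add: s_theta_def del: One_nat_def\<close>)
  qed
  have 1: "yval a (refl_act n 0 \<nu>) = (if c = ?r then qpar powi (- int n) else 1) * yval (s_perm ?k c) ?\<kappa>"
    unfolding s a yval_pi_act yval_s_perm[OF k(1,2) kne] ..
  have 2: "yval (s_theta a) \<nu> = (if s_perm ?k c = ?r then qpar powi (- int n) else 1) * yval (s_perm ?k c) ?\<kappa>"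
    using yval_pi_act[of "s_perm ?k c" ?\<kappa>] unfolding a st by simp
  have 3: "(theta :: 'r weight) $ a = (if c = ?r then 1 else if c = coord ?k then - 1 else 0)"
  proof -
    have "a = coord 1 \<longleftrightarrow> c = ?r" "a = ?r \<longleftrightarrow> c = coord ?k" unfolding a using cyc_eq_first ck by (metis, metis cyc_cyc_inv(2))
    then show ?thesis unfolding theta_nth[OF r2] by simp
  qed
  have 4: "s_perm ?k c = ?r \<longleftrightarrow> c = coord ?k" using sk by (metis s_perm_invol)
  show ?thesis unfolding 1 2 3 4 using kr by (auto simp: power_int_minus)
qed

text \<open>The linear action after division by n and n^2, matching the arguments of
  \<open>gm\<close>.\<close>

definition lact :: "nat \<Rightarrow> 'r::{finite,linorder} weight \<times> int \<Rightarrow> 'r weight \<times> int"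
  where "lact i m = (if i = 0 then (perm_act s_theta (fst m), snd m + ip (fst m) theta) else (perm_act (s_perm i) (fst m), snd m))"

lemma lin_act_lact: "lin_act n i (int n *s fst m, (int n)\<^sup>2 * snd m) = (int n *s fst (lact i m), (int n)\<^sup>2 * snd (lact i m))"
  by (simp add: lin_act_def lact_def perm_act_scale ip_scale power2_eq_square algebra_simps)

lemma gm_lact_eps:
  fixes \<nu> :: "'r::{finite,linorder} weight"
  assumes r2: "CARD('r) \<ge> 2" and i: "i < CARD('r)" and ne: "refl_act n i \<nu> \<noteq> \<nu>"
  shows "gm (fst (lact i (eps a, 0))) (snd (lact i (eps a, 0))) (refl_act n i \<nu>) = gm (eps a) 0 \<nu>"
proof (cases "i = 0")
  case False
  then have i': "1 \<le> i" "i < CARD('r)" using i by auto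
  have "\<nu> $ coord i \<noteq> \<nu> $ coord (i+1)"
    using ne False unfolding refl_act_eq_iff[OF r2 i] 
    by (simp add: aff_dir_def aff_lev_def simple_root_def ip_diff_left ip_eps_left)
  from yval_s_perm[OF i' this, of "s_perm i a"] False show ?thesis
    by (simp add: lact_def refl_act_simps perm_act_eps yval_def)
next
  case True
  have th: "(theta :: 'r weight) $ s_theta a = - theta $ a"
    using coord_first_last_ne[OF r2] by (auto simp: theta_nth[OF r2] s_theta_def Transposition.transpose_def)
  have "gm (eps (s_theta a)) (theta $ a) (refl_act n 0 \<nu>) = gm (eps (s_theta a)) 0 (refl_act n 0 \<nu>) * gm 0 (theta $ a) (refl_act n 0 \<nu>)"
    using gm_add[of "eps (s_theta a)" 0 0 "theta $ a" "refl_act n 0 \<nu>"] by simp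
  also have "\<dots> = yval a \<nu>"
    unfolding yval_def[symmetric] yval_refl_act_0[OF r2 ne[unfolded True]] gm_zero th
    by (simp add: power_int_minus mult.commute)
  finally show ?thesis using True by (simp add: lact_def perm_act_eps ip_eps_left yval_def)
qed

text \<open>Multiplicativity in the first argument reduces invariance under simultaneous reflection
  to the vectors \<open>eps a\<close>, that is, to the transformation of eigenvalues off the
  wall.\<close>

lemma gm_lact:
  fixes \<nu> :: "'r::{finite,linorder} weight"
  assumes r2: "CARD('r) \<ge> 2" and i: "i < CARD('r)" and ne: "refl_act n i \<nu> \<noteq> \<nu>"
  shows "gm (fst (lact i (\<beta>, d))) (snd (lact i (\<beta>, d))) (refl_act n i \<nu>) = gm \<beta> d \<nu>"
proof (induction \<beta> rule: weight_pm_induct)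
  case zero
  show ?case by (simp add: lact_def gm_zero)
next
  have l: "lact i (\<beta> + \<gamma>, d + 0) = (fst (lact i (\<beta>, d)) + fst (lact i (\<gamma>, 0)), snd (lact i (\<beta>, d)) + snd (lact i (\<gamma>, 0)))" for \<beta> \<gamma> :: "'r weight" and d
    by (simp add: lact_def perm_act_add ip_add_left)
  case (add \<beta> a)
  show ?case using l[of \<beta> "eps a" d] gm_add[of \<beta> "eps a" d 0 \<nu>] add gm_lact_eps[OF assms, of a] by (simp add: gm_add)
next
  have l: "lact i (\<beta> - \<gamma>, d) = (fst (lact i (\<beta>, d)) + - fst (lact i (\<gamma>, 0)), snd (lact i (\<beta>, d)) + - snd (lact i (\<gamma>, 0)))" for \<beta> \<gamma> :: "'r weight" and d
    by (simp add: lact_def perm_act_diff ip_diff_left)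
  case (sub \<beta> a)
  have "gm (\<beta> - eps a) d \<nu> = gm \<beta> d \<nu> * inverse (gm (eps a) 0 \<nu>)"
    using gm_add[of \<beta> "- eps a" d 0 \<nu>] gm_minus[of "eps a" 0 \<nu>] by simp
  then show ?case unfolding l fst_conv snd_conv gm_add gm_minus gm_lact_eps[OF assms] sub by simp
qed

lemma gm_fold_lact:
  fixes lam :: "'r::{finite,linorder} weight"
  assumes r2: "CARD('r) \<ge> 2" and "set ws \<subseteq> {0..<CARD('r)}" "regular_word lam ws"
  shows "gm (fst (fold lact ws m)) (snd (fold lact ws m)) lam = gm (fst m) (snd m) (word_act n ws lam)"
  using assms(2,3)
proof (induction ws arbitrary: m)
  case (Cons i ws)
  let ?\<nu> = "word_act n ws lam"
  have i: "i < CARD('r)" and ne: "refl_act n i ?\<nu> \<noteq> ?\<nu>" using Cons.prems by auto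
  have ne': "refl_act n i (refl_act n i ?\<nu>) \<noteq> refl_act n i ?\<nu>" using ne refl_act_invol[OF r2] by metis
  show ?case using Cons.IH[of "lact i m"] Cons.prems gm_lact[OF r2 i ne', of "fst m" "snd m"] refl_act_invol[OF r2, of n i ?\<nu>] by simp
qed simp

text \<open>The reflections in the definition of \<beta>_j are moved to the weight: the factor of a
  fold, expressed at the fixed \<lambda>, is the scalar of the intertwiner at the intermediate
  weight.\<close>

lemma gamma_beta:
  fixes lam :: "'r::{finite,linorder} weight"
  assumes r2: "CARD('r) \<ge> 2" and "set ws \<subseteq> {0..<CARD('r)}" "regular_word lam ws"
  shows "gamma n sg (- beta n (i # ws) 1) lam = gamma n sg (- aff_simple_root n i) (word_act n ws lam)"
proof -
  have "fold (lin_act n) ws (int n *s fst m, (int n)\<^sup>2 * snd m) = (int n *s fst (fold lact ws m), (int n)\<^sup>2 * snd (fold lact ws m))" for m :: "'r weight \<times> int"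
    by (induction ws arbitrary: m) (simp_all add: lin_act_lact)
  from this[of "(aff_dir i, aff_lev i)"]
  have b: "beta n (i # ws) 1 = (int n *s fst (fold lact ws (aff_dir i :: 'r weight, aff_lev i)),
     (int n)\<^sup>2 * snd (fold lact ws (aff_dir i :: 'r weight, aff_lev i)))"
    unfolding beta_Cons aff_simple_root_eq by simp
  show ?thesis unfolding b aff_simple_root_eq gamma_neg gm_fold_lact[OF assms] by simp
qed

text \<open>The part of \<open>walk_coeff\<close> that arises from folds; the remaining
  \<sigma>-factors are produced by \<open>ev\<close> at the endpoint.\<close>

definition fold_coeff :: "'r::{finite,linorder} weight \<Rightarrow> nat list \<Rightarrow> 'r aff list \<Rightarrow> 'v pfield"
  where "fold_coeff lam ws p = 
    (\<Prod>j\<in>pos_folds ws p. (inverse kpar - kpar) / (1 - gamma n sg (- beta n ws j) lam)) *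
    (\<Prod>j\<in>neg_folds ws p. (inverse kpar - kpar) * gamma n sg (- beta n ws j) lam / (1 - gamma n sg (- beta n ws j) lam))"

lemma fold_coeff_Cons:
  fixes lam :: "'r::{finite,linorder} weight"
  assumes r2: "CARD('r) \<ge> 2" and ws: "set ws \<subseteq> {0..<CARD('r)}" "regular_word lam ws" and len: "length p = length ws + 1"
  defines "\<nu> \<equiv> word_act n ws lam"
  shows "fold_coeff lam (i # ws) (w # p) = (if p ! 0 = w then if starts_pos w i then bcoef i \<nu>
      else bcoef i \<nu> * gamma n sg (- aff_simple_root n i) \<nu> else 1) * fold_coeff lam ws p"
proof -
  let ?P = "{j\<in>{1..length ws}. p ! j = p ! (j - 1) \<and> starts_pos (p ! (j - 1)) (ws ! (j - 1))}"
  let ?N = "{j\<in>{1..length ws}. p ! j = p ! (j - 1) \<and> \<not> starts_pos (p ! (j - 1)) (ws ! (j - 1))}"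
  have P: "?P \<subseteq> {1..length ws}" and N: "?N \<subseteq> {1..length ws}" by auto
  have b: "beta n (i # ws) (Suc j) = (beta n ws j :: 'r weight \<times> int)" if "j \<in> ?P \<or> j \<in> ?N" for j using that by (intro beta_Cons(1)) auto
  let ?G = "\<lambda>ws j. gamma n sg (- beta n ws j) lam" and ?k = "inverse kpar - kpar :: 'v pfield"
  have "(\<Prod>j\<in>?P. ?k / (1 - ?G (i # ws) (Suc j))) = (\<Prod>j\<in>?P. ?k / (1 - ?G ws j))"
    by (rule prod.cong) (simp_all add: b)
  moreover have "(\<Prod>j\<in>?N. ?k * ?G (i # ws) (Suc j) / (1 - ?G (i # ws) (Suc j))) = (\<Prod>j\<in>?N. ?k * ?G ws j / (1 - ?G ws j))"
    by (rule prod.cong) (simp_all add: b)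
  moreover have "?k / (1 - ?G (i # ws) 1) = bcoef i \<nu>" "?k * ?G (i # ws) 1 / (1 - ?G (i # ws) 1) = bcoef i \<nu> * gamma n sg (- aff_simple_root n i) \<nu>"
    unfolding gamma_beta[OF r2 ws] \<nu>_def[symmetric] by (simp_all add: bcoef_def)
  ultimately show ?thesis
    unfolding fold_coeff_def pos_folds_eq neg_folds_eq folds_sets_Cons[OF len, of i w "starts_pos"] 
      folds_sets_Cons[OF len, of i w "\<lambda>w i. \<not> starts_pos w i"] prod_Suc_image_insert[OF P] prod_Suc_image_insert[OF N]
    by (cases "p ! 0 = w"; cases "starts_pos w i") (simp_all only: simp_thms if_True if_False mult_1 ac_simps)
qed

text \<open>A factor T_i + b sends a basis element to its neighbour plus a multiple of itself. The
  neighbour accounts for walks that cross, the multiple for walks that fold.\<close>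

lemma ev_right_prod_walks:
  fixes lam :: "'r::{finite,linorder} weight"
  assumes r2: "CARD('r) \<ge> 2" and "set ws \<subseteq> {0..<CARD('r)}" "regular_word lam ws" "bij (snd w)"
  shows "ev lam (right_prod lam ws (wmon w)) = (\<Sum>p\<in>alcove_walks w ws. smul (fold_coeff lam ws p) (ev lam (wmon (last p))))"
  using assms(2-4)
proof (induction ws arbitrary: w)
  case Nil
  then show ?case by (simp add: alcove_walks_Nil fold_coeff_def pos_folds_eq neg_folds_eq smul_simps)
next
  case (Cons i ws)
  let ?\<nu> = "word_act n ws lam" and ?w' = "wmult w i"
  define b where "b = bcoef i ?\<nu>"
  define g where "g = gamma n sg (- aff_simple_root n i) ?\<nu>"
  have i: "i < CARD('r)" and ws: "set ws \<subseteq> {0..<CARD('r)}" "regular_word lam ws" and ne: "refl_act n i ?\<nu> \<noteq> ?\<nu>"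
    using Cons.prems by auto
  have w': "bij (snd ?w')" by (rule bij_snd_wmult[OF Cons.prems(3)])
  have "g \<noteq> 1" unfolding g_def using ne refl_act_eq_iff[OF r2 i] by (intro gamma_neg_ne_1) auto
  \<comment> \<open>From b(1 - g) = k^{-1} - k. Thus the coefficient on the negative side, b plus
    the second term of the Hecke relation, is the factor of a negative fold.\<close>
  then have bg: "b * g = b + hecke_par"
    unfolding b_def bcoef_def g_def[symmetric] hecke_par_def by (simp add: field_simps)
  have c: "b + kd (neg_side_alcove w i) = (if starts_pos w i then b else b * g)"
    using starts_pos_iff[OF r2 i Cons.prems(3)] bg by (simp add: kd_def)
  have ww: "?w' \<noteq> w" by (rule wmult_ne[OF Cons.prems(3) r2 i])
  have l: "last (w # p) = last p" if "p \<in> alcove_walks v ws" for v p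
    using alcove_walks_length[OF that] by auto
  have f1: "fold_coeff lam (i # ws) (w # p) = (if starts_pos w i then b else b * g) * fold_coeff lam ws p" if "p \<in> alcove_walks w ws" for p
    using fold_coeff_Cons[OF r2 ws alcove_walks_length[OF that], of i w] alcove_walks_hd[OF that] by (simp add: b_def g_def)
  have f2: "fold_coeff lam (i # ws) (w # p) = fold_coeff lam ws p" if "p \<in> alcove_walks ?w' ws" for p
    using fold_coeff_Cons[OF r2 ws alcove_walks_length[OF that], of i w] alcove_walks_hd[OF that] ww by simp
  have inj: "inj_on (\<lambda>p. w # p) A" for A by (simp add: inj_on_def)
  have dj: "alcove_walks w ws \<inter> alcove_walks ?w' ws = {}"
    by (rule equals0I) (metis IntE alcove_walks_hd ww)
  have "ev lam (right_prod lam (i # ws) (wmon w)) = 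
     ev lam (right_prod lam ws (hadd (wmon ?w') (hsmul (b + kd (neg_side_alcove w i)) (wmon w))))"
  proof -
    have "hadd (Rgen i (wmon w)) (hsmul b (wmon w)) = hadd (wmon ?w') (hsmul (b + kd (neg_side_alcove w i)) (wmon w :: ('r, 'v) hmod))"
      unfolding Rgen_wmon[OF r2 i Cons.prems(3)] by (auto simp: hadd_def hsmul_def smul_simps fun_eq_iff)
    then show ?thesis by (simp add: b_def)
  qed
  also have "\<dots> = ev lam (right_prod lam ws (wmon ?w')) + smul (b + kd (neg_side_alcove w i)) (ev lam (right_prod lam ws (wmon w)))"
    by (simp add: right_prod_lin ev_add ev_smul)
  also have "\<dots> = (\<Sum>p\<in>alcove_walks ?w' ws. smul (fold_coeff lam (i # ws) (w # p)) (ev lam (wmon (last (w # p)))))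
     + (\<Sum>p\<in>alcove_walks w ws. smul (fold_coeff lam (i # ws) (w # p)) (ev lam (wmon (last (w # p)))))"
    unfolding Cons.IH[OF ws w'] Cons.IH[OF ws Cons.prems(3)] smul_sum c
    by (intro arg_cong2[where f="(+)"] sum.cong) (simp_all add: f1 f2 l smul_simps del: last.simps)
  also have "\<dots> = (\<Sum>p\<in>alcove_walks w (i # ws). smul (fold_coeff lam (i # ws) p) (ev lam (wmon (last p))))"
    unfolding alcove_walks_Cons sum.reindex[OF inj] o_apply
    by (subst sum.union_disjoint[OF finite_alcove_walks finite_alcove_walks dj]) (rule add.commute)
  finally show ?case .
qed

lemma ip_perm_act_s_perm: "ip x (perm_act (s_perm i) y) = ip (perm_act (s_perm i) x) (y :: 'r::{finite,linorder} weight)"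
  unfolding ip_def by (rule sum.reindex_bij_witness[of _ "s_perm i" "s_perm i"]) simp_all

lemma ip_fold_s_perm:
  "ip lam (fold (\<lambda>i. perm_act (s_perm i)) ws \<alpha>) = ip (perm_act (word_perm ws) lam) (\<alpha> :: 'r::{finite,linorder} weight)"
proof (induction ws arbitrary: \<alpha>)
  case (Cons i ws)
  then show ?case unfolding word_perm_simps perm_act_comp[OF bij_s_perm bij_word_perm] by (simp add: ip_perm_act_s_perm)
qed (simp add: word_perm_def word_prod_def sym_gp_def)

text \<open>Each letter of a reduced word adds one inversion; pairing \<lambda> with the root moved
  through the later letters gives the argument of its \<sigma>-factor.\<close>

lemma inv_coeff_reduced:
  assumes "perm_reduced us (u :: 'r::{finite,linorder} \<Rightarrow> 'r)"
  shows "(\<Prod>a\<in>{1..length us}. sigma n sg (ip lam (fold (\<lambda>i. perm_act (s_perm i)) (drop a us) (simple_root (us ! (a - 1)))))) = inv_coeff lam u"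
proof -
  let ?g = "\<lambda>us a. sigma n sg (ip lam (fold (\<lambda>i. perm_act (s_perm i)) (drop a us) (simple_root (us ! (a - 1)))))"
  have "word_perm us = u \<and> prod (?g us) {1..length us} = inv_coeff lam u"
  proof (rule perm_reduced_induct[OF assms, where P="\<lambda>us u. word_perm us = u \<and> prod (?g us) {1..length us} = inv_coeff lam u"])
    show "word_perm [] = id \<and> prod (?g []) {1..length []} = inv_coeff lam (id :: 'r \<Rightarrow> 'r)" by simp
  next
    fix i ws and p :: "'r \<Rightarrow> 'r"
    assume i: "1 \<le> i" "i < CARD('r)" and p: "bij p" "inv p (coord i) < inv p (coord (i + 1))"
      and IH: "word_perm ws = p \<and> prod (?g ws) {1..length ws} = inv_coeff lam p"
    have "prod (?g (i # ws)) {1..length (i # ws)} = ?g (i # ws) 1 * (\<Prod>a\<in>{1..length ws}. ?g (i # ws) (Suc a))"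
      unfolding length_Cons by (rule prod_interval_Suc)
    also have "(\<Prod>a\<in>{1..length ws}. ?g (i # ws) (Suc a)) = prod (?g ws) {1..length ws}"
      by (rule prod.cong) (auto simp: nth_Cons')
    also have "?g (i # ws) 1 = sigma n sg (ip (perm_act p lam) (simple_root i))"
      using IH by (simp add: ip_fold_s_perm)
    finally have "prod (?g (i # ws)) {1..length (i # ws)} = inv_coeff lam (s_perm i \<circ> p)"
      using IH unfolding inv_coeff_s_perm[OF p(1) i p(2)] by simp
    then show "word_perm (i # ws) = s_perm i \<circ> p \<and> prod (?g (i # ws)) {1..length (i # ws)} = inv_coeff lam (s_perm i \<circ> p)"
      using IH by simp
  qed
  then show ?thesis by simp
qed

end

section \<open>The basis of eigenvectors\<close>

text \<open>The element of the level-1 group acting on weights with its translation scaled by n,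
  which realizes the identification of the two affine groups.\<close>

definition aff_point :: "nat \<Rightarrow> 'r::{finite,linorder} aff \<Rightarrow> 'r weight \<Rightarrow> 'r weight"
  where "aff_point n w x = int n *s fst w + perm_act (snd w) x"

lemma aff_point_wmult:
  assumes "bij (snd w)"
  shows "aff_point n (wmult w i) x = aff_point n w (refl_act n i x)"
  using assms by (simp add: aff_point_def wmult_eq refl_act_simps perm_act_comp perm_act_add perm_act_scale vector_add_ldistrib)

lemma aff_point_foldl:
  assumes "bij (snd w)"
  shows "bij (snd (foldl wmult w ws)) \<and> aff_point n (foldl wmult w ws) x = aff_point n w (word_act n ws x)"
  using assms
proof (induction ws arbitrary: w)
  case (Cons i ws)
  have "bij (snd (wmult w i))" using Cons.prems by (rule bij_snd_wmult)
  from Cons.IH[OF this] show ?case by (simp add: aff_point_wmult[OF Cons.prems])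
qed simp

lemma perm_reduced_Nil: "perm_reduced [] (id :: 'r::{finite,linorder} \<Rightarrow> 'r)"
proof -
  have "word_prod sym_gp s_perm [] = (id :: 'r \<Rightarrow> 'r)" by (simp add: word_prod_def sym_gp_def)
  then have "cox_length sym_gp s_perm {1..<CARD('r)} (id :: 'r \<Rightarrow> 'r) = 0"
    unfolding cox_length_def by (intro Least_eq_0) (intro exI[of _ "[]"], simp)
  then show ?thesis using \<open>word_prod sym_gp s_perm [] = (id :: 'r \<Rightarrow> 'r)\<close>
    by (simp add: perm_reduced_def reduced_word_def)
qed

context metaplectic_params begin

lemma ev_wmon: "bij (snd w) \<Longrightarrow> ev lam (wmon w) = smul (inv_coeff lam (snd w)) (x_pow (aff_point n w lam))"
  by (simp add: wmon_def ev_mon aff_point_def)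

text \<open>Taking the crossing in every factor follows the whole word; every other choice drops a
  letter and ends at a weight reached by a shorter word.\<close>

lemma right_prod_leading:
  fixes lam :: "'r::{finite,linorder} weight"
  assumes r2: "CARD('r) \<ge> 2" and "set ws \<subseteq> {0..<CARD('r)}" "bij (snd w)"
  shows "ev lam (right_prod lam ws (wmon w)) - ev lam (wmon (foldl wmult w ws)) \<in>
    laurent_vs.span {x_pow (aff_point n w (word_act n vs lam)) | vs. set vs \<subseteq> {0..<CARD('r)} \<and> length vs < length ws}"
  using assms(2,3)
proof (induction ws arbitrary: w)
  case Nil
  then show ?case by (simp add: laurent_vs.span_zero)
next
  case (Cons i ws)
  let ?B = "\<lambda>w m. {x_pow (aff_point n w (word_act n vs lam)) | vs. set vs \<subseteq> {0..<CARD('r)} \<and> length vs < m} :: ('r, 'v) laurent set"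
  let ?w' = "wmult w i" and ?m = "length (i # ws)"
  let ?c = "kd (neg_side_alcove w i) + bcoef i (word_act n ws lam) :: 'v pfield"
  have i: "i < CARD('r)" and ws: "set ws \<subseteq> {0..<CARD('r)}" using Cons.prems by auto
  have w': "bij (snd ?w')" by (rule bij_snd_wmult[OF Cons.prems(2)])
  have s1: "?B ?w' (length ws) \<subseteq> ?B w ?m"
  proof clarify
    fix vs assume vs: "set vs \<subseteq> {0..<CARD('r)}" "length vs < length ws"
    have "aff_point n ?w' (word_act n vs lam) = aff_point n w (word_act n (i # vs) lam)"
      by (simp add: aff_point_wmult[OF Cons.prems(2)])
    then show "\<exists>vs'. x_pow (aff_point n ?w' (word_act n vs lam)) = (x_pow (aff_point n w (word_act n vs' lam)) :: ('r, 'v) laurent) \<and> set vs' \<subseteq> {0..<CARD('r)} \<and> length vs' < ?m"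
      using vs i by (intro exI[of _ "i # vs"]) auto
  qed
  have s2: "?B w (length ws) \<subseteq> ?B w ?m" by auto
  have 1: "ev lam (right_prod lam ws (wmon ?w')) - ev lam (wmon (foldl wmult ?w' ws)) \<in> laurent_vs.span (?B w ?m)"
    using Cons.IH[OF ws w'] laurent_vs.span_mono[OF s1] by blast
  have 2: "ev lam (right_prod lam ws (wmon w)) - ev lam (wmon (foldl wmult w ws)) \<in> laurent_vs.span (?B w ?m)"
    using Cons.IH[OF ws Cons.prems(2)] laurent_vs.span_mono[OF s2] by blast
  have fl: "bij (snd (foldl wmult w ws))" "aff_point n (foldl wmult w ws) lam = aff_point n w (word_act n ws lam)"
    using aff_point_foldl[OF Cons.prems(2)] by auto
  \<comment> \<open>The summand that drops the letter i is lower as a whole: even its leading weight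
    is reached by the shorter word \<open>ws\<close>.\<close>
  have "x_pow (aff_point n w (word_act n ws lam)) \<in> ?B w ?m" using ws by auto
  then have 3: "ev lam (wmon (foldl wmult w ws)) \<in> laurent_vs.span (?B w ?m)"
    unfolding ev_wmon[OF fl(1)] fl(2) by (intro laurent_vs.span_scale laurent_vs.span_base)
  have 4: "ev lam (right_prod lam ws (wmon w)) \<in> laurent_vs.span (?B w ?m)"
    using laurent_vs.span_add[OF 2 3] by simp
  have "hadd (Rgen i (wmon w)) (hsmul (bcoef i (word_act n ws lam)) (wmon w)) = hadd (wmon ?w') (hsmul ?c (wmon w :: ('r, 'v) hmod))"
    unfolding Rgen_wmon[OF r2 i Cons.prems(2)] by (auto simp: hadd_def hsmul_def smul_simps fun_eq_iff)
  then have "ev lam (right_prod lam (i # ws) (wmon w)) = ev lam (right_prod lam ws (wmon ?w')) + smul ?c (ev lam (right_prod lam ws (wmon w)))"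
    by (simp add: right_prod_lin ev_add ev_smul)
  then have "ev lam (right_prod lam (i # ws) (wmon w)) - ev lam (wmon (foldl wmult w (i # ws))) = 
    (ev lam (right_prod lam ws (wmon ?w')) - ev lam (wmon (foldl wmult ?w' ws))) + smul ?c (ev lam (right_prod lam ws (wmon w)))"
    by simp
  also have "\<dots> \<in> laurent_vs.span (?B w ?m)"
    by (intro laurent_vs.span_add[OF 1] laurent_vs.span_scale[OF 4])
  finally show ?case .
qed

lemma tau_prod_leading:
  fixes lam :: "'r::{finite,linorder} weight"
  assumes r2: "CARD('r) \<ge> 2" and ws: "set ws \<subseteq> {0..<CARD('r)}" and lam: "lam \<in> fund_alcove_weights n"
  shows "\<exists>c. c \<noteq> 0 \<and> tau_prod lam ws - smul c (x_pow (word_act n ws lam)) \<in>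
    laurent_vs.span {x_pow (word_act n vs lam) | vs. set vs \<subseteq> {0..<CARD('r)} \<and> length vs < length ws}"
proof -
  have "aff_point n (0, id) x = x" for x :: "'r weight" by (simp add: aff_point_def)
  moreover have "tau_prod lam ws = ev lam (right_prod lam ws (wmon (0, id)))"
    using T_word_tau_prod[OF r2 ws lam perm_reduced_Nil] by (simp add: T_word_def wmon_def)
  moreover have fl: "bij (snd (foldl wmult (0, id :: 'r \<Rightarrow> 'r) ws))" 
    "aff_point n (foldl wmult (0, id) ws) lam = aff_point n (0, id) (word_act n ws lam)"
    using aff_point_foldl[of "(0, id :: 'r \<Rightarrow> 'r)"] by auto
  ultimately have "tau_prod lam ws - smul (inv_coeff lam (snd (foldl wmult (0, id) ws))) (x_pow (word_act n ws lam)) \<in>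
    laurent_vs.span {x_pow (word_act n vs lam) | vs. set vs \<subseteq> {0..<CARD('r)} \<and> length vs < length ws}"
    using right_prod_leading[OF r2 ws, of "(0, id)" lam] unfolding ev_wmon[OF fl(1)] by simp
  then show ?thesis using inv_coeff_nz by blast
qed

lemma lookup_span_zero:
  assumes "f \<in> laurent_vs.span {x_pow (g v) | v. P v}" "\<And>v. P v \<Longrightarrow> g v \<noteq> \<mu>"
  shows "Poly_Mapping.lookup f \<mu> = 0"
  using assms(1)
proof (induction rule: laurent_vs.span_induct_alt)
  case base
  show ?case by simp
next
  case (step c x y)
  then obtain v where "x = x_pow (g v)" "P v" by auto
  then show ?case using step assms(2)[of v] by (simp add: lookup_add lookup_x_pow)
qed

text \<open>A letter that fixes the weight could be deleted, and a suffix of a shortest word is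
  again shortest.\<close>

lemma regular_word_minimal:
  fixes lam :: "'r::{finite,linorder} weight"
  assumes "set ws \<subseteq> {0..<CARD('r)}"
    "\<And>vs. set vs \<subseteq> {0..<CARD('r)} \<Longrightarrow> word_act n vs lam = word_act n ws lam \<Longrightarrow> length ws \<le> length vs"
  shows "regular_word lam ws"
  using assms
proof (induction ws)
  case (Cons i ws)
  have "length ws \<le> length vs" if "set vs \<subseteq> {0..<CARD('r)}" "word_act n vs lam = word_act n ws lam" for vs
    using Cons.prems(2)[of "i # vs"] Cons.prems(1) that by simp
  then have "regular_word lam ws" using Cons by simp
  moreover have "refl_act n i (word_act n ws lam) \<noteq> word_act n ws lam"
    using Cons.prems(2)[of ws] Cons.prems(1) by auto
  ultimately show ?case by simp
qed simp

end

text \<open>The witness fixes the index type, so that the bound on the rank can be an assumption of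
  the locale.\<close>

locale metaplectic_rank = metaplectic_params n sg for n :: nat and sg :: "'v::{finite,linorder} pfield" +
  fixes rank_witness :: "'r::{finite,linorder} itself"
  assumes r2: "CARD('r) \<ge> 2"
begin

definition word_rep :: "'r weight \<Rightarrow> 'r weight \<times> nat list \<Rightarrow> bool"
  where "word_rep \<nu> x \<longleftrightarrow> fst x \<in> fund_alcove_weights n \<and> set (snd x) \<subseteq> {0..<CARD('r)} \<and> word_act n (snd x) (fst x) = \<nu>"

text \<open>Some shortest way to reach \<nu> from the closed alcove; its length is the grading with
  respect to which the eigenvectors are triangular.\<close>

definition min_rep :: "'r weight \<Rightarrow> 'r weight \<times> nat list"
  where "min_rep \<nu> = arg_min (\<lambda>x. length (snd x)) (word_rep \<nu>)"

definition depth :: "'r weight \<Rightarrow> nat"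
  where "depth \<nu> = length (snd (min_rep \<nu>))"

lemma min_rep: "word_rep \<nu> (min_rep \<nu>)" "word_rep \<nu> x \<Longrightarrow> depth \<nu> \<le> length (snd x)"
proof -
  obtain ws lam where "set ws \<subseteq> {0..<CARD('r)}" "lam \<in> fund_alcove_weights n" "\<nu> = word_act n ws lam"
    using reach_fund_alcove[OF r2 n1] by blast
  then have "word_rep \<nu> (lam, ws)" by (simp add: word_rep_def)
  then show "word_rep \<nu> (min_rep \<nu>)" unfolding min_rep_def by (rule arg_min_natI)
  show "word_rep \<nu> x \<Longrightarrow> depth \<nu> \<le> length (snd x)" unfolding depth_def min_rep_def by (rule arg_min_nat_le)
qed

definition eig_basis :: "'r weight \<Rightarrow> ('r, 'v) laurent"
  where "eig_basis \<nu> = tau_prod (fst (min_rep \<nu>)) (snd (min_rep \<nu>))"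

lemma eig_eig_basis: "eig \<nu> (eig_basis \<nu>)"
proof -
  note m = min_rep(1)[of \<nu>, unfolded word_rep_def]
  have "regular_word (fst (min_rep \<nu>)) (snd (min_rep \<nu>))"
  proof (rule regular_word_minimal)
    fix vs assume "set vs \<subseteq> {0..<CARD('r)}" "word_act n vs (fst (min_rep \<nu>)) = word_act n (snd (min_rep \<nu>)) (fst (min_rep \<nu>))"
    then show "length (snd (min_rep \<nu>)) \<le> length vs"
      using min_rep(2)[of \<nu> "(fst (min_rep \<nu>), vs)"] m by (simp add: word_rep_def depth_def)
  qed (use m in simp)
  then show ?thesis using eig_tau_prod[OF r2, of "fst (min_rep \<nu>)" "snd (min_rep \<nu>)"] m by (simp add: eig_basis_def)
qed

lemma eig_basis_leading:
  "\<exists>c. c \<noteq> 0 \<and> eig_basis \<nu> - smul c (x_pow \<nu>) \<in> laurent_vs.span {x_pow \<kappa> | \<kappa>. depth \<kappa> < depth \<nu>}"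
proof -
  note m = min_rep(1)[of \<nu>, unfolded word_rep_def]
  have "{x_pow (word_act n vs (fst (min_rep \<nu>))) | vs. set vs \<subseteq> {0..<CARD('r)} \<and> length vs < length (snd (min_rep \<nu>))}
    \<subseteq> {x_pow \<kappa> | \<kappa>. depth \<kappa> < depth \<nu>}"
  proof clarify
    fix vs assume vs: "set vs \<subseteq> {0..<CARD('r)}" "length vs < length (snd (min_rep \<nu>))"
    have "depth (word_act n vs (fst (min_rep \<nu>))) \<le> length vs"
      using min_rep(2)[of "word_act n vs (fst (min_rep \<nu>))" "(fst (min_rep \<nu>), vs)"] m vs by (simp add: word_rep_def)
    then show "\<exists>\<kappa>. x_pow (word_act n vs (fst (min_rep \<nu>))) = x_pow \<kappa> \<and> depth \<kappa> < depth \<nu>"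
      using vs(2) unfolding depth_def[of \<nu>] by (intro exI[of _ "word_act n vs (fst (min_rep \<nu>))"]) simp
  qed
  from laurent_vs.span_mono[OF this] tau_prod_leading[OF r2, of "snd (min_rep \<nu>)" "fst (min_rep \<nu>)"] m
  show ?thesis unfolding eig_basis_def by auto
qed

lemma lookup_eig_basis:
  "Poly_Mapping.lookup (eig_basis \<nu>) \<nu> \<noteq> 0"
  "\<kappa> \<noteq> \<nu> \<Longrightarrow> depth \<nu> \<le> depth \<kappa> \<Longrightarrow> Poly_Mapping.lookup (eig_basis \<nu>) \<kappa> = 0"
proof -
  obtain c where c: "c \<noteq> 0" "eig_basis \<nu> - smul c (x_pow \<nu>) \<in> laurent_vs.span {x_pow \<kappa> | \<kappa>. depth \<kappa> < depth \<nu>}"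
    using eig_basis_leading by blast
  have z: "Poly_Mapping.lookup (eig_basis \<nu> - smul c (x_pow \<nu>)) \<kappa> = 0" if "depth \<nu> \<le> depth \<kappa>" for \<kappa>
    using lookup_span_zero[OF c(2), of \<kappa>] that by force
  show "Poly_Mapping.lookup (eig_basis \<nu>) \<nu> \<noteq> 0" using z[of \<nu>] c(1) by (simp add: lookup_minus lookup_x_pow)
  show "\<kappa> \<noteq> \<nu> \<Longrightarrow> depth \<nu> \<le> depth \<kappa> \<Longrightarrow> Poly_Mapping.lookup (eig_basis \<nu>) \<kappa> = 0"
    using z[of \<kappa>] by (simp add: lookup_minus lookup_x_pow)
qed

text \<open>The linear map from monomials to eigenvectors; that it is bijective says that the
  eigenvectors form a basis.\<close>

definition from_basis :: "('r, 'v) laurent \<Rightarrow> ('r, 'v) laurent"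
  where "from_basis = lin_ext eig_basis"

lemma lin_from_basis: "lin from_basis" by (simp add: from_basis_def lin_lin_ext)

lemma from_basis_x_pow [simp]: "from_basis (x_pow \<nu>) = eig_basis \<nu>"
  by (simp add: from_basis_def)

text \<open>The triangular system is solved for x^\<nu> by recursion on depth, as its leading
  coefficient is invertible.\<close>

lemma from_basis_surj: "\<exists>g. from_basis g = f"
proof -
  have range_add: "\<exists>g. from_basis g = a + b" if "\<exists>g. from_basis g = a" "\<exists>g. from_basis g = b" for a b
    using that lin_add[OF lin_from_basis] by metis
  have range_smul: "\<exists>g. from_basis g = smul c a" if "\<exists>g. from_basis g = a" for a c
    using that lin_smul[OF lin_from_basis] by metis
  have x: "\<exists>g. from_basis g = x_pow \<nu>" for \<nu>
  proof (induction "depth \<nu>" arbitrary: \<nu> rule: less_induct)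
    case less
    obtain c where c: "c \<noteq> 0" "eig_basis \<nu> - smul c (x_pow \<nu>) \<in> laurent_vs.span {x_pow \<kappa> | \<kappa>. depth \<kappa> < depth \<nu>}"
      using eig_basis_leading by blast
    have "\<exists>g. from_basis g = eig_basis \<nu> - smul c (x_pow \<nu>)"
      using c(2)
    proof (induction rule: laurent_vs.span_induct_alt)
      case base
      show ?case using lin_zero[OF lin_from_basis] by blast
    next
      case (step d x y)
      then obtain \<kappa> where "x = x_pow \<kappa>" "depth \<kappa> < depth \<nu>" by auto
      then show ?case using less step(2) range_add range_smul by blast
    qed
    then have "\<exists>g. from_basis g = smul (- inverse c) (eig_basis \<nu> - smul c (x_pow \<nu>)) + smul (inverse c) (eig_basis \<nu>)"
      using range_add range_smul from_basis_x_pow by metis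
    moreover have "smul (- inverse c) (eig_basis \<nu> - smul c (x_pow \<nu>)) + smul (inverse c) (eig_basis \<nu>) = x_pow \<nu>"
      using c(1) by (simp add: smul_simps)
    ultimately show ?case by simp
  qed
  show ?thesis
  proof (induction f rule: laurent_induct)
    case zero
    show ?case using lin_zero[OF lin_from_basis] by blast
  qed (use x range_add range_smul in auto)
qed

text \<open>At a key of maximal depth no other eigenvector of the combination contributes, so the
  coefficient there survives.\<close>

lemma from_basis_inj: 
  assumes "from_basis g = 0" shows "g = 0"
proof (rule ccontr)
  assume "g \<noteq> 0"
  then have "Poly_Mapping.keys g \<noteq> {}" by simp
  then have "Max (depth ` Poly_Mapping.keys g) \<in> depth ` Poly_Mapping.keys g" by (intro Max_in) auto
  then obtain \<nu> where "\<nu> \<in> Poly_Mapping.keys g" "depth \<nu> = Max (depth ` Poly_Mapping.keys g)" by auto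
  then have \<nu>: "\<nu> \<in> Poly_Mapping.keys g" "\<And>\<kappa>. \<kappa> \<in> Poly_Mapping.keys g \<Longrightarrow> depth \<kappa> \<le> depth \<nu>" by auto
  have "Poly_Mapping.lookup (from_basis g) \<nu> = (\<Sum>\<kappa>\<in>Poly_Mapping.keys g. Poly_Mapping.lookup g \<kappa> * Poly_Mapping.lookup (eig_basis \<kappa>) \<nu>)"
    by (simp add: from_basis_def lin_ext_def lookup_sum)
  also have "\<dots> = (\<Sum>\<kappa>\<in>Poly_Mapping.keys g. if \<kappa> = \<nu> then Poly_Mapping.lookup g \<nu> * Poly_Mapping.lookup (eig_basis \<nu>) \<nu> else 0)"
    by (rule sum.cong) (use \<nu>(2) lookup_eig_basis(2) in auto)
  also have "\<dots> = Poly_Mapping.lookup g \<nu> * Poly_Mapping.lookup (eig_basis \<nu>) \<nu>" using \<nu>(1) by simp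
  also have "\<dots> \<noteq> 0" using \<nu>(1) lookup_eig_basis(1) by (simp add: in_keys_iff)
  finally show False using assms by simp
qed

definition diag :: "('r weight \<Rightarrow> 'v pfield) \<Rightarrow> ('r, 'v) laurent \<Rightarrow> ('r, 'v) laurent"
  where "diag d = lin_ext (\<lambda>\<nu>. smul (d \<nu>) (x_pow \<nu>))"

lemma lin_diag: "lin (diag d)" by (simp add: diag_def lin_lin_ext)

lemma lookup_diag: "Poly_Mapping.lookup (diag d g) \<kappa> = d \<kappa> * Poly_Mapping.lookup g \<kappa>"
proof (induction g rule: laurent_induct)
  case (mono c \<mu>)
  show ?case by (simp add: lin_smul[OF lin_diag]) (simp add: diag_def lookup_x_pow)
qed (simp_all add: lin_zero[OF lin_diag] lin_add[OF lin_diag] lookup_add distrib_left)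

lemma Y_from_basis:
  assumes "i \<in> {1..CARD('r)}"
  shows "Y_op n sg i (from_basis g) = from_basis (diag (yval (coord i)) g)"
proof (rule lin_eqI[of "\<lambda>g. Y_op n sg i (from_basis g)" "\<lambda>g. from_basis (diag (yval (coord i)) g)"])
  show "lin (\<lambda>g. Y_op n sg i (from_basis g))" by (rule lin_comp[OF lin_Y_op lin_from_basis]) (use assms in simp)
  show "lin (\<lambda>g. from_basis (diag (yval (coord i)) g))" by (rule lin_comp[OF lin_from_basis lin_diag])
  fix \<nu> :: "'r weight"
  show "Y_op n sg i (from_basis (x_pow \<nu>)) = from_basis (diag (yval (coord i)) (x_pow \<nu>))"
    using eig_eig_basis[of \<nu>] assms by (simp add: eig_def diag_def lin_smul[OF lin_from_basis])
qed

text \<open>The exponent of q in the eigenvalue of index a is -\<nu>_a, so the eigenvalues recover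
  the weight.\<close>

lemma yval_inj:
  assumes "\<And>i. i \<in> {1..CARD('r)} \<Longrightarrow> yval (coord i :: 'r) \<kappa> = yval (coord i) \<nu>"
  shows "\<kappa> = \<nu>"
proof -
  have "\<kappa> $ a = \<nu> $ a" for a
  proof -
    have "yval a \<kappa> = yval a \<nu>" using assms[of "coord_index a"] by simp
    then show ?thesis using qdeg_unique[OF qdeg_gm[of "eps a" 0 \<kappa>]] qdeg_gm[of "eps a" 0 \<nu>]
      by (force simp: yval_def ip_eps_left)
  qed
  then show ?thesis by (simp add: vec_eq_iff)
qed

text \<open>In eigenbasis coordinates every Y_i is diagonal, and a coordinate at another weight is
  annihilated by a nonzero difference of eigenvalues.\<close>

lemma eig_unique:
  assumes "eig \<nu> f"
  shows "\<exists>c. f = smul c (eig_basis \<nu>)"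
proof -
  obtain g where g: "from_basis g = f" using from_basis_surj by blast
  have z: "(yval (coord i) \<kappa> - yval (coord i) \<nu>) * Poly_Mapping.lookup g \<kappa> = 0" if i: "i \<in> {1..CARD('r)}" for i \<kappa>
  proof -
    have "from_basis (diag (yval (coord i)) g - smul (yval (coord i) \<nu>) g) = 0"
      using assms i Y_from_basis[OF i, of g] unfolding g
      by (simp add: lin_diff[OF lin_from_basis] lin_smul[OF lin_from_basis] g eig_def)
    from from_basis_inj[OF this] have "Poly_Mapping.lookup (diag (yval (coord i)) g - smul (yval (coord i) \<nu>) g) \<kappa> = 0" by simp
    then show ?thesis by (simp add: lookup_minus lookup_diag left_diff_distrib)
  qed
  have "g = smul (Poly_Mapping.lookup g \<nu>) (x_pow \<nu>)"
  proof (rule poly_mapping_eqI)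
    fix \<kappa>
    show "Poly_Mapping.lookup g \<kappa> = Poly_Mapping.lookup (smul (Poly_Mapping.lookup g \<nu>) (x_pow \<nu>)) \<kappa>"
    proof (cases "\<kappa> = \<nu>")
      case False
      then obtain i where "i \<in> {1..CARD('r)}" "yval (coord i :: 'r) \<kappa> \<noteq> yval (coord i) \<nu>" using yval_inj by blast
      then show ?thesis using z[of i \<kappa>] False by (simp add: lookup_x_pow)
    qed (simp add: lookup_x_pow)
  qed
  then have "f = smul (Poly_Mapping.lookup g \<nu>) (eig_basis \<nu>)"
    using g lin_smul[OF lin_from_basis] from_basis_x_pow by metis
  then show ?thesis by blast
qed

lemma eig_smul: "eig \<nu> (f :: ('r, 'v) laurent) \<Longrightarrow> eig \<nu> (smul c f)"
  unfolding eig_def using lin_smul[OF lin_Y_op[where 'r='r]] by (simp add: smul_simps mult.commute)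

text \<open>The definite description is met here: the eigenspace is a line on which the coefficient
  at \<nu> does not vanish, so normalization selects one vector.\<close>

lemma E_poly_eq: "E_poly n sg \<nu> = smul (inverse (Poly_Mapping.lookup (eig_basis \<nu>) \<nu>)) (eig_basis \<nu>)"
  unfolding E_poly_def yval_gamma eig_def[symmetric]
proof (rule the_equality)
  let ?f = "smul (inverse (Poly_Mapping.lookup (eig_basis \<nu>) \<nu>)) (eig_basis \<nu>)"
  show "Poly_Mapping.lookup ?f \<nu> = 1 \<and> eig \<nu> ?f"
    using lookup_eig_basis(1) eig_smul[OF eig_eig_basis] by simp
  fix f assume f: "Poly_Mapping.lookup f \<nu> = 1 \<and> eig \<nu> f"
  then obtain c where c: "f = smul c (eig_basis \<nu>)" using eig_unique by blast
  then have "c * Poly_Mapping.lookup (eig_basis \<nu>) \<nu> = 1" using f by simp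
  then show "f = ?f" unfolding c using lookup_eig_basis(1)[of \<nu>] by (metis inverse_unique mult.commute)
qed

lemma linear_iff_lin: "Vector_Spaces.linear smul smul T \<longleftrightarrow> lin (T :: ('r, 'v) laurent \<Rightarrow> ('r, 'v) laurent)"
  unfolding Vector_Spaces.linear_iff lin_def using laurent_vs.vector_space_axioms by auto

text \<open>An operator with the prescribed values exists as a diagonal map in eigenbasis
  coordinates, and a linear map is determined by its values on a basis.\<close>

lemma R_op_E_poly:
  "lin (R_op n sg i :: ('r, 'v) laurent \<Rightarrow> _)"
  "R_op n sg i (E_poly n sg \<nu>) = smul (inverse (1 - gamma n sg (- aff_simple_root n i) \<nu>)) (E_poly n sg \<nu> :: ('r, 'v) laurent)"
proof -
  let ?d = "\<lambda>\<nu> :: 'r weight. inverse (1 - gamma n sg (- aff_simple_root n i) \<nu>)"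
  let ?P = "\<lambda>R :: ('r, 'v) laurent \<Rightarrow> ('r, 'v) laurent. Vector_Spaces.linear smul smul R \<and> (\<forall>\<nu>. R (E_poly n sg \<nu>) = smul (?d \<nu>) (E_poly n sg \<nu>))"
  define inv_basis where "inv_basis f = (SOME g. from_basis g = f)" for f
  have ib: "from_basis (inv_basis f) = f" for f
    unfolding inv_basis_def using someI_ex[OF from_basis_surj] .
  have ib2: "inv_basis (from_basis g) = g" for g
  proof -
    have "from_basis (inv_basis (from_basis g) - g) = 0" by (simp add: lin_diff[OF lin_from_basis] ib)
    from from_basis_inj[OF this] show ?thesis by simp
  qed
  define R0 where "R0 f = from_basis (diag ?d (inv_basis f))" for f
  have R0b: "R0 (from_basis g) = from_basis (diag ?d g)" for g by (simp add: R0_def ib2)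
  have "lin R0"
    unfolding lin_def
  proof (intro conjI allI)
    fix f g c
    show "R0 (f + g) = R0 f + R0 g"
      using R0b[of "inv_basis f + inv_basis g"] by (simp add: lin_add[OF lin_from_basis] lin_add[OF lin_diag] ib R0_def)
    show "R0 (smul c f) = smul c (R0 f)"
      using R0b[of "smul c (inv_basis f)"] by (simp add: lin_smul[OF lin_from_basis] lin_smul[OF lin_diag] ib R0_def)
  qed
  have R0e: "R0 (eig_basis \<nu>) = smul (?d \<nu>) (eig_basis \<nu>)" for \<nu>
    using R0b[of "x_pow \<nu>"] by (simp add: diag_def lin_smul[OF lin_from_basis])
  have "?P R0"
    using \<open>lin R0\<close> by (simp add: linear_iff_lin E_poly_eq lin_smul[OF \<open>lin R0\<close>] R0e smul_simps mult.commute)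
  moreover have "R = R0" if "?P R" for R
  proof
    fix f
    have lR: "lin R" using that by (simp add: linear_iff_lin)
    have e: "eig_basis \<nu> = smul (Poly_Mapping.lookup (eig_basis \<nu>) \<nu>) (E_poly n sg \<nu>)" for \<nu>
      unfolding E_poly_eq using lookup_eig_basis(1) by (simp add: smul_simps)
    have Re: "R (eig_basis \<nu>) = smul (?d \<nu>) (eig_basis \<nu>)" for \<nu>
    proof -
      have "R (eig_basis \<nu>) = smul (Poly_Mapping.lookup (eig_basis \<nu>) \<nu>) (smul (?d \<nu>) (E_poly n sg \<nu>))"
        using that e[of \<nu>] lin_smul[OF lR] by metis
      also have "\<dots> = smul (?d \<nu>) (eig_basis \<nu>)" by (subst (2) e) (simp add: smul_simps mult.commute)
      finally show ?thesis .
    qed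
    have "R (from_basis g) = R0 (from_basis g)" for g
      by (rule lin_eqI[OF lin_comp[OF lR lin_from_basis] lin_comp[OF \<open>lin R0\<close> lin_from_basis]]) (simp add: Re R0e)
    then show "R f = R0 f" using ib by metis
  qed
  ultimately have "?P (THE R. ?P R)" by (rule theI)
  then have "?P (R_op n sg i)" unfolding R_op_def .
  then show "lin (R_op n sg i :: ('r, 'v) laurent \<Rightarrow> _)"
    "R_op n sg i (E_poly n sg \<nu>) = smul (?d \<nu>) (E_poly n sg \<nu> :: ('r, 'v) laurent)"
    by (simp_all add: linear_iff_lin)
qed

text \<open>A joint eigenvector is a multiple of the corresponding \<open>E_poly\<close>, so the
  spectral operator acts on it as a scalar.\<close>

lemma tau_check_eig:
  assumes "eig \<nu> (f :: ('r, 'v) laurent)"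
  shows "tau_check n sg i f = T_check n sg i f + smul (bcoef i \<nu>) f"
proof -
  obtain c where c: "f = smul c (eig_basis \<nu>)" using eig_unique[OF assms] by blast
  then have f: "f = smul (c * Poly_Mapping.lookup (eig_basis \<nu>) \<nu>) (E_poly n sg \<nu>)"
    unfolding E_poly_eq using lookup_eig_basis(1) by (simp add: smul_simps)
  have "R_op n sg i f = smul (inverse (1 - gamma n sg (- aff_simple_root n i) \<nu>)) f"
    unfolding f lin_smul[OF R_op_E_poly(1)] R_op_E_poly(2) by (simp add: smul_simps mult.commute)
  then show ?thesis by (simp add: tau_check_def bcoef_def smul_simps divide_inverse)
qed

lemma tau_check_word:
  assumes "lam \<in> fund_alcove_weights n" "set ws \<subseteq> {0..<CARD('r)}" "regular_word (lam :: 'r weight) ws"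
  shows "comp_list (map (tau_check n sg) ws) (x_pow lam) = tau_prod lam ws"
  using assms(2,3)
proof (induction ws)
  case (Cons i ws)
  have "eig (word_act n ws lam) (tau_prod lam ws)" by (rule eig_tau_prod[OF r2 assms(1)]) (use Cons.prems in auto)
  from tau_check_eig[OF this] Cons show ?case by simp
qed simp

text \<open>Shorter words do not reach this weight, so the coefficient of the product there is its
  nonzero leading coefficient; a nonzero vector spans the eigenline.\<close>

lemma E_poly_tau_prod:
  assumes lam: "lam \<in> fund_alcove_weights n" and ws: "set ws \<subseteq> {0..<CARD('r)}"
    and min: "\<And>vs. set vs \<subseteq> {0..<CARD('r)} \<Longrightarrow> word_act n vs lam = word_act n ws (lam :: 'r weight) \<Longrightarrow> length ws \<le> length vs"
  shows "\<exists>c. c \<noteq> 0 \<and> E_poly n sg (word_act n ws lam) = smul c (tau_prod lam ws)"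
proof -
  let ?\<mu> = "word_act n ws lam"
  have reg: "regular_word lam ws" by (rule regular_word_minimal[OF ws min])
  obtain d where d: "tau_prod lam ws = smul d (eig_basis ?\<mu>)"
    using eig_unique[OF eig_tau_prod[OF r2 lam ws reg]] by blast
  obtain c where c: "c \<noteq> 0" "tau_prod lam ws - smul c (x_pow ?\<mu>) \<in> laurent_vs.span {x_pow (word_act n vs lam) | vs. set vs \<subseteq> {0..<CARD('r)} \<and> length vs < length ws}"
    using tau_prod_leading[OF r2 ws lam] by blast
  have "Poly_Mapping.lookup (tau_prod lam ws - smul c (x_pow ?\<mu>)) ?\<mu> = 0"
    using lookup_span_zero[OF c(2), of ?\<mu>] min by (metis not_le)
  then have "Poly_Mapping.lookup (tau_prod lam ws) ?\<mu> \<noteq> 0" using c(1) by (simp add: lookup_minus lookup_x_pow)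
  then have d0: "d \<noteq> 0" unfolding d by auto
  let ?l = "Poly_Mapping.lookup (eig_basis ?\<mu>) ?\<mu>"
  have "E_poly n sg ?\<mu> = smul (inverse ?l * inverse d) (tau_prod lam ws)"
    unfolding E_poly_eq d using d0 by (simp add: smul_simps)
  moreover have "inverse ?l * inverse d \<noteq> 0" using d0 lookup_eig_basis(1) by simp
  ultimately show ?thesis by blast
qed

end

section \<open>The expansion\<close>

lemma root_lattice_add: "x \<in> root_lattice \<Longrightarrow> y \<in> root_lattice \<Longrightarrow> x + y \<in> root_lattice"
proof -
  assume "x \<in> root_lattice" "y \<in> root_lattice"
  then obtain c d where "x = (\<Sum>\<alpha>\<in>Roots. c \<alpha> *s \<alpha>)" "y = (\<Sum>\<alpha>\<in>Roots. d \<alpha> *s \<alpha>)" unfolding root_lattice_def by blast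
  then have "x + y = (\<Sum>\<alpha>\<in>Roots. (c \<alpha> + d \<alpha>) *s \<alpha>)" by (simp add: vector_sadd_rdistrib sum.distrib)
  then show ?thesis unfolding root_lattice_def by (intro CollectI exI[of _ "\<lambda>\<alpha>. c \<alpha> + d \<alpha>"]) simp
qed

lemma root_lattice_zero: "0 \<in> root_lattice"
  unfolding root_lattice_def by (intro CollectI exI[of _ "\<lambda>_. 0"]) (simp add: vector_smult_lzero)

lemma finite_Roots: "finite (Roots :: 'a::finite weight set)"
proof (rule finite_subset)
  show "Roots \<subseteq> (\<lambda>(a, b). eps a - eps b) ` (UNIV :: ('a \<times> 'a) set)" by (auto simp: Roots_def)
qed simp

lemma root_lattice_root: "\<alpha> \<in> Roots \<Longrightarrow> \<alpha> \<in> root_lattice"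
proof -
  assume a: "\<alpha> \<in> Roots"
  have "(\<Sum>\<beta>\<in>Roots. (if \<beta> = \<alpha> then 1 else 0) *s \<beta>) = \<alpha>"
    using a by (simp add: finite_Roots if_distrib[where f="\<lambda>c. c *s _"] vector_smult_lzero cong: if_cong)
  then show ?thesis unfolding root_lattice_def by (intro CollectI exI[of _ "\<lambda>\<beta>. if \<beta> = \<alpha> then 1 else 0"]) simp
qed

lemma perm_act_Roots: "bij p \<Longrightarrow> \<alpha> \<in> Roots \<Longrightarrow> perm_act p \<alpha> \<in> Roots"
  unfolding Roots_def by (auto simp: perm_act_diff perm_act_eps) (metis inv_f_f_bij(1))

lemma root_lattice_perm_act:
  assumes p: "bij p" and x: "x \<in> root_lattice"
  shows "perm_act p x \<in> root_lattice"
proof -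
  obtain c where x: "x = (\<Sum>\<alpha>\<in>Roots. c \<alpha> *s \<alpha>)" using x unfolding root_lattice_def by blast
  have "perm_act p (\<Sum>\<alpha>\<in>A. c \<alpha> *s \<alpha>) \<in> root_lattice" if "finite A" "A \<subseteq> Roots" for A
    using that
  proof (induction A)
    case empty
    show ?case by (simp add: root_lattice_zero)
  next
    case (insert \<alpha> A)
    have "perm_act p \<alpha> \<in> Roots" using perm_act_Roots[OF p] insert by simp
    then have r: "perm_act p \<alpha> \<in> root_lattice" by (rule root_lattice_root)
    obtain d where d: "perm_act p \<alpha> = (\<Sum>\<beta>\<in>Roots. d \<beta> *s \<beta>)" using r unfolding root_lattice_def by blast
    have "c \<alpha> *s perm_act p \<alpha> = (\<Sum>\<beta>\<in>Roots. (c \<alpha> * d \<beta>) *s \<beta>)"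
      unfolding d by (simp add: vec_eq_iff sum_component sum_distrib_left mult.assoc)
    then have "c \<alpha> *s perm_act p \<alpha> \<in> root_lattice" unfolding root_lattice_def by (intro CollectI exI[of _ "\<lambda>\<beta>. c \<alpha> * d \<beta>"]) simp
    then show ?case using insert by (simp add: perm_act_add perm_act_scale root_lattice_add)
  qed
  then show ?thesis unfolding x using finite_Roots by blast
qed

text \<open>Words give group elements with the same action, so minimality of length among group
  elements can be turned into minimality among words.\<close>

lemma word_prod_WCox:
  assumes r2: "CARD('r::{finite,linorder}) \<ge> 2" and "set ws \<subseteq> {0..<CARD('r)}"
  shows "word_prod (WCox n) (s_aff n) ws \<in> carrier (WCox n :: 'r aff monoid)"
    and "aff_act (word_prod (WCox n) (s_aff n) ws) (x :: 'r weight) = word_act n ws x"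
proof -
  let ?w = "\<lambda>ws. word_prod (WCox n) (s_aff n) ws :: 'r aff"
  have th: "theta \<in> (root_lattice :: 'r weight set)"
    using coord_first_last_ne[OF r2] by (intro root_lattice_root) (auto simp: Roots_def theta_def)
  have step: "?w (i # ws) = (if i = 0 then (int n *s theta + perm_act s_theta (fst (?w ws)), s_theta \<circ> snd (?w ws))
    else (perm_act (s_perm i) (fst (?w ws)), s_perm i \<circ> snd (?w ws)))" for i ws
    by (simp add: word_prod_def WCox_def s_aff_def case_prod_beta)
  have nil: "?w [] = (0, id)" by (simp add: word_prod_def WCox_def)
  have c: "(\<exists>\<beta>\<in>root_lattice. fst (?w ws) = int n *s \<beta>) \<and> bij (snd (?w ws))" for ws
  proof (induction ws)
    case Nil
    have "(0 :: 'r weight) = int n *s 0" by simp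
    then show ?case unfolding nil using root_lattice_zero bij_id by (metis fst_conv snd_conv)
  next
    case (Cons i ws)
    then obtain \<beta> where \<beta>: "\<beta> \<in> root_lattice" "fst (?w ws) = int n *s \<beta>" and b: "bij (snd (?w ws))" by blast
    show ?case
    proof (cases "i = 0")
      case True
      have "fst (?w (i # ws)) = int n *s (theta + perm_act s_theta \<beta>)"
        using True unfolding step by (simp add: \<beta>(2) perm_act_scale vector_add_ldistrib)
      moreover have "theta + perm_act s_theta \<beta> \<in> root_lattice"
        by (intro root_lattice_add th root_lattice_perm_act \<beta>) simp
      moreover have "snd (?w (i # ws)) = s_theta \<circ> snd (?w ws)" using True unfolding step by simp
      ultimately show ?thesis using bij_comp'[OF bij_s_theta b] by metis
    next
      case False
      have "fst (?w (i # ws)) = int n *s perm_act (s_perm i) \<beta>"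
        using False unfolding step by (simp add: \<beta>(2) perm_act_scale)
      moreover have "perm_act (s_perm i) \<beta> \<in> root_lattice"
        by (intro root_lattice_perm_act \<beta>) simp
      moreover have "snd (?w (i # ws)) = s_perm i \<circ> snd (?w ws)" using False unfolding step by simp
      ultimately show ?thesis using bij_comp'[OF bij_s_perm b] by metis
    qed
  qed
  have carr: "g \<in> carrier (WCox n) \<longleftrightarrow> fst g \<in> (\<lambda>\<beta>. int n *s \<beta>) ` root_lattice \<and> bij (snd g)" for g :: "'r aff"
    by (cases g) (auto simp: WCox_def)
  show "?w ws \<in> carrier (WCox n)" unfolding carr using c[of ws] by blast
  have act: "aff_act g x = fst g + perm_act (snd g) x" for g :: "'r aff" and x
    by (simp add: aff_act_def vec_eq_iff)
  show "aff_act (?w ws) x = word_act n ws x"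
  proof (induction ws)
    case Nil
    show ?case unfolding nil act by simp
  next
    case (Cons i ws)
    have b: "bij (snd (?w ws))" using c by blast
    show ?case
    proof (cases "i = 0")
      case True
      have "aff_act (?w (i # ws)) x = int n *s theta + perm_act s_theta (aff_act (?w ws) x)"
        using True unfolding act step by (simp add: perm_act_comp[OF bij_s_theta b] perm_act_add del: o_apply)
      then show ?thesis using True Cons by (simp add: refl_act_simps)
    next
      case False
      have "aff_act (?w (i # ws)) x = perm_act (s_perm i) (aff_act (?w ws) x)"
        using False unfolding act step by (simp add: perm_act_comp[OF bij_s_perm b] perm_act_add del: o_apply)
      then show ?thesis using False Cons by (simp add: refl_act_simps)
    qed
  qed
qed

theorem theorem3p15:
  fixes n :: nat
    and sg :: "'v::{finite,linorder} pfield"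
    and \<mu> lam :: "'r::{finite,linorder} weight"
    and u :: "'r \<Rightarrow> 'r"
    and w :: "'r aff"
    and us ws :: "nat list"
    and red :: "'r aff list \<Rightarrow> nat list"
  assumes "CARD('r) \<ge> 2" and "n \<ge> 1"
    and "CARD('v) = (n - 1) div 2 + 2"
    and "sg \<in> {1, -1}"
    and "u \<in> carrier sym_gp" and "perm_reduced us u"
    and "lam \<in> fund_alcove_weights n"
    and "w \<in> carrier (WCox n)" and "aff_act w lam = \<mu>"
    and "\<And>w'. w' \<in> carrier (WCox n) \<Longrightarrow> aff_act w' lam = \<mu> \<Longrightarrow> aff_length n w \<le> aff_length n w'"
    and "aff_reduced n ws w"
    and "\<And>p. p \<in> alcove_walks (0, u) ws \<Longrightarrow> perm_reduced (red p) (walk_phi p)"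
  shows "(\<exists>c. c \<noteq> 0 \<and>
           T_word n sg us (E_poly n sg \<mu>) =
           smul c (T_word n sg us (comp_list (map (tau_check n sg) ws) (x_pow lam)))) \<and>
         T_word n sg us (comp_list (map (tau_check n sg) ws) (x_pow lam)) =
           (\<Sum>p\<in>alcove_walks (0, u) ws.
              smul (walk_coeff n sg lam ws (red p) p)
                (x_pow (int n *s walk_wt p + perm_act (walk_phi p) lam)))"
proof -
  interpret metaplectic_rank n sg "TYPE('r)"
    by unfold_locales (use assms(1-4) in auto)
  note lam = assms(7)
  have u: "bij u" using assms(5) by (simp add: sym_gp_def)
  have ws: "set ws \<subseteq> {0..<CARD('r)}" and w: "word_prod (WCox n) (s_aff n) ws = w" and len: "length ws = aff_length n w"
    using assms(11) by (auto simp: aff_reduced_def reduced_word_def aff_length_def)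
  have \<mu>: "word_act n ws lam = \<mu>" using word_prod_WCox(2)[OF assms(1) ws, of n lam] assms(9) w by simp
  \<comment> \<open>Any competing word represents a group element that also sends \<lambda> to
    \<mu>, and the length of this element is at most that of the word.\<close>
  have min: "length ws \<le> length vs" if vs: "set vs \<subseteq> {0..<CARD('r)}" "word_act n vs lam = word_act n ws lam" for vs
  proof -
    let ?w' = "word_prod (WCox n) (s_aff n) vs :: 'r aff"
    have "aff_length n w \<le> aff_length n ?w'"
      using assms(10)[OF word_prod_WCox(1)[OF assms(1) vs(1)]] word_prod_WCox(2)[OF assms(1) vs(1), of n lam] vs(2) \<mu> by simp
    also have "aff_length n ?w' \<le> length vs"
      unfolding aff_length_def cox_length_def by (rule Least_le) (use vs(1) in blast)
    finally show ?thesis using len by simp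
  qed
  have reg: "regular_word lam ws" by (rule regular_word_minimal[OF ws min])
  note tau = tau_check_word[OF lam ws reg]
  have "lin (T_word n sg us :: ('r, 'v) laurent \<Rightarrow> _)" unfolding T_word_def by (rule lin_comp_list) simp
  moreover obtain c where "c \<noteq> 0" "E_poly n sg \<mu> = smul c (tau_prod lam ws)"
    using E_poly_tau_prod[OF lam ws min] unfolding \<mu> by blast
  ultimately have 1: "\<exists>c. c \<noteq> 0 \<and> T_word n sg us (E_poly n sg \<mu>) = smul c (T_word n sg us (tau_prod lam ws))"
    using lin_smul by metis
  have "T_word n sg us (tau_prod lam ws) = ev lam (right_prod lam ws (wmon (0, u)))"
    using T_word_tau_prod[OF assms(1) ws lam assms(6)] by (simp add: wmon_def)
  also have "\<dots> = (\<Sum>p\<in>alcove_walks (0, u) ws. smul (fold_coeff lam ws p) (ev lam (wmon (last p))))"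
    by (rule ev_right_prod_walks[OF assms(1) ws reg]) (simp add: u)
  also have "\<dots> = (\<Sum>p\<in>alcove_walks (0, u) ws. smul (walk_coeff n sg lam ws (red p) p)
                (x_pow (int n *s walk_wt p + perm_act (walk_phi p) lam)))"
  proof (rule sum.cong)
    fix p assume p: "p \<in> alcove_walks (0, u) ws"
    have b: "bij (snd (last p))" using bij_last_walk[OF p] u by simp
    \<comment> \<open>The \<sigma>-product over the chosen reduced word is the coefficient that
      \<open>ev\<close> attaches to the endpoint, whichever word was chosen.\<close>
    have "walk_coeff n sg lam ws (red p) p = fold_coeff lam ws p * inv_coeff lam (walk_phi p)"
      unfolding walk_coeff_def fold_coeff_def inv_coeff_reduced[OF assms(12)[OF p]] by (simp only: ac_simps)
    then show "smul (fold_coeff lam ws p) (ev lam (wmon (last p))) = smul (walk_coeff n sg lam ws (red p) p)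
                (x_pow (int n *s walk_wt p + perm_act (walk_phi p) lam))"
      unfolding ev_wmon[OF b] by (simp add: smul_simps walk_phi_def walk_wt_def aff_point_def)
  qed simp
  finally have 2: "T_word n sg us (tau_prod lam ws) = (\<Sum>p\<in>alcove_walks (0, u) ws. smul (walk_coeff n sg lam ws (red p) p)
                (x_pow (int n *s walk_wt p + perm_act (walk_phi p) lam)))" .
  show ?thesis unfolding tau using 1 2 by simp
qed

end
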